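(* Let $2<\alpha<Q$. Then for every $\phi\in C_0^\infty(\mathbb{R}^n\setminus\{0\})$, $$\int_{\mathbb{R}^n}\rho^{\alpha}\frac{|\Delta_\gamma\phi|^2}{|\nabla_\gamma\rho|^2}\,dz\ \ge\ \frac{(Q-\alpha)^2}{4}\int_{\mathbb{R}^n}\rho^{\alpha}\frac{|\nabla_\gamma\phi|^2}{\rho^2}\,dz .$$ Moreover the constant $\big(\frac{Q-\alpha}{2}\big)^2$ is sharp, i.e. it equals the infimum of the ratio of the left-hand integral to $\int_{\mathbb{R}^n}\rho^{\alpha-2}|\nabla_\gamma\phi|^2\,dz$ over all nonzero admissible $\phi$.
   Context: Points of $\mathbb{R}^n$ are written $z=(x,y)$ with $x\in\mathbb{R}^m$, $y\in\mathbb{R}^k$, $m,k\ge1$, $n=m+k$, and $\gamma>0$. The Baouendi–Grushin gradient is $\nabla_\gamma=(\partial_{x_1},\dots,\partial_{x_m},|x|^\gamma\partial_{y_1},\dots,|x|^\gamma\partial_{y_k})$, and the Baouendi–Grushin operator is $\Delta_\gamma=\nabla_\gamma\cdot\nabla_\gamma=\Delta_x+|x|^{2\gamma}\Delta_y$. The homogeneous dimension is $Q=m+(1+\gamma)k$. The gauge is $\rho(z)=\big(|x|^{2(1+\gamma)}+(1+\gamma)^2|y|^2\big)^{\frac{1}{2(1+\gamma)}}$; one has $|\nabla_\gamma\rho|=|x|^\gamma/\rho^\gamma$. The integral on the left-hand side is allowed to be $+\infty$. *)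

theory Defs
  imports "HOL-Analysis.Analysis"
begin

type_synonym ('m,'k) pt = "(real^'m) \<times> (real^'k)"

definition dirderiv :: "('a::real_normed_vector) \<Rightarrow> ('a \<Rightarrow> real) \<Rightarrow> 'a \<Rightarrow> real" where
  "dirderiv v f z = frechet_derivative f (at z) v"

fun iter_dirderiv :: "('a::real_normed_vector) list \<Rightarrow> ('a \<Rightarrow> real) \<Rightarrow> 'a \<Rightarrow> real" where
  "iter_dirderiv [] f = f"
| "iter_dirderiv (v # vs) f = dirderiv v (iter_dirderiv vs f)"

definition smooth :: "('a::real_normed_vector \<Rightarrow> real) \<Rightarrow> bool" where
  "smooth f \<longleftrightarrow> (\<forall>vs z. iter_dirderiv vs f differentiable (at z))"

definition tsupport :: "('a::topological_space \<Rightarrow> real) \<Rightarrow> 'a set" where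
  "tsupport f = closure {z. f z \<noteq> 0}"

definition test_fun :: "('a::{real_normed_vector} \<Rightarrow> real) \<Rightarrow> bool" where
  "test_fun f \<longleftrightarrow> smooth f \<and> compact (tsupport f) \<and> 0 \<notin> tsupport f"

definition ex :: "'m::finite \<Rightarrow> ('m,'k::finite) pt" where
  "ex i = (axis i 1, 0)"

definition ey :: "'k::finite \<Rightarrow> ('m::finite,'k) pt" where
  "ey j = (0, axis j 1)"

definition grushin_grad_sq :: "real \<Rightarrow> (('m::finite,'k::finite) pt \<Rightarrow> real) \<Rightarrow> ('m,'k) pt \<Rightarrow> real" where
  "grushin_grad_sq \<gamma> f z =
     (\<Sum>i\<in>UNIV. (dirderiv (ex i) f z)\<^sup>2)
     + (norm (fst z) powr \<gamma>)\<^sup>2 * (\<Sum>j\<in>UNIV. (dirderiv (ey j) f z)\<^sup>2)"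

definition grushin_lap :: "real \<Rightarrow> (('m::finite,'k::finite) pt \<Rightarrow> real) \<Rightarrow> ('m,'k) pt \<Rightarrow> real" where
  "grushin_lap \<gamma> f z =
     (\<Sum>i\<in>UNIV. dirderiv (ex i) (dirderiv (ex i) f) z)
     + (norm (fst z) powr \<gamma>)\<^sup>2 * (\<Sum>j\<in>UNIV. dirderiv (ey j) (dirderiv (ey j) f) z)"

definition gauge :: "real \<Rightarrow> ('m::finite,'k::finite) pt \<Rightarrow> real" where
  "gauge \<gamma> z = (norm (fst z) powr (2*(1+\<gamma>)) + (1+\<gamma>)\<^sup>2 * (norm (snd z))\<^sup>2) powr (1 / (2*(1+\<gamma>)))"

definition hom_dim :: "real \<Rightarrow> ('m::finite,'k::finite) pt itself \<Rightarrow> real" where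
  "hom_dim \<gamma> _ = real CARD('m) + (1+\<gamma>) * real CARD('k)"

definition lhs_int :: "real \<Rightarrow> real \<Rightarrow> (('m::finite,'k::finite) pt \<Rightarrow> real) \<Rightarrow> ennreal" where
  "lhs_int \<gamma> \<alpha> \<phi> = (\<integral>\<^sup>+ z. ennreal (gauge \<gamma> z powr \<alpha> * (grushin_lap \<gamma> \<phi> z)\<^sup>2
                                      / grushin_grad_sq \<gamma> (gauge \<gamma>) z) \<partial>lborel)"

definition rhs_int :: "real \<Rightarrow> real \<Rightarrow> (('m::finite,'k::finite) pt \<Rightarrow> real) \<Rightarrow> ennreal" where
  "rhs_int \<gamma> \<alpha> \<phi> = (\<integral>\<^sup>+ z. ennreal (gauge \<gamma> z powr \<alpha> * grushin_grad_sq \<gamma> \<phi> z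
                                      / (gauge \<gamma> z)\<^sup>2) \<partial>lborel)"

end

theory Submission
  imports Defs
begin

text \<open>
  Write \<open>h = \<rho>\<^sup>\<tau>\<close> with \<open>\<tau> = 2(1 + \<gamma>)\<close>, \<open>r = |x|\<^sup>2\<^sup>\<gamma>\<close>, \<open>A = (Q + \<alpha> - 4)/2\<close>, \<open>B = (Q - \<alpha>)/2\<close>, and let
  \<open>R = \<integral> \<rho>\<^sup>\<alpha>\<^sup>-\<^sup>2 |\<nabla>\<phi>|\<^sup>2\<close>, \<open>P = \<integral> \<rho>\<^sup>\<alpha>\<^sup>-\<^sup>2 \<phi> \<Delta>\<phi>\<close>, \<open>N = \<integral> \<rho>\<^sup>\<alpha>\<^sup>-\<^sup>4 |\<nabla>\<rho>|\<^sup>2 \<phi>\<^sup>2\<close> (all operators are the Grushin ones).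
  Two integrations by parts give \<open>P = - R + A (A - B) N\<close>, and expanding
  \<open>\<integral> \<rho>\<^sup>\<alpha>\<^sup>-\<^sup>2 |\<nabla>\<phi> + A \<phi> \<nabla>\<rho>/\<rho>|\<^sup>2 \<ge> 0\<close> gives the Hardy inequality \<open>R \<ge> A\<^sup>2 N\<close>. Expanding the square of
  \<open>\<rho>\<^sup>\<alpha>\<^sup>/\<^sup>2 \<Delta>\<phi> / |\<nabla>\<rho>| + A B \<rho>\<^sup>\<alpha>\<^sup>/\<^sup>2\<^sup>-\<^sup>2 |\<nabla>\<rho>| \<phi>\<close> bounds the left-hand side below by
  \<open>- 2 A B P - A\<^sup>2 B\<^sup>2 N = B\<^sup>2 R + B (2 A - B) (R - A\<^sup>2 N)\<close>, and \<open>2 A \<ge> B\<close> because \<open>\<alpha> > 2\<close>.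

  The radial function \<open>\<rho>\<^sup>-\<^sup>A\<close> is a virtual extremal: on it both integrands are multiples of
  \<open>\<rho>\<^sup>-\<^sup>Q |\<nabla>\<rho>|\<^sup>2 dz\<close>, a measure giving the same mass to every dyadic shell \<open>2\<^sup>j \<le> h < 2\<^sup>j\<^sup>+\<^sup>1\<close>. Cutting it off
  so that \<open>n\<close> shells are untouched costs a bounded amount, which is negligible against \<open>n\<close>. Since \<open>h\<close> is
  not smooth where \<open>x = 0\<close>, it is replaced by \<open>|x|\<^sup>\<tau> exp (- b/|x|\<^sup>2) + (1 + \<gamma>)\<^sup>2 |y|\<^sup>2\<close> with \<open>b \<longlonglongrightarrow> 0\<close>; the operator
  \<open>\<Delta>\<close> of the latter is \<open>O(r)\<close> uniformly in \<open>b\<close>, which compensates the singular weight \<open>|\<nabla>\<rho>|\<^sup>-\<^sup>2\<close>.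
\<close>

section \<open>Integration of directional derivatives\<close>

lemma dirderiv_eq: "(f has_derivative D) (at z) \<Longrightarrow> dirderiv v f z = D v"
  by (metis dirderiv_def frechet_derivative_at)

lemma has_derivative_dirderiv:
  "f differentiable (at z) \<Longrightarrow> (f has_derivative (\<lambda>v. dirderiv v f z)) (at z)"
  unfolding dirderiv_def by (metis frechet_derivative_works eta_contract_eq)

lemma has_real_derivative_line:
  fixes f :: "'a::real_normed_vector \<Rightarrow> real"
  assumes "(f has_derivative D) (at z)"
  shows "((\<lambda>t. f (z + t *\<^sub>R v)) has_real_derivative D v) (at 0)"
proof -
  have "((\<lambda>t::real. z + t *\<^sub>R v) has_derivative (\<lambda>t. t *\<^sub>R v)) (at 0)"
    by (auto intro!: derivative_eq_intros)
  from diff_chain_at[OF this, of f D] assms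
  have "((\<lambda>t. f (z + t *\<^sub>R v)) has_derivative (\<lambda>t. D (t *\<^sub>R v))) (at 0)"
    by (simp add: o_def)
  moreover have "(\<lambda>t. D (t *\<^sub>R v)) = (\<lambda>t. D v * t)"
    using linear_scale[OF has_derivative_linear[OF assms]] by (auto simp: mult.commute)
  ultimately show ?thesis by (simp add: has_field_derivative_def)
qed

lemma has_real_derivative_line_dirderiv:
  fixes f :: "'a::real_normed_vector \<Rightarrow> real"
  assumes "f differentiable (at z)"
  shows "((\<lambda>t. f (z + t *\<^sub>R v)) has_real_derivative dirderiv v f z) (at 0)"
  using has_real_derivative_line[OF has_derivative_dirderiv[OF assms]] .

lemma line_derivative_shift:
  fixes F G :: "'a::real_normed_vector \<Rightarrow> real"
  assumes "\<And>z. ((\<lambda>t. F (z + t *\<^sub>R v)) has_real_derivative G z) (at 0)"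
  shows "((\<lambda>t. F (z + t *\<^sub>R v)) has_real_derivative G (z + s *\<^sub>R v)) (at s)"
proof -
  have "((\<lambda>t. F (z + s *\<^sub>R v + t *\<^sub>R v)) has_real_derivative G (z + s *\<^sub>R v)) (at 0)"
    by (rule assms)
  then have "((\<lambda>t. F (z + (t + s) *\<^sub>R v)) has_real_derivative G (z + s *\<^sub>R v)) (at 0)"
    by (simp add: algebra_simps)
  then show ?thesis by (simp add: DERIV_at_within_shift_lemma[of "\<lambda>t. F (z + t *\<^sub>R v)"] DERIV_shift[of _ _ 0 s, simplified])
qed

text \<open>\<open>G\<close> is the pointwise limit of difference quotients of \<open>F\<close>
  along \<open>v\<close>; each of them integrates to 0 by translation invariance, and the mean value
  theorem bounds them all by \<open>M\<close>, so dominated convergence applies. Using only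
  derivatives along lines covers the weight |x|^(2\<gamma>), which may fail to be differentiable
  where x = 0.\<close>

lemma integral_line_derivative:
  fixes F G :: "'a::euclidean_space \<Rightarrow> real"
  assumes deriv: "\<And>z. ((\<lambda>t. F (z + t *\<^sub>R v)) has_real_derivative G z) (at 0)"
    and cont: "continuous_on UNIV F"
    and K: "bounded K" "\<And>z. z \<notin> K \<Longrightarrow> F z = 0"
    and bound: "\<And>z. \<bar>G z\<bar> \<le> M"
  shows "integrable lborel G" and "integral\<^sup>L lborel G = 0"
proof -
  define D where "D n z = real (Suc n) * (F (z + inverse (real (Suc n)) *\<^sub>R v) - F z)" for n z
  obtain r where r: "\<And>z. z \<in> K \<Longrightarrow> norm z \<le> r" using K(1) bounded_iff by metis
  \<comment> \<open>The shifts have length at most \<open>norm v\<close>, so every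
    \<open>D n\<close> vanishes outside the ball enlarged by that amount.\<close>
  define C where "C = cball (0::'a) (r + norm v)"
  have FC: "F z = 0" if "z \<notin> cball 0 r" for z
    using that r K(2)[of z] by force
  have intF: "integrable lborel F"
  proof -
    have "integrable lborel (\<lambda>x. indicator (cball 0 r) x *\<^sub>R F x)"
      by (rule borel_integrable_compact) (auto intro: continuous_on_subset[OF cont])
    moreover have "(\<lambda>x. indicator (cball 0 r) x *\<^sub>R F x) = F"
      using FC by (auto simp: indicator_def fun_eq_iff)
    ultimately show ?thesis by simp
  qed
  have shift: "integrable lborel (\<lambda>z. F (z + w))" "(\<integral>z. F (z + w) \<partial>lborel) = (\<integral>z. F z \<partial>lborel)" for w
  proof -
    have "integrable lborel F = integrable (distr lborel borel ((+) w)) F"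
      by (simp add: lborel_distr_plus)
    then show "integrable lborel (\<lambda>z. F (z + w))" using intF
      by (subst (asm) integrable_distr_eq) (auto simp: add.commute intro: borel_measurable_continuous_onI cont)
    have "(\<integral>z. F z \<partial>lborel) = (\<integral>z. F z \<partial>(distr lborel borel ((+) w)))"
      by (simp add: lborel_distr_plus)
    then show "(\<integral>z. F (z + w) \<partial>lborel) = (\<integral>z. F z \<partial>lborel)"
      by (subst (asm) integral_distr) (auto simp: add.commute intro: borel_measurable_continuous_onI cont)
  qed
  have mF: "F \<in> borel_measurable borel" by (intro borel_measurable_continuous_onI cont)
  have mD: "D n \<in> borel_measurable lborel" for n
    unfolding D_def using mF by measurable
  have D0: "integral\<^sup>L lborel (D n) = 0" for n
    unfolding D_def using shift intF by simp
  have lim: "(\<lambda>n. D n z) \<longlonglongrightarrow> G z" for z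
  proof -
    have "((\<lambda>h. (F (z + h *\<^sub>R v) - F z) / h) \<longlongrightarrow> G z) (at 0)"
      using deriv[of z] by (simp add: DERIV_def)
    moreover have "filterlim (\<lambda>n. inverse (real (Suc n))) (at 0) sequentially"
      using LIMSEQ_inverse_real_of_nat by (auto simp: filterlim_at)
    ultimately have "(\<lambda>n. (F (z + inverse (real (Suc n)) *\<^sub>R v) - F z) / inverse (real (Suc n))) \<longlonglongrightarrow> G z"
      by (rule filterlim_compose)
    then show ?thesis by (simp add: D_def field_simps)
  qed
  have le: "\<bar>D n z\<bar> \<le> M * indicator C z" for n z
  proof (cases "z \<in> C")
    case True
    let ?e = "inverse (real (Suc n))"
    have "\<exists>s. 0 < s \<and> s < ?e \<and> F (z + ?e *\<^sub>R v) - F (z + 0 *\<^sub>R v) = (?e - 0) * G (z + s *\<^sub>R v)"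
      by (rule MVT2) (auto intro: line_derivative_shift deriv)
    then obtain s where "F (z + ?e *\<^sub>R v) - F z = ?e * G (z + s *\<^sub>R v)" by auto
    then have "D n z = G (z + s *\<^sub>R v)" by (simp add: D_def)
    then show ?thesis using bound True by simp
  next
    case False
    then have "norm z > r + norm v" by (simp add: C_def)
    moreover have "norm z \<le> norm (z + inverse (real (Suc n)) *\<^sub>R v) + norm (inverse (real (Suc n)) *\<^sub>R v)"
      by (metis add_diff_cancel norm_triangle_sub norm_triangle_ineq4)
    moreover have "norm (inverse (real (Suc n)) *\<^sub>R v) \<le> norm v"
      by (simp add: mult_left_le_one_le inverse_le_1_iff)
    ultimately have "norm (z + inverse (real (Suc n)) *\<^sub>R v) > r" "norm z > r"
      using norm_ge_zero[of v] by linarith+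
    then show ?thesis using FC False by (simp add: D_def)
  qed
  have mG: "G \<in> borel_measurable lborel"
    by (rule borel_measurable_LIMSEQ_real[OF lim mD])
  have intM: "integrable lborel (\<lambda>z. M * indicator C z)"
    unfolding C_def by (intro integrable_mult_right integrable_real_indicator) (use emeasure_bounded_finite[OF bounded_cball, of 0 "r + norm v"] in auto)
  have AE: "AE z in lborel. (\<lambda>n. D n z) \<longlonglongrightarrow> G z" "\<And>n. AE z in lborel. norm (D n z) \<le> M * indicator C z"
    using lim le by simp_all
  show "integrable lborel G"
    by (rule integrable_dominated_convergence[OF mG mD intM AE])
  have "(\<lambda>n. integral\<^sup>L lborel (D n)) \<longlonglongrightarrow> integral\<^sup>L lborel G"
    by (rule integral_dominated_convergence[OF mG mD intM AE])
  then show "integral\<^sup>L lborel G = 0"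
    by (simp add: D0 LIMSEQ_const_iff)
qed

section \<open>Powers of the norm along coordinate axes\<close>

lemma has_derivative_powr_norm:
  fixes x :: "'a::real_inner"
  assumes "x \<noteq> 0"
  shows "((\<lambda>x. norm x powr p) has_derivative (\<lambda>v. p * norm x powr (p - 2) * (x \<bullet> v))) (at x)"
proof -
  have "((\<lambda>x. norm x powr p) has_derivative (\<lambda>v. norm x powr p * (0 * ln (norm x) + (v \<bullet> sgn x) * p / norm x))) (at x)"
    using assms by (intro has_derivative_powr[where X=UNIV, simplified] has_derivative_norm) (auto intro!: derivative_eq_intros)
  then show ?thesis using assms
    by (simp add: sgn_div_norm powr_diff inner_commute power2_eq_square field_simps)
qed

text \<open>The point x = 0 is included: there the quotient \<open>\<bar>t\<bar> powr p / t\<close>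
  tends to 0 because p > 1, and the right-hand side is 0 since \<open>x $ i = 0\<close>.\<close>

lemma line_powr_norm_axis:
  fixes x :: "real^'m"
  assumes "p > 1"
  shows "((\<lambda>t. norm (x + t *\<^sub>R axis i 1) powr p) has_real_derivative
    p * norm x powr (p - 2) * x $ i) (at 0)"
proof (cases "x = 0")
  case True
  have "((\<lambda>t::real. \<bar>t\<bar> powr p / t) \<longlongrightarrow> 0) (at 0)"
  proof (rule Lim_null_comparison)
    show "\<forall>\<^sub>F t in at (0::real). norm (\<bar>t\<bar> powr p / t) \<le> \<bar>t\<bar> powr (p - 1)"
      unfolding eventually_at
      by (rule exI[of _ 1]) (auto simp: powr_diff)
    show "((\<lambda>t::real. \<bar>t\<bar> powr (p - 1)) \<longlongrightarrow> 0) (at 0)"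
      using assms by (auto intro!: tendsto_eq_intros)
  qed
  then have "((\<lambda>t::real. \<bar>t\<bar> powr p) has_real_derivative 0) (at 0)"
    using assms by (simp add: DERIV_def)
  then show ?thesis using True by simp
next
  case False
  from has_real_derivative_line[OF has_derivative_powr_norm[OF this], of "axis i 1"] show ?thesis
    by (simp add: inner_axis)
qed

text \<open>At x = 0 the quotient is \<open>\<bar>t\<bar> powr p\<close>, which tends to 0. The
  exponent p - 2 may be negative; the convention \<open>0 powr c = 0\<close> then gives the
  right-hand side its correct value 0.\<close>

lemma line_powr_norm_times_coord:
  fixes x :: "real^'m"
  assumes "p > 0"
  shows "((\<lambda>t. norm (x + t *\<^sub>R axis i 1) powr p * (x + t *\<^sub>R axis i 1) $ i) has_real_derivative
    norm x powr p + p * norm x powr (p - 2) * (x $ i)\<^sup>2) (at 0)"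
proof (cases "x = 0")
  case True
  have "((\<lambda>t::real. \<bar>t\<bar> powr p * t / t) \<longlongrightarrow> 0) (at 0)"
  proof (rule Lim_transform_eventually)
    show "\<forall>\<^sub>F t in at (0::real). \<bar>t\<bar> powr p = \<bar>t\<bar> powr p * t / t"
      unfolding eventually_at by (rule exI[of _ 1]) auto
    show "((\<lambda>t::real. \<bar>t\<bar> powr p) \<longlongrightarrow> 0) (at 0)"
      using assms by (auto intro!: tendsto_eq_intros)
  qed
  then have "((\<lambda>t::real. \<bar>t\<bar> powr p * t) has_real_derivative 0) (at 0)"
    using assms by (simp add: DERIV_def)
  then show ?thesis using True by simp
next
  case False
  have "((\<lambda>x. norm x powr p * x $ i) has_derivative
      (\<lambda>v. norm x powr p * v $ i + p * norm x powr (p - 2) * (x \<bullet> v) * x $ i)) (at x)"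
    by (rule has_derivative_mult[OF has_derivative_powr_norm[OF False]
        bounded_linear_imp_has_derivative[OF bounded_linear_vec_nth]])
  from has_real_derivative_line[OF this, of "axis i 1"] show ?thesis
    by (simp add: inner_axis power2_eq_square mult.assoc)
qed

section \<open>The power of the gauge and its derivatives\<close>

lemma continuous_on_UNIV_if_support:
  fixes f :: "'a::t2_space \<Rightarrow> real"
  assumes "closed K" "p \<notin> K" "\<And>z. z \<notin> K \<Longrightarrow> f z = 0" "continuous_on (- {p}) f"
  shows "continuous_on UNIV f"
proof -
  have "continuous_on (- K) f"
    using assms(3) by (subst continuous_on_cong[of _ _ _ "\<lambda>_. 0"]) auto
  then have "continuous_on (- {p} \<union> - K) f"
    using assms by (intro continuous_on_open_Un) auto
  moreover have "- {p} \<union> - K = UNIV" using assms by auto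
  ultimately show ?thesis by simp
qed

lemma integrable_continuous_compact_support:
  fixes f :: "'a::euclidean_space \<Rightarrow> real"
  assumes "compact K" "\<And>z. z \<notin> K \<Longrightarrow> f z = 0" "continuous_on UNIV f"
  shows "integrable lborel f"
proof -
  have "integrable lborel (\<lambda>x. indicator K x *\<^sub>R f x)"
    by (rule borel_integrable_compact) (use assms in \<open>auto intro: continuous_on_subset\<close>)
  moreover have "(\<lambda>x. indicator K x *\<^sub>R f x) = f"
    using assms by (auto simp: indicator_def fun_eq_iff)
  ultimately show ?thesis by simp
qed

text \<open>Powers of the gauge can be singular at the origin, but \<open>F\<close> vanishes near
  it, so derivatives matter only elsewhere. The majorant \<open>B\<close>, continuous off the origin
  and hence bounded on \<open>K\<close>, supplies the uniform bound on \<open>G\<close>.\<close>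

lemma integral_line_derivative_punctured:
  fixes F G :: "'a::euclidean_space \<Rightarrow> real"
  assumes K: "compact K" "0 \<notin> K" "\<And>z. z \<notin> K \<Longrightarrow> F z = 0" "\<And>z. z \<notin> K \<Longrightarrow> G z = 0"
    and contF: "continuous_on (- {0}) F"
    and deriv: "\<And>z. z \<noteq> 0 \<Longrightarrow> ((\<lambda>t. F (z + t *\<^sub>R v)) has_real_derivative G z) (at 0)"
    and contB: "continuous_on (- {0}) B"
    and bound: "\<And>z. z \<noteq> 0 \<Longrightarrow> \<bar>G z\<bar> \<le> B z"
  shows "integrable lborel G" and "integral\<^sup>L lborel G = 0"
proof -
  have "continuous_on K B" using contB K(2) by (auto intro: continuous_on_subset)
  then have "bounded (B ` K)" using K(1) by (intro compact_imp_bounded compact_continuous_image)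
  then obtain M where M: "\<And>z. z \<in> K \<Longrightarrow> \<bar>B z\<bar> \<le> M" by (auto simp: bounded_iff)
  have *: "((\<lambda>t. F (z + t *\<^sub>R v)) has_real_derivative G z) (at 0)" for z
  proof (cases "z = 0")
    case True
    have "open (- K)" using K(1) compact_imp_closed by auto
    then obtain e where e: "e > 0" "ball 0 e \<subseteq> - K" using K(2) by (metis ComplI open_contains_ball)
    have "((\<lambda>t::real. 0::real) has_real_derivative 0) (at 0)" by simp
    then have "((\<lambda>t. F (t *\<^sub>R v)) has_real_derivative 0) (at 0)"
    proof (rule has_field_derivative_transform_within)
      \<comment> \<open>The added 1 keeps the radius positive when v = 0.\<close>
      show "e / (norm v + 1) > 0" using e(1) by (intro divide_pos_pos add_nonneg_pos) simp_all
      fix t :: real assume "dist t 0 < e / (norm v + 1)"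
      then have "\<bar>t\<bar> * (norm v + 1) < e"
        using pos_less_divide_eq[of "norm v + 1" "\<bar>t\<bar>" e] by (simp add: add_nonneg_pos)
      moreover have "\<bar>t\<bar> * norm v \<le> \<bar>t\<bar> * (norm v + 1)" by (intro mult_left_mono) auto
      ultimately have "t *\<^sub>R v \<in> ball 0 e" by simp
      then have "t *\<^sub>R v \<notin> K" using e(2) by blast
      then show "0 = F (t *\<^sub>R v)" by (simp add: K(3))
    qed simp
    then show ?thesis using True K(2) by (simp add: K(4))
  qed (rule deriv)
  have c: "continuous_on UNIV F"
    by (rule continuous_on_UNIV_if_support[OF compact_imp_closed[OF K(1)] K(2,3) contF])
  have b: "\<bar>G z\<bar> \<le> max M 0" for z
  proof (cases "z \<in> K")
    case True
    then have "\<bar>G z\<bar> \<le> B z" using K(2) by (intro bound) auto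
    then show ?thesis using M[OF True] by linarith
  qed (simp add: K(4))
  show "integrable lborel G" "integral\<^sup>L lborel G = 0"
    using integral_line_derivative[OF * c compact_imp_bounded[OF K(1)] K(3) b] by blast+
qed

text \<open>The function h of the introductory comment. Without the outer root its derivatives are
  simple, and every power of the gauge is a power of h.\<close>

definition gauge_pow :: "real \<Rightarrow> ('m::finite,'k::finite) pt \<Rightarrow> real" where
  "gauge_pow \<gamma> z = norm (fst z) powr (2*(1+\<gamma>)) + (1+\<gamma>)\<^sup>2 * (norm (snd z))\<^sup>2"

lemma gauge_powr: "gauge \<gamma> z powr p = gauge_pow \<gamma> z powr (p / (2*(1+\<gamma>)))"
  by (simp add: gauge_def gauge_pow_def powr_powr)

lemma gauge_pow_nonneg: "gauge_pow \<gamma> z \<ge> 0"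
  by (simp add: gauge_pow_def)

lemma gauge_pow_pos:
  assumes "\<gamma> > 0" "z \<noteq> 0"
  shows "gauge_pow \<gamma> z > 0"
proof (cases "fst z = 0")
  case True
  then have "snd z \<noteq> 0" using assms(2) by (simp add: prod_eq_iff)
  then show ?thesis using assms(1) True by (simp add: gauge_pow_def)
next
  case False
  then show ?thesis unfolding gauge_pow_def by (intro add_pos_nonneg) auto
qed

lemma continuous_on_gauge_pow:
  assumes "\<gamma> > 0"
  shows "continuous_on S (gauge_pow \<gamma>)"
  unfolding gauge_pow_def
  by (intro continuous_intros continuous_on_powr') (use assms in auto)

lemma continuous_on_norm_powr:
  assumes "p > 0"
  shows "continuous_on S (\<lambda>z. norm (fst z) powr p)"
  by (intro continuous_intros continuous_on_powr') (use assms in auto)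

lemma continuous_on_gauge_pow_powr:
  assumes "\<gamma> > 0"
  shows "continuous_on (- {0}) (\<lambda>z. gauge_pow \<gamma> z powr c)"
  by (intro continuous_intros continuous_on_gauge_pow assms)
    (use gauge_pow_pos[OF assms] in force)

lemma line_gauge_pow_ex:
  fixes z :: "('m::finite,'k::finite) pt"
  assumes "\<gamma> > 0"
  shows "((\<lambda>t. gauge_pow \<gamma> (z + t *\<^sub>R ex i)) has_real_derivative
     2 * (1+\<gamma>) * norm (fst z) powr (2*\<gamma>) * fst z $ i) (at 0)"
proof -
  have "((\<lambda>t. norm (fst z + t *\<^sub>R axis i 1) powr (2*(1+\<gamma>)) + (1+\<gamma>)\<^sup>2 * (norm (snd z))\<^sup>2) has_real_derivative
     2 * (1+\<gamma>) * norm (fst z) powr (2*(1+\<gamma>) - 2) * fst z $ i + 0) (at 0)"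
    by (intro DERIV_add line_powr_norm_axis DERIV_const) (use assms in auto)
  then show ?thesis by (simp add: gauge_pow_def ex_def algebra_simps)
qed

lemma line_gauge_pow_ey:
  fixes z :: "('m::finite,'k::finite) pt"
  shows "((\<lambda>t. gauge_pow \<gamma> (z + t *\<^sub>R ey j)) has_real_derivative
     2 * (1+\<gamma>)\<^sup>2 * snd z $ j) (at 0)"
proof -
  have *: "(norm (snd z + t *\<^sub>R axis j 1))\<^sup>2 = (norm (snd z))\<^sup>2 + 2 * t * snd z $ j + t\<^sup>2" for t
    unfolding power2_norm_eq_inner
    by (simp add: inner_simps inner_axis inner_axis' algebra_simps power2_eq_square)
  have "((\<lambda>t. norm (fst z) powr (2*(1+\<gamma>)) + (1+\<gamma>)\<^sup>2 * ((norm (snd z))\<^sup>2 + 2 * t * snd z $ j + t\<^sup>2)) has_real_derivative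
     2 * (1+\<gamma>)\<^sup>2 * snd z $ j) (at 0)"
    by (auto intro!: derivative_eq_intros)
  then show ?thesis by (simp add: gauge_pow_def ey_def *)
qed

lemma line_gauge_pow_powr_ex:
  fixes z :: "('m::finite,'k::finite) pt"
  assumes "\<gamma> > 0" "z \<noteq> 0"
  shows "((\<lambda>t. gauge_pow \<gamma> (z + t *\<^sub>R ex i) powr c) has_real_derivative
     c * gauge_pow \<gamma> z powr (c - 1) * (2 * (1+\<gamma>) * norm (fst z) powr (2*\<gamma>) * fst z $ i)) (at 0)"
  using DERIV_fun_powr[OF line_gauge_pow_ex[OF assms(1), of z i], of c] gauge_pow_pos[OF assms] by simp

lemma line_gauge_pow_powr_ey:
  fixes z :: "('m::finite,'k::finite) pt"
  assumes "\<gamma> > 0" "z \<noteq> 0"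
  shows "((\<lambda>t. gauge_pow \<gamma> (z + t *\<^sub>R ey j) powr c) has_real_derivative
     c * gauge_pow \<gamma> z powr (c - 1) * (2 * (1+\<gamma>)\<^sup>2 * snd z $ j)) (at 0)"
  using DERIV_fun_powr[OF line_gauge_pow_ey[of \<gamma> z j], of c] gauge_pow_pos[OF assms] by simp

section \<open>Iterated smoothness and supports\<close>

lemma smooth_differentiable: "smooth f \<Longrightarrow> f differentiable (at z)"
  using iter_dirderiv.simps(1) by (metis smooth_def)

lemma smooth_dirderiv:
  assumes "smooth f" shows "smooth (dirderiv v f)"
proof -
  have "iter_dirderiv vs (dirderiv v f) = iter_dirderiv (vs @ [v]) f" for vs
    by (induction vs) auto
  then show ?thesis using assms by (simp add: smooth_def)
qed

lemma smooth_continuous_on: "smooth f \<Longrightarrow> continuous_on S f"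
  by (intro continuous_at_imp_continuous_on ballI differentiable_imp_continuous_within smooth_differentiable)

lemma eq_0_outside_tsupport: "z \<notin> tsupport f \<Longrightarrow> f z = 0"
  unfolding tsupport_def using closure_subset[of "{z. f z \<noteq> 0}"] by blast

lemma dirderiv_eq_0_outside_closed:
  fixes f :: "'a::real_normed_vector \<Rightarrow> real"
  assumes "closed K" "\<And>z. z \<notin> K \<Longrightarrow> f z = 0" "z \<notin> K"
  shows "dirderiv v f z = 0"
proof -
  have "((\<lambda>_. 0) has_derivative (\<lambda>_. 0)) (at z)" by simp
  then have "(f has_derivative (\<lambda>_. 0)) (at z)"
    by (rule has_derivative_transform_within_open[where s = "- K"]) (use assms in auto)
  from dirderiv_eq[OF this] show ?thesis .
qed

section \<open>Integral identities for test functions\<close>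

text \<open>The generator Z of the dilations (x, y) -> (l x, l^(1+\<gamma>) y). It encodes radial
  derivatives: for Grushin gradients, \<nabla>h . \<nabla>f = 2(1+\<gamma>) r Z f with r =
  |x|^(2\<gamma>).\<close>

definition dilation_deriv :: "real \<Rightarrow> (('m::finite,'k::finite) pt \<Rightarrow> real) \<Rightarrow> ('m,'k) pt \<Rightarrow> real" where
  "dilation_deriv \<gamma> f z =
     (\<Sum>i\<in>UNIV. fst z $ i * dirderiv (ex i) f z) + (1+\<gamma>) * (\<Sum>j\<in>UNIV. snd z $ j * dirderiv (ey j) f z)"

lemma norm_sq_vec: "(norm x)\<^sup>2 = (\<Sum>i\<in>UNIV. (x $ i)\<^sup>2)" for x :: "real^'n"
  unfolding power2_norm_eq_inner inner_vec_def by (simp add: power2_eq_square)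

lemma norm_powr_sq: "(norm x powr \<gamma>)\<^sup>2 = norm x powr (2*\<gamma>)"
  by (simp add: power2_eq_square flip: powr_add)

lemma norm_powr_mult_norm_sq: "norm x powr p * (norm x)\<^sup>2 = norm x powr (p + 2)"
  by (cases "x = 0") (simp_all add: powr_add)

context
  fixes \<gamma> :: real and \<phi> :: "('m::finite,'k::finite) pt \<Rightarrow> real"
  assumes \<gamma>: "\<gamma> > 0" and test: "test_fun \<phi>"
begin

private abbreviation (input) "h \<equiv> gauge_pow \<gamma> :: ('m,'k) pt \<Rightarrow> real"
private abbreviation (input) "r z \<equiv> norm (fst z) powr (2*\<gamma>)"
private abbreviation (input) "K \<equiv> tsupport \<phi>"

lemma tsupport_props: "compact K" "closed K" "0 \<notin> K"
  using test by (auto simp: test_fun_def compact_imp_closed)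

lemma smooth_phi: "smooth \<phi>" "smooth (dirderiv v \<phi>)" "smooth (dirderiv w (dirderiv v \<phi>))"
  using test by (auto simp: test_fun_def intro: smooth_dirderiv)

lemma phi_outside: "z \<notin> K \<Longrightarrow> \<phi> z = 0" "z \<notin> K \<Longrightarrow> dirderiv v \<phi> z = 0"
    "z \<notin> K \<Longrightarrow> dirderiv w (dirderiv v \<phi>) z = 0"
  using eq_0_outside_tsupport dirderiv_eq_0_outside_closed[OF tsupport_props(2)] by metis+

lemma continuous_on_phi: "continuous_on S \<phi>" "continuous_on S (dirderiv v \<phi>)"
    "continuous_on S (dirderiv w (dirderiv v \<phi>))"
  by (intro smooth_continuous_on smooth_phi)+

lemma integrable_if_punctured:
  fixes f :: "('m,'k) pt \<Rightarrow> real"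
  assumes "continuous_on (- {0}) f" "\<And>z. z \<notin> K \<Longrightarrow> f z = 0"
  shows "integrable lborel f"
  by (rule integrable_continuous_compact_support[OF tsupport_props(1) assms(2)
      continuous_on_UNIV_if_support[OF tsupport_props(2,3) assms(2,1)]])

lemmas cont_intros = continuous_on_phi continuous_on_gauge_pow_powr[OF \<gamma>]
    continuous_on_norm_powr continuous_intros

lemma grushin_grad_sq_outside: "z \<notin> K \<Longrightarrow> grushin_grad_sq \<gamma> \<phi> z = 0"
  by (simp add: grushin_grad_sq_def phi_outside)

lemma continuous_on_grad_lap: "continuous_on S (grushin_grad_sq \<gamma> \<phi>)" "continuous_on S (grushin_lap \<gamma> \<phi>)"
    "continuous_on S (dilation_deriv \<gamma> \<phi>)"
  unfolding grushin_grad_sq_def grushin_lap_def norm_powr_sq dilation_deriv_def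
  by (intro cont_intros; use \<gamma> in simp)+

lemma integrable_terms:
  shows "integrable lborel (\<lambda>z. h z powr \<beta> * grushin_grad_sq \<gamma> \<phi> z)"
    and "integrable lborel (\<lambda>z. h z powr \<beta> * (\<phi> z * grushin_lap \<gamma> \<phi> z))"
    and "integrable lborel (\<lambda>z. h z powr \<beta> * r z * (\<phi> z * dilation_deriv \<gamma> \<phi> z))"
    and "integrable lborel (\<lambda>z. h z powr \<beta> * r z * (\<phi> z)\<^sup>2)"
  by (rule integrable_if_punctured, intro cont_intros continuous_on_grad_lap; use \<gamma> in \<open>simp add: phi_outside grushin_grad_sq_outside\<close>)+

lemma line_phi: "((\<lambda>t. \<phi> (z + t *\<^sub>R v)) has_real_derivative dirderiv v \<phi> z) (at 0)"
    "((\<lambda>t. dirderiv w \<phi> (z + t *\<^sub>R v)) has_real_derivative dirderiv v (dirderiv w \<phi>) z) (at 0)"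
  by (intro has_real_derivative_line_dirderiv smooth_differentiable smooth_phi)+

text \<open>The divergence of the field h^\<beta> \<phi> \<nabla>\<phi> integrates to 0. The last
  term is the derivative of the weight, with \<nabla>h . \<nabla>\<phi> expressed by the dilation
  generator.\<close>

lemma green_identity:
  "(\<integral>z. h z powr \<beta> * grushin_grad_sq \<gamma> \<phi> z \<partial>lborel) + (\<integral>z. h z powr \<beta> * (\<phi> z * grushin_lap \<gamma> \<phi> z) \<partial>lborel)
    + 2 * (1+\<gamma>) * \<beta> * (\<integral>z. h z powr (\<beta> - 1) * r z * (\<phi> z * dilation_deriv \<gamma> \<phi> z) \<partial>lborel) = 0"
proof -
  \<comment> \<open>\<open>G1 i\<close> and \<open>G2 j\<close> are the contributions of the
    directions x_i and y_j to this divergence.\<close>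
  define G1 where "G1 i z = dirderiv (ex i) \<phi> z * (h z powr \<beta> * dirderiv (ex i) \<phi> z) +
    \<phi> z * (\<beta> * h z powr (\<beta> - 1) * (2 * (1+\<gamma>) * r z * fst z $ i) * dirderiv (ex i) \<phi> z
      + h z powr \<beta> * dirderiv (ex i) (dirderiv (ex i) \<phi>) z)" for i z
  define G2 where "G2 j z = r z * (dirderiv (ey j) \<phi> z * (h z powr \<beta> * dirderiv (ey j) \<phi> z) +
    \<phi> z * (\<beta> * h z powr (\<beta> - 1) * (2 * (1+\<gamma>)\<^sup>2 * snd z $ j) * dirderiv (ey j) \<phi> z
      + h z powr \<beta> * dirderiv (ey j) (dirderiv (ey j) \<phi>) z))" for j z
  have G1: "integrable lborel (G1 i) \<and> integral\<^sup>L lborel (G1 i) = 0" for i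
  proof -
    have d: "((\<lambda>t. \<phi> (z + t *\<^sub>R ex i) * (h (z + t *\<^sub>R ex i) powr \<beta> * dirderiv (ex i) \<phi> (z + t *\<^sub>R ex i)))
        has_real_derivative G1 i z) (at 0)" if "z \<noteq> 0" for z
      by (rule DERIV_cong[OF DERIV_mult[OF line_phi(1) DERIV_mult[OF line_gauge_pow_powr_ex[OF \<gamma> that] line_phi(2)]]])
        (simp add: G1_def algebra_simps)
    have c: "continuous_on (- {0}) (G1 i)" unfolding G1_def by (intro cont_intros) (use \<gamma> in simp)
    have c': "continuous_on (- {0}) (\<lambda>z. \<phi> z * (h z powr \<beta> * dirderiv (ex i) \<phi> z))"
      by (intro cont_intros)
    have z: "z \<notin> K \<Longrightarrow> G1 i z = 0" for z by (simp add: phi_outside G1_def)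
    show ?thesis
      by (intro conjI integral_line_derivative_punctured[OF tsupport_props(1,3) _ z c' d continuous_on_rabs[OF c] order_refl]; simp add: phi_outside)
  qed
  have G2: "integrable lborel (G2 j) \<and> integral\<^sup>L lborel (G2 j) = 0" for j
  proof -
    have d: "((\<lambda>t. r (z + t *\<^sub>R ey j) * (\<phi> (z + t *\<^sub>R ey j) * (h (z + t *\<^sub>R ey j) powr \<beta> * dirderiv (ey j) \<phi> (z + t *\<^sub>R ey j))))
        has_real_derivative G2 j z) (at 0)" if "z \<noteq> 0" for z
    proof -
      \<comment> \<open>A shift along \<open>ey j\<close> leaves x fixed, so r is a constant factor
        on this line.\<close>
      have "((\<lambda>t. r z * (\<phi> (z + t *\<^sub>R ey j) * (h (z + t *\<^sub>R ey j) powr \<beta> * dirderiv (ey j) \<phi> (z + t *\<^sub>R ey j))))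
        has_real_derivative G2 j z) (at 0)"
        by (rule DERIV_cong[OF DERIV_cmult[OF DERIV_mult[OF line_phi(1) DERIV_mult[OF line_gauge_pow_powr_ey[OF \<gamma> that] line_phi(2)]]]])
          (simp add: G2_def algebra_simps)
      then show ?thesis by (simp add: ey_def)
    qed
    have c: "continuous_on (- {0}) (G2 j)" unfolding G2_def by (intro cont_intros) (use \<gamma> in simp)
    have c': "continuous_on (- {0}) (\<lambda>z. r z * (\<phi> z * (h z powr \<beta> * dirderiv (ey j) \<phi> z)))"
      by (intro cont_intros) (use \<gamma> in simp)
    have z: "z \<notin> K \<Longrightarrow> G2 j z = 0" for z by (simp add: phi_outside G2_def)
    show ?thesis
      by (intro conjI integral_line_derivative_punctured[OF tsupport_props(1,3) _ z c' d continuous_on_rabs[OF c] order_refl]; simp add: phi_outside)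
  qed
  have "(\<integral>z. (\<Sum>i\<in>UNIV. G1 i z) + (\<Sum>j\<in>UNIV. G2 j z) \<partial>lborel) = 0"
    using G1 G2 by simp
  moreover have "(\<Sum>i\<in>UNIV. G1 i z) + (\<Sum>j\<in>UNIV. G2 j z) =
      h z powr \<beta> * grushin_grad_sq \<gamma> \<phi> z + h z powr \<beta> * (\<phi> z * grushin_lap \<gamma> \<phi> z)
      + 2 * (1+\<gamma>) * \<beta> * (h z powr (\<beta> - 1) * r z * (\<phi> z * dilation_deriv \<gamma> \<phi> z))" for z
    unfolding G1_def G2_def grushin_grad_sq_def grushin_lap_def dilation_deriv_def norm_powr_sq
    by (simp add: sum.distrib sum_distrib_left algebra_simps power2_eq_square)
  ultimately show ?thesis
    using integrable_terms by simp
qed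

text \<open>
  The divergence theorem for the field \<open>\<phi>\<^sup>2 h\<^sup>\<beta> r (x, (1 + \<gamma>) y)\<close>. Although \<open>r = |x|\<^sup>2\<^sup>\<gamma>\<close> need not be
  differentiable where \<open>x = 0\<close>, the product \<open>r x\<close> is.
\<close>
lemma dilation_identity:
  "2 * (\<integral>z. h z powr \<beta> * r z * (\<phi> z * dilation_deriv \<gamma> \<phi> z) \<partial>lborel)
    + (2 * (1+\<gamma>) * \<beta> + hom_dim \<gamma> TYPE(('m,'k) pt) + 2 * \<gamma>) * (\<integral>z. h z powr \<beta> * r z * (\<phi> z)\<^sup>2 \<partial>lborel) = 0"
proof -
  \<comment> \<open>The exponent is negative for \<gamma> < 1; \<open>r2\<close> occurs only
    multiplied by the square of a coordinate of x, and that product is at most r.\<close>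
  define r2 where "r2 z = norm (fst z) powr (2*\<gamma> - 2)" for z :: "('m,'k) pt"
  define G1 where "G1 i z = (2 * \<phi> z * dirderiv (ex i) \<phi> z) * (h z powr \<beta> * (r z * fst z $ i)) +
    (\<phi> z)\<^sup>2 * (\<beta> * h z powr (\<beta> - 1) * (2 * (1+\<gamma>) * r z * fst z $ i) * (r z * fst z $ i)
      + h z powr \<beta> * (r z + 2 * \<gamma> * r2 z * (fst z $ i)\<^sup>2))" for i z
  \<comment> \<open>A majorant of \<open>G1 i\<close> that is continuous off the origin: r replaces
    \<open>r2 z * (fst z $ i)\<^sup>2\<close>, because \<open>r2\<close> may be discontinuous where
    x = 0.\<close>
  define B where "B i z = \<bar>2 * \<phi> z * dirderiv (ex i) \<phi> z * (h z powr \<beta> * (r z * fst z $ i))\<bar> +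
    (\<phi> z)\<^sup>2 * (\<bar>\<beta> * h z powr (\<beta> - 1) * (2 * (1+\<gamma>) * r z * fst z $ i) * (r z * fst z $ i)\<bar>
      + h z powr \<beta> * (r z + 2 * \<gamma> * r z))" for i z
  define G2 where "G2 j z = r z * (1+\<gamma>) * ((2 * \<phi> z * dirderiv (ey j) \<phi> z) * (h z powr \<beta> * snd z $ j) +
    (\<phi> z)\<^sup>2 * (\<beta> * h z powr (\<beta> - 1) * (2 * (1+\<gamma>)\<^sup>2 * snd z $ j) * snd z $ j
      + h z powr \<beta>))" for j z
  have sq: "((\<lambda>t. (\<phi> (z + t *\<^sub>R v))\<^sup>2) has_real_derivative 2 * \<phi> z * dirderiv v \<phi> z) (at 0)" for z v
    using DERIV_power[OF line_phi(1)[of z v], of 2] by (simp add: ac_simps)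
  have r2: "r2 z * (norm (fst z))\<^sup>2 = r z" for z
    by (simp add: r2_def norm_powr_mult_norm_sq)
  have G1: "integrable lborel (G1 i) \<and> integral\<^sup>L lborel (G1 i) = 0" for i
  proof -
    have d: "((\<lambda>t. (\<phi> (z + t *\<^sub>R ex i))\<^sup>2 * (h (z + t *\<^sub>R ex i) powr \<beta> * (r (z + t *\<^sub>R ex i) * fst (z + t *\<^sub>R ex i) $ i)))
        has_real_derivative G1 i z) (at 0)" if "z \<noteq> 0" for z
    proof -
      have "((\<lambda>t. r (z + t *\<^sub>R ex i) * fst (z + t *\<^sub>R ex i) $ i) has_real_derivative r z + 2 * \<gamma> * r2 z * (fst z $ i)\<^sup>2) (at 0)"
        using line_powr_norm_times_coord[of "2 * \<gamma>" "fst z" i] \<gamma> by (simp add: ex_def r2_def)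
      from DERIV_mult[OF sq DERIV_mult[OF line_gauge_pow_powr_ex[OF \<gamma> that] this]]
      show ?thesis by (rule DERIV_cong) (simp add: G1_def algebra_simps)
    qed
    have b: "\<bar>G1 i z\<bar> \<le> B i z" for z
    proof -
      have "(fst z $ i)\<^sup>2 \<le> (norm (fst z))\<^sup>2"
        using component_le_norm_cart[of "fst z" i] by (simp add: abs_le_square_iff[symmetric])
      then have *: "r2 z * (fst z $ i)\<^sup>2 \<le> r z"
        by (subst r2[symmetric]) (auto intro!: mult_left_mono simp: r2_def)
      have "\<bar>r z + 2 * \<gamma> * r2 z * (fst z $ i)\<^sup>2\<bar> = r z + 2 * \<gamma> * (r2 z * (fst z $ i)\<^sup>2)"
        using \<gamma> by (simp add: r2_def mult.assoc)
      also have "\<dots> \<le> r z + 2 * \<gamma> * r z"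
        using * \<gamma> by simp
      finally have **: "\<bar>r z + 2 * \<gamma> * r2 z * (fst z $ i)\<^sup>2\<bar> \<le> r z + 2 * \<gamma> * r z" .
      have aux: "\<bar>a + b * (c + d * e)\<bar> \<le> \<bar>a\<bar> + b * (\<bar>c\<bar> + d * e')" if "b \<ge> 0" "d \<ge> 0" "\<bar>e\<bar> \<le> e'" for a b c d e e' :: real
      proof -
        have "\<bar>d * e\<bar> \<le> d * e'" using that by (simp add: abs_mult mult_left_mono)
        then have "\<bar>c + d * e\<bar> \<le> \<bar>c\<bar> + d * e'" by linarith
        then have "\<bar>b * (c + d * e)\<bar> \<le> b * (\<bar>c\<bar> + d * e')" using that by (simp add: abs_mult mult_left_mono)
        then show ?thesis by linarith
      qed
      show ?thesis unfolding G1_def B_def by (rule aux[OF _ _ **]) simp_all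
    qed
    have c: "continuous_on (- {0}) (B i)" unfolding B_def by (intro cont_intros) (use \<gamma> in simp_all)
    have c': "continuous_on (- {0}) (\<lambda>z. (\<phi> z)\<^sup>2 * (h z powr \<beta> * (r z * fst z $ i)))"
      by (intro cont_intros) (use \<gamma> in simp)
    have z: "z \<notin> K \<Longrightarrow> G1 i z = 0" for z by (simp add: phi_outside G1_def)
    show ?thesis
      by (intro conjI integral_line_derivative_punctured[OF tsupport_props(1,3) _ z c' d c b]; simp add: phi_outside)
  qed
  have G2: "integrable lborel (G2 j) \<and> integral\<^sup>L lborel (G2 j) = 0" for j
  proof -
    have d: "((\<lambda>t. r (z + t *\<^sub>R ey j) * (1+\<gamma>) * ((\<phi> (z + t *\<^sub>R ey j))\<^sup>2 * (h (z + t *\<^sub>R ey j) powr \<beta> * snd (z + t *\<^sub>R ey j) $ j)))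
        has_real_derivative G2 j z) (at 0)" if "z \<noteq> 0" for z
    proof -
      have "((\<lambda>t. snd (z + t *\<^sub>R ey j) $ j) has_real_derivative 1) (at 0)"
        by (auto simp: ey_def intro!: derivative_eq_intros)
      from DERIV_cmult[OF DERIV_mult[OF sq DERIV_mult[OF line_gauge_pow_powr_ey[OF \<gamma> that] this]]]
      have "((\<lambda>t. r z * (1+\<gamma>) * ((\<phi> (z + t *\<^sub>R ey j))\<^sup>2 * (h (z + t *\<^sub>R ey j) powr \<beta> * snd (z + t *\<^sub>R ey j) $ j)))
        has_real_derivative G2 j z) (at 0)"
        by (rule DERIV_cong) (simp add: G2_def algebra_simps)
      then show ?thesis by (simp add: ey_def)
    qed
    have c: "continuous_on (- {0}) (G2 j)" unfolding G2_def by (intro cont_intros) (use \<gamma> in simp)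
    have c': "continuous_on (- {0}) (\<lambda>z. r z * (1+\<gamma>) * ((\<phi> z)\<^sup>2 * (h z powr \<beta> * snd z $ j)))"
      by (intro cont_intros) (use \<gamma> in simp)
    have z: "z \<notin> K \<Longrightarrow> G2 j z = 0" for z by (simp add: phi_outside G2_def)
    show ?thesis
      by (intro conjI integral_line_derivative_punctured[OF tsupport_props(1,3) _ z c' d continuous_on_rabs[OF c] order_refl]; simp add: phi_outside)
  qed
  have "(\<integral>z. (\<Sum>i\<in>UNIV. G1 i z) + (\<Sum>j\<in>UNIV. G2 j z) \<partial>lborel) = 0"
    using G1 G2 by simp
  moreover have "(\<Sum>i\<in>UNIV. G1 i z) + (\<Sum>j\<in>UNIV. G2 j z) =
      2 * (h z powr \<beta> * r z * (\<phi> z * dilation_deriv \<gamma> \<phi> z)) +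
      (2 * (1+\<gamma>) * \<beta> + hom_dim \<gamma> TYPE(('m,'k) pt) + 2 * \<gamma>) * (h z powr \<beta> * r z * (\<phi> z)\<^sup>2)" (is "?L = ?R") for z
  proof (cases "z = 0")
    case True
    then have "\<phi> z = 0" using tsupport_props(3) phi_outside(1) by blast
    then show ?thesis by (simp add: G1_def G2_def)
  next
    case False
    let ?x = "(norm (fst z))\<^sup>2" and ?y = "(norm (snd z))\<^sup>2"
    have "?L = 2 * (h z powr \<beta> * r z * (\<phi> z * dilation_deriv \<gamma> \<phi> z))
      + (\<phi> z)\<^sup>2 * \<beta> * h z powr (\<beta> - 1) * 2 * (1+\<gamma>) * r z * (r z * ?x + (1+\<gamma>)\<^sup>2 * ?y)
      + (\<phi> z)\<^sup>2 * h z powr \<beta> * (real CARD('m) * r z + 2 * \<gamma> * (r2 z * ?x) + (1+\<gamma>) * real CARD('k) * r z)"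
    proof -
      have "G1 i z = (2 * \<phi> z * h z powr \<beta> * r z) * (fst z $ i * dirderiv (ex i) \<phi> z)
          + (\<phi> z)\<^sup>2 * (\<beta> * h z powr (\<beta> - 1) * 2 * (1+\<gamma>) * r z * r z + h z powr \<beta> * 2 * \<gamma> * r2 z) * (fst z $ i)\<^sup>2
          + (\<phi> z)\<^sup>2 * h z powr \<beta> * r z" for i
        by (simp add: G1_def algebra_simps power2_eq_square)
      then have 1: "(\<Sum>i\<in>UNIV. G1 i z) = (2 * \<phi> z * h z powr \<beta> * r z) * (\<Sum>i\<in>UNIV. fst z $ i * dirderiv (ex i) \<phi> z)
          + (\<phi> z)\<^sup>2 * (\<beta> * h z powr (\<beta> - 1) * 2 * (1+\<gamma>) * r z * r z + h z powr \<beta> * 2 * \<gamma> * r2 z) * ?x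
          + real CARD('m) * ((\<phi> z)\<^sup>2 * h z powr \<beta> * r z)"
        by (simp only: sum.distrib sum_distrib_left[symmetric] norm_sq_vec sum_constant) (simp add: ac_simps)
      have "G2 j z = (2 * \<phi> z * h z powr \<beta> * r z * (1+\<gamma>)) * (snd z $ j * dirderiv (ey j) \<phi> z)
          + (\<phi> z)\<^sup>2 * (\<beta> * h z powr (\<beta> - 1) * 2 * (1+\<gamma>) * r z * (1+\<gamma>)\<^sup>2) * (snd z $ j)\<^sup>2
          + (1+\<gamma>) * (\<phi> z)\<^sup>2 * h z powr \<beta> * r z" for j
        by (simp add: G2_def algebra_simps power2_eq_square)
      then have 2: "(\<Sum>j\<in>UNIV. G2 j z) = (2 * \<phi> z * h z powr \<beta> * r z * (1+\<gamma>)) * (\<Sum>j\<in>UNIV. snd z $ j * dirderiv (ey j) \<phi> z)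
          + (\<phi> z)\<^sup>2 * (\<beta> * h z powr (\<beta> - 1) * 2 * (1+\<gamma>) * r z * (1+\<gamma>)\<^sup>2) * ?y
          + real CARD('k) * ((1+\<gamma>) * (\<phi> z)\<^sup>2 * h z powr \<beta> * r z)"
        by (simp only: sum.distrib sum_distrib_left[symmetric] norm_sq_vec sum_constant) (simp add: ac_simps)
      show ?thesis unfolding 1 2 dilation_deriv_def by algebra
    qed
    \<comment> \<open>Differentiating the weight along the dilation field reproduces h, which raises
      the exponent \<beta> - 1 back to \<beta>.\<close>
    also have "r z * ?x + (1+\<gamma>)\<^sup>2 * ?y = h z"
      using norm_powr_mult_norm_sq[of "fst z" "2 * \<gamma>"] by (simp add: gauge_pow_def algebra_simps)
    also have "(\<phi> z)\<^sup>2 * \<beta> * h z powr (\<beta> - 1) * 2 * (1+\<gamma>) * r z * h z = (\<phi> z)\<^sup>2 * \<beta> * h z powr \<beta> * 2 * (1+\<gamma>) * r z"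
      using gauge_pow_pos[OF \<gamma> False] by (simp add: powr_diff)
    finally show ?thesis by (simp add: r2 hom_dim_def algebra_simps)
  qed
  ultimately show ?thesis
    using integrable_terms by simp
qed

end

section \<open>The weighted Rellich inequality\<close>

text \<open>
  Where \<open>x = 0\<close> the gradient of the gauge vanishes, so the integrand of \<^const>\<open>lhs_int\<close> is a division
  by zero with value \<open>0\<close>; pointwise estimates hold only off this null set.
\<close>
lemma AE_fst_nonzero: "AE z in lborel. fst (z :: ('m::finite,'k::finite) pt) \<noteq> 0"
proof -
  obtain i :: 'm where True by simp
  \<comment> \<open>The set x = 0 lies in the hyperplane where one chosen coordinate of x
    vanishes.\<close>
  let ?a = "(axis i 1, 0) :: ('m,'k) pt" and ?H = "{z :: ('m,'k) pt. (axis i 1, 0) \<bullet> z = 0}"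
  have "?a \<noteq> 0" by (simp add: zero_prod_def axis_eq_0_iff)
  then have "negligible ?H" using negligible_hyperplane[of ?a 0] by blast
  moreover have "?H \<in> sets lborel"
    by (simp add: closed_hyperplane borel_closed)
  ultimately have "?H \<in> null_sets lborel"
    by (simp add: negligible_iff_null_sets null_sets_completion_iff)
  then have "AE z in lborel. z \<notin> ?H" by (rule AE_not_in)
  then show ?thesis by (rule AE_mp) (auto intro!: AE_I2 simp: inner_prod_def)
qed

lemma open_AE_empty:
  fixes S :: "'a::euclidean_space set"
  assumes "open S" "AE z in lborel. z \<notin> S"
  shows "S = {}"
proof (rule ccontr)
  assume "S \<noteq> {}"
  then have "\<not> negligible S" using assms(1) by (rule open_not_negligible[rotated])
  moreover have "S \<in> null_sets lborel"
    using AE_iff_null_sets[of S lborel] assms by auto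
  ultimately show False
    by (auto simp: negligible_iff_null_sets intro: null_sets_completionI)
qed

text \<open>\<open>dirderiv\<close> is defined through the Frechet derivative, so line derivatives
  identify it only once differentiability is known. Off x = 0 both summands of h are differentiable
  and h is positive.\<close>

lemma gauge_differentiable:
  fixes z :: "('m::finite,'k::finite) pt"
  assumes "\<gamma> > 0" "fst z \<noteq> 0"
  shows "gauge \<gamma> differentiable (at z)"
proof -
  have z: "z \<noteq> 0" using assms by auto
  have 1: "((\<lambda>z. norm (fst z) powr (2*(1+\<gamma>))) has_derivative
      (\<lambda>v. 2*(1+\<gamma>) * norm (fst z) powr (2*(1+\<gamma>) - 2) * (fst z \<bullet> fst v))) (at z)"
    using has_derivative_compose[OF has_derivative_fst[OF has_derivative_ident] has_derivative_powr_norm[OF assms(2)]] .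
  have "((\<lambda>z. norm (fst z) powr (2*(1+\<gamma>)) + (1+\<gamma>)\<^sup>2 * (snd z \<bullet> snd z)) has_derivative
      (\<lambda>v. 2*(1+\<gamma>) * norm (fst z) powr (2*(1+\<gamma>) - 2) * (fst z \<bullet> fst v) +
        (1+\<gamma>)\<^sup>2 * (snd z \<bullet> snd v + snd v \<bullet> snd z))) (at z)"
    by (intro has_derivative_add 1 has_derivative_mult_right has_derivative_inner has_derivative_snd has_derivative_ident)
  then have "gauge_pow \<gamma> differentiable (at z)"
    unfolding gauge_pow_def power2_norm_eq_inner differentiable_def by blast
  then obtain D where "(gauge_pow \<gamma> has_derivative D) (at z)" by (auto simp: differentiable_def)
  have eq: "gauge \<gamma> = (\<lambda>z :: ('m,'k) pt. gauge_pow \<gamma> z powr (1 / (2*(1+\<gamma>))))"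
    by (simp add: gauge_def gauge_pow_def fun_eq_iff)
  show ?thesis unfolding eq
    by (rule differentiableI, rule has_derivative_powr[where X = UNIV, OF \<open>(gauge_pow \<gamma> has_derivative D) (at z)\<close> has_derivative_const])
      (use gauge_pow_pos[OF assms(1) z] in auto)
qed

text \<open>This is |\<nabla>\<rho>|^2 = |x|^(2\<gamma>) / \<rho>^(2\<gamma>) in powers of h. It
  follows from the chain rule and r |x|^2 + (1+\<gamma>)^2 |y|^2 = h.\<close>

lemma grushin_grad_sq_gauge:
  fixes z :: "('m::finite,'k::finite) pt"
  assumes "\<gamma> > 0" "fst z \<noteq> 0"
  shows "grushin_grad_sq \<gamma> (gauge \<gamma>) z = norm (fst z) powr (2*\<gamma>) * gauge_pow \<gamma> z powr (- (\<gamma> / (1+\<gamma>)))"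
proof -
  let ?r = "norm (fst z) powr (2*\<gamma>)" and ?h = "gauge_pow \<gamma> z" and ?c = "1 / (2*(1+\<gamma>)) :: real"
  have z: "z \<noteq> 0" using assms by auto
  have eq: "gauge \<gamma> = (\<lambda>z :: ('m,'k) pt. gauge_pow \<gamma> z powr ?c)"
    by (simp add: gauge_def gauge_pow_def fun_eq_iff)
  have 1: "dirderiv (ex i) (gauge \<gamma>) z = ?h powr (?c - 1) * ?r * fst z $ i" for i
  proof -
    have "dirderiv (ex i) (gauge \<gamma>) z = ?c * ?h powr (?c - 1) * (2 * (1+\<gamma>) * ?r * fst z $ i)"
      using DERIV_unique[OF has_real_derivative_line_dirderiv[OF gauge_differentiable[OF assms], of "ex i"]]
        line_gauge_pow_powr_ex[OF assms(1) z, of i ?c] by (simp add: eq)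
    also have "\<dots> = ?c * (2 * (1+\<gamma>)) * ?h powr (?c - 1) * ?r * fst z $ i"
      by (simp only: mult_ac)
    also have "?c * (2 * (1+\<gamma>)) = 1" using assms(1) by simp
    finally show ?thesis by simp
  qed
  have 2: "dirderiv (ey j) (gauge \<gamma>) z = ?h powr (?c - 1) * (1+\<gamma>) * snd z $ j" for j
  proof -
    have "dirderiv (ey j) (gauge \<gamma>) z = ?c * ?h powr (?c - 1) * (2 * (1+\<gamma>)\<^sup>2 * snd z $ j)"
      using DERIV_unique[OF has_real_derivative_line_dirderiv[OF gauge_differentiable[OF assms], of "ey j"]]
        line_gauge_pow_powr_ey[OF assms(1) z, of j ?c] by (simp add: eq)
    also have "\<dots> = ?h powr (?c - 1) * (?c * (2 * (1+\<gamma>)) * (1+\<gamma>)) * snd z $ j"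
      by (simp only: power2_eq_square mult_ac)
    also have "?c * (2 * (1+\<gamma>)) * (1+\<gamma>) = 1+\<gamma>" using assms(1) by simp
    finally show ?thesis .
  qed
  have "grushin_grad_sq \<gamma> (gauge \<gamma>) z = (?h powr (?c - 1))\<^sup>2 * ?r * (?r * (norm (fst z))\<^sup>2 + (1+\<gamma>)\<^sup>2 * (norm (snd z))\<^sup>2)"
    unfolding grushin_grad_sq_def norm_powr_sq[of "fst z" \<gamma>] 1 2 power_mult_distrib sum_distrib_left[symmetric] norm_sq_vec
    by algebra
  also have "?r * (norm (fst z))\<^sup>2 + (1+\<gamma>)\<^sup>2 * (norm (snd z))\<^sup>2 = ?h"
    using norm_powr_mult_norm_sq[of "fst z" "2 * \<gamma>"] by (simp add: gauge_pow_def algebra_simps)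
  also have "(?h powr (?c - 1))\<^sup>2 * ?r * ?h = ?r * (?h powr (2 * (?c - 1)) * ?h powr 1)"
    using gauge_pow_pos[OF assms(1) z] by (simp add: powr_mult_base[symmetric] power2_eq_square flip: powr_add)
  also have "\<dots> = ?r * ?h powr (2 * (?c - 1) + 1)"
    by (simp only: powr_add)
  also have "2 * (?c - 1) + 1 = - (\<gamma> / (1+\<gamma>))"
  proof -
    have e: "2 * ?c = 1 / (1+\<gamma>)" "\<gamma> / (1+\<gamma>) = 1 - 1 / (1+\<gamma>)" using assms(1) by (simp_all add: field_simps)
    show ?thesis unfolding right_diff_distrib e by simp
  qed
  finally show ?thesis .
qed

section \<open>The two integrands in terms of h\<close>

lemma gauge_eq_0_iff:
  assumes "\<gamma> > 0"
  shows "gauge \<gamma> z = 0 \<longleftrightarrow> z = 0"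
proof -
  have "gauge \<gamma> z = gauge_pow \<gamma> z powr (1 / (2*(1+\<gamma>)))"
    by (simp add: gauge_def gauge_pow_def)
  then show ?thesis
    using gauge_pow_pos[OF assms, of z] assms by (cases "z = 0") (auto simp: gauge_pow_def)
qed

text \<open>No exceptional set arises: at the origin both sides are 0 because
  \<open>0 powr c = 0\<close>.\<close>

lemma rhs_integrand:
  assumes "\<gamma> > 0"
  shows "gauge \<gamma> z powr \<alpha> * G / (gauge \<gamma> z)\<^sup>2 = gauge_pow \<gamma> z powr ((\<alpha> - 2) / (2*(1+\<gamma>))) * G"
proof (cases "z = 0")
  case True
  then show ?thesis using gauge_eq_0_iff[OF assms, of z] by (simp add: gauge_pow_def)
next
  case False
  then have "gauge \<gamma> z > 0"
    using gauge_eq_0_iff[OF assms, of z] by (simp add: gauge_def less_le)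
  then have "gauge \<gamma> z powr \<alpha> * G / (gauge \<gamma> z)\<^sup>2 = gauge \<gamma> z powr (\<alpha> - 2) * G"
    by (simp add: powr_diff)
  then show ?thesis by (simp add: gauge_powr)
qed

lemma lhs_integrand:
  assumes "\<gamma> > 0" "fst z \<noteq> 0"
  shows "gauge \<gamma> z powr \<alpha> * l\<^sup>2 / grushin_grad_sq \<gamma> (gauge \<gamma>) z =
    gauge_pow \<gamma> z powr ((\<alpha> - 2) / (2*(1+\<gamma>)) + 1) / norm (fst z) powr (2*\<gamma>) * l\<^sup>2"
proof -
  have z: "z \<noteq> 0" using assms by auto
  \<comment> \<open>The weight \<rho>^\<alpha> contributes \<alpha>/(2(1+\<gamma>)) and
    1/|\<nabla>\<rho>|^2 contributes \<gamma>/(1+\<gamma>); the sum exceeds the exponent of the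
    right-hand weight by exactly 1.\<close>
  have e: "(\<alpha> - 2) / (2*(1+\<gamma>)) + 1 = \<alpha> / (2*(1+\<gamma>)) + \<gamma> / (1+\<gamma>)"
  proof -
    have "\<gamma> / (1+\<gamma>) = 1 - 1 / (1+\<gamma>)" using assms(1) by (simp add: field_simps)
    moreover have "(\<alpha> - 2) / (2*(1+\<gamma>)) = \<alpha> / (2*(1+\<gamma>)) - 2 / (2*(1+\<gamma>))"
      by (rule diff_divide_distrib)
    moreover have "2 / (2*(1+\<gamma>)) = 1 / (1+\<gamma>)"
      using assms(1) by (simp add: field_simps)
    ultimately show ?thesis by simp
  qed
  show ?thesis
    unfolding grushin_grad_sq_gauge[OF assms] gauge_powr e powr_add powr_minus
    using gauge_pow_pos[OF assms(1) z] by (simp add: field_simps)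
qed

lemma rhs_int_eq:
  fixes \<phi> :: "('m::finite,'k::finite) pt \<Rightarrow> real"
  assumes "\<gamma> > 0" "test_fun \<phi>"
  shows "rhs_int \<gamma> \<alpha> \<phi> = ennreal (\<integral>z. gauge_pow \<gamma> z powr ((\<alpha> - 2) / (2*(1+\<gamma>))) * grushin_grad_sq \<gamma> \<phi> z \<partial>lborel)"
  unfolding rhs_int_def rhs_integrand[OF assms(1)]
  by (intro nn_integral_eq_integral integrable_terms(1) assms)
     (simp add: grushin_grad_sq_def sum_nonneg)

text \<open>Off the origin the expression is h^\<beta> |\<nabla>\<phi> + A \<phi>
  \<nabla>\<rho>/\<rho>|^2, expanded; at the origin all powers of h are 0.\<close>

lemma hardy_pointwise:
  fixes z :: "('m::finite,'k::finite) pt"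
  assumes "\<gamma> > 0"
  shows "0 \<le> gauge_pow \<gamma> z powr \<beta> * grushin_grad_sq \<gamma> \<phi> z
    + 2 * A * (gauge_pow \<gamma> z powr (\<beta> - 1) * norm (fst z) powr (2*\<gamma>) * (\<phi> z * dilation_deriv \<gamma> \<phi> z))
    + A\<^sup>2 * (gauge_pow \<gamma> z powr (\<beta> - 1) * norm (fst z) powr (2*\<gamma>) * (\<phi> z)\<^sup>2)" (is "0 \<le> ?E")
proof (cases "z = 0")
  case True
  then show ?thesis by (simp add: gauge_pow_def)
next
  case False
  \<comment> \<open>Since \<nabla>\<rho>/\<rho> = \<nabla>h / (2(1+\<gamma>) h), the components of A
    \<phi> \<nabla>\<rho>/\<rho> are \<open>q * r * fst z $ i\<close> and |x|^\<gamma> times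
    \<open>q * (1+\<gamma>) * snd z $ j\<close>.\<close>
  define h r q where "h = gauge_pow \<gamma> z" and "r = norm (fst z) powr (2*\<gamma>)" and "q = A * \<phi> z / h"
  have h: "h > 0" unfolding h_def by (rule gauge_pow_pos[OF assms False])
  have rh: "r * (norm (fst z))\<^sup>2 + (1+\<gamma>)\<^sup>2 * (norm (snd z))\<^sup>2 = h"
    using norm_powr_mult_norm_sq[of "fst z" "2 * \<gamma>"] by (simp add: r_def h_def gauge_pow_def algebra_simps)
  have 1: "(\<Sum>i\<in>UNIV. (dirderiv (ex i) \<phi> z + q * r * fst z $ i)\<^sup>2) =
      (\<Sum>i\<in>UNIV. (dirderiv (ex i) \<phi> z)\<^sup>2) + 2 * q * r * (\<Sum>i\<in>UNIV. fst z $ i * dirderiv (ex i) \<phi> z) + (q * r)\<^sup>2 * (norm (fst z))\<^sup>2"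
    unfolding norm_sq_vec sum_distrib_left sum.distrib[symmetric]
    by (rule sum.cong) (auto simp: power2_eq_square algebra_simps)
  have 2: "(\<Sum>j\<in>UNIV. (dirderiv (ey j) \<phi> z + q * (1+\<gamma>) * snd z $ j)\<^sup>2) =
      (\<Sum>j\<in>UNIV. (dirderiv (ey j) \<phi> z)\<^sup>2) + 2 * q * (1+\<gamma>) * (\<Sum>j\<in>UNIV. snd z $ j * dirderiv (ey j) \<phi> z) + (q * (1+\<gamma>))\<^sup>2 * (norm (snd z))\<^sup>2"
    unfolding norm_sq_vec sum_distrib_left sum.distrib[symmetric]
    by (rule sum.cong) (auto simp: power2_eq_square algebra_simps)
  have "0 \<le> h powr \<beta> * ((\<Sum>i\<in>UNIV. (dirderiv (ex i) \<phi> z + q * r * fst z $ i)\<^sup>2)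
     + r * (\<Sum>j\<in>UNIV. (dirderiv (ey j) \<phi> z + q * (1+\<gamma>) * snd z $ j)\<^sup>2))"
    by (intro mult_nonneg_nonneg add_nonneg_nonneg sum_nonneg) (auto simp: r_def)
  also have "\<dots> = h powr \<beta> * (grushin_grad_sq \<gamma> \<phi> z + 2 * q * r * dilation_deriv \<gamma> \<phi> z +
      q\<^sup>2 * r * (r * (norm (fst z))\<^sup>2 + (1+\<gamma>)\<^sup>2 * (norm (snd z))\<^sup>2))"
    unfolding 1 2 grushin_grad_sq_def dilation_deriv_def norm_powr_sq r_def[symmetric] by algebra
  also have "\<dots> = h powr \<beta> * grushin_grad_sq \<gamma> \<phi> z + 2 * A * (h powr \<beta> / h * r * (\<phi> z * dilation_deriv \<gamma> \<phi> z))
      + A\<^sup>2 * (h powr \<beta> / h * r * (\<phi> z)\<^sup>2)"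
    unfolding rh using h by (simp add: q_def field_simps power2_eq_square)
  also have "h powr \<beta> / h = h powr (\<beta> - 1)"
    using h by (simp add: powr_diff)
  finally show ?thesis unfolding h_def r_def .
qed

text \<open>The lower bound \<open>g\<close> may change sign and the right-hand side may be
  infinite. Truncating \<open>g\<close> at 0 only increases its integral, and \<open>ennreal\<close>
  sends negative values to 0.\<close>

lemma ennreal_integral_le_nn_integral:
  assumes "integrable M g" "AE x in M. g x \<le> f x"
  shows "ennreal (integral\<^sup>L M g) \<le> (\<integral>\<^sup>+x. ennreal (f x) \<partial>M)"
proof -
  have "integral\<^sup>L M g \<le> integral\<^sup>L M (\<lambda>x. max 0 (g x))"
    using assms(1) by (intro integral_mono) auto
  then have "ennreal (integral\<^sup>L M g) \<le> ennreal (integral\<^sup>L M (\<lambda>x. max 0 (g x)))"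
    by (rule ennreal_leI)
  also have "\<dots> = (\<integral>\<^sup>+x. ennreal (max 0 (g x)) \<partial>M)"
    using assms(1) by (intro nn_integral_eq_integral[symmetric]) auto
  also have "\<dots> \<le> (\<integral>\<^sup>+x. ennreal (f x) \<partial>M)"
    using assms(2) by (intro nn_integral_mono_AE) (auto elim!: eventually_mono simp: max_def ennreal_leI ennreal_neg)
  finally show ?thesis .
qed

text \<open>The first part is the argument of the introductory comment. The second uses R >= A^2 N
  again: if N were 0, \<phi> would vanish almost everywhere, hence everywhere by continuity.\<close>

lemma grushin_rellich:
  fixes \<gamma> \<alpha> :: real and \<phi> :: "('m::finite,'k::finite) pt \<Rightarrow> real"
  defines "Q \<equiv> hom_dim \<gamma> TYPE(('m,'k) pt)"
  assumes \<gamma>: "\<gamma> > 0" and \<alpha>: "2 < \<alpha>" "\<alpha> < Q" and test: "test_fun \<phi>"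
  shows "ennreal ((Q - \<alpha>)\<^sup>2 / 4) * rhs_int \<gamma> \<alpha> \<phi> \<le> lhs_int \<gamma> \<alpha> \<phi>"
    and "\<phi> \<noteq> (\<lambda>z. 0) \<Longrightarrow> 0 < rhs_int \<gamma> \<alpha> \<phi>"
proof -
  define \<beta> A B where "\<beta> = (\<alpha> - 2) / (2*(1+\<gamma>))" and "A = (Q + \<alpha> - 4) / 2" and "B = (Q - \<alpha>) / 2"
  let ?h = "gauge_pow \<gamma> :: ('m,'k) pt \<Rightarrow> real" and ?r = "\<lambda>z :: ('m,'k) pt. norm (fst z) powr (2*\<gamma>)"
  define R P X N where "R = (\<integral>z. ?h z powr \<beta> * grushin_grad_sq \<gamma> \<phi> z \<partial>lborel)"
    and "P = (\<integral>z. ?h z powr \<beta> * (\<phi> z * grushin_lap \<gamma> \<phi> z) \<partial>lborel)"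
    and "X = (\<integral>z. ?h z powr (\<beta> - 1) * ?r z * (\<phi> z * dilation_deriv \<gamma> \<phi> z) \<partial>lborel)"
    and "N = (\<integral>z. ?h z powr (\<beta> - 1) * ?r z * (\<phi> z)\<^sup>2 \<partial>lborel)"
  note int = integrable_terms[OF \<gamma> test]
  have \<beta>: "2 * (1+\<gamma>) * \<beta> = A - B" using \<gamma> by (simp add: \<beta>_def A_def B_def field_simps)
  \<comment> \<open>Both Q and \<alpha> exceed 2, so A > 0 and 2 A - B = (Q + 3 \<alpha> - 8)/2 >
    0.\<close>
  have AB: "A > 0" "B > 0" "2 * A \<ge> B" using \<alpha> by (auto simp: A_def B_def)
  have I1: "R + P + (A - B) * X = 0"
    using green_identity[OF \<gamma> test, of \<beta>] unfolding R_def P_def X_def \<beta> .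
  \<comment> \<open>With the exponent \<beta> - 1 the coefficient of N in the dilation identity
    becomes 2 A, so X = - A N.\<close>
  have "2 * X + (2 * (1+\<gamma>) * (\<beta> - 1) + Q + 2 * \<gamma>) * N = 0"
    using dilation_identity[OF \<gamma> test, of "\<beta> - 1"] unfolding N_def X_def Q_def .
  moreover have "2 * (1+\<gamma>) * (\<beta> - 1) + Q + 2 * \<gamma> = 2 * A"
  proof -
    have "2 * (1+\<gamma>) * (\<beta> - 1) = (A - B) - 2 * (1+\<gamma>)"
      using \<beta> by (simp add: right_diff_distrib)
    then show ?thesis by (simp add: A_def B_def field_simps)
  qed
  ultimately have I2: "X = - A * N" by simp
  have N0: "N \<ge> 0" unfolding N_def by (intro integral_nonneg_AE) auto
  have "0 \<le> (\<integral>z. ?h z powr \<beta> * grushin_grad_sq \<gamma> \<phi> z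
    + 2 * A * (?h z powr (\<beta> - 1) * ?r z * (\<phi> z * dilation_deriv \<gamma> \<phi> z))
    + A\<^sup>2 * (?h z powr (\<beta> - 1) * ?r z * (\<phi> z)\<^sup>2) \<partial>lborel)"
    by (intro integral_nonneg_AE AE_I2 hardy_pointwise \<gamma>)
  also have "\<dots> = R + 2 * A * X + A\<^sup>2 * N"
    unfolding R_def X_def N_def using int by simp
  finally have S: "R - A\<^sup>2 * N \<ge> 0" unfolding I2 by (simp add: power2_eq_square)
  have g: "integrable lborel (\<lambda>z. - (2 * A * B * (?h z powr \<beta> * (\<phi> z * grushin_lap \<gamma> \<phi> z)))
      - (A * B)\<^sup>2 * (?h z powr (\<beta> - 1) * ?r z * (\<phi> z)\<^sup>2))" (is "integrable _ ?g")
    using int by simp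
  have le: "?g z \<le> gauge \<gamma> z powr \<alpha> * (grushin_lap \<gamma> \<phi> z)\<^sup>2 / grushin_grad_sq \<gamma> (gauge \<gamma>) z"
    if z: "fst z \<noteq> 0" for z
  proof -
    have z': "z \<noteq> 0" using z by auto
    define hz rz l where "hz = ?h z" and "rz = ?r z" and "l = grushin_lap \<gamma> \<phi> z"
    have pos: "hz > 0" "rz > 0" using gauge_pow_pos[OF \<gamma> z'] z by (auto simp: hz_def rz_def)
    \<comment> \<open>The square of the introductory comment with a common factor pulled out. Its
      cross term is the integrand of P and its last term that of N.\<close>
    have "0 \<le> hz powr \<beta> / (hz * rz) * (hz * l + A * B * rz * \<phi> z)\<^sup>2"
      using pos by simp
    also have "\<dots> = (hz powr \<beta> * hz) / rz * l\<^sup>2 + 2 * A * B * (hz powr \<beta> * (\<phi> z * l)) + (A * B)\<^sup>2 * (hz powr \<beta> / hz * rz * (\<phi> z)\<^sup>2)"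
      using pos by (simp add: field_simps power2_eq_square)
    also have "hz powr \<beta> * hz = hz powr (\<beta> + 1)" using pos by (simp add: powr_add)
    also have "hz powr \<beta> / hz = hz powr (\<beta> - 1)" using pos by (simp add: powr_diff)
    finally show ?thesis
      unfolding lhs_integrand[OF \<gamma> z] \<beta>_def[symmetric] hz_def[symmetric] rz_def[symmetric] l_def[symmetric] by linarith
  qed
  have "B\<^sup>2 * R \<le> integral\<^sup>L lborel ?g"
  proof -
    have "integral\<^sup>L lborel ?g = - (2 * A * B * P) - (A * B)\<^sup>2 * N"
      unfolding P_def N_def using int by simp
    also have "P = - R + (A - B) * A * N" using I1 I2 by (simp add: algebra_simps)
    \<comment> \<open>The surplus over B^2 R is a nonnegative multiple of R - A^2 N, so the Hardy
      inequality finishes the estimate.\<close>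
    also have "- (2 * A * B * (- R + (A - B) * A * N)) - (A * B)\<^sup>2 * N = B\<^sup>2 * R + B * (2 * A - B) * (R - A\<^sup>2 * N)"
      by algebra
    finally show ?thesis using AB S by simp
  qed
  also have "ennreal (integral\<^sup>L lborel ?g) \<le> lhs_int \<gamma> \<alpha> \<phi>"
    unfolding lhs_int_def
    by (rule ennreal_integral_le_nn_integral[OF g]) (use AE_fst_nonzero in eventually_elim, rule le)
  finally have "ennreal (B\<^sup>2 * R) \<le> lhs_int \<gamma> \<alpha> \<phi>" by (simp add: ennreal_leI)
  moreover have "rhs_int \<gamma> \<alpha> \<phi> = ennreal R"
    unfolding R_def \<beta>_def by (rule rhs_int_eq[OF \<gamma> test])
  moreover have "(Q - \<alpha>)\<^sup>2 / 4 = B\<^sup>2" by (simp add: B_def power_divide)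
  moreover have "ennreal (B\<^sup>2) * ennreal R = ennreal (B\<^sup>2 * R)" by (simp add: ennreal_mult')
  ultimately show "ennreal ((Q - \<alpha>)\<^sup>2 / 4) * rhs_int \<gamma> \<alpha> \<phi> \<le> lhs_int \<gamma> \<alpha> \<phi>"
    by simp
  show "0 < rhs_int \<gamma> \<alpha> \<phi>" if "\<phi> \<noteq> (\<lambda>z. 0)"
  proof -
    have "N \<noteq> 0"
    proof
      assume "N = 0"
      then have "AE z in lborel. ?h z powr (\<beta> - 1) * ?r z * (\<phi> z)\<^sup>2 = 0"
        unfolding N_def using int(4) by (subst (asm) integral_nonneg_eq_0_iff_AE) auto
      then have "AE z in lborel. z \<notin> {z. \<phi> z \<noteq> 0}"
        using AE_fst_nonzero
      proof eventually_elim
        case (elim z)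
        then have "?h z > 0" using gauge_pow_pos[OF \<gamma>, of z] by fastforce
        then show ?case using elim by simp
      qed
      moreover have "open {z. \<phi> z \<noteq> 0}"
        by (intro open_Collect_neq continuous_on_phi[OF \<gamma> test] continuous_on_const)
      ultimately have "{z. \<phi> z \<noteq> 0} = {}" by (intro open_AE_empty)
      then show False using that by auto
    qed
    then have "A\<^sup>2 * N > 0" using N0 AB by simp
    then have "R > 0" using S by linarith
    then show ?thesis using \<open>rhs_int \<gamma> \<alpha> \<phi> = ennreal R\<close> by simp
  qed
qed

section \<open>An algebra of smooth functions\<close>

text \<open>A power damped by exp (- b/s), flat to infinite order at 0 when b > 0. Admitting every
  real exponent makes the linear span of the family closed under differentiation.\<close>

definition flat :: "real \<Rightarrow> real \<Rightarrow> real \<Rightarrow> real" where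
  "flat a b s = (if s > 0 then s powr a * exp (- b / s) else 0)"

lemma flat_nonneg: "flat a b s \<ge> 0"
  by (simp add: flat_def)

lemma flat_tendsto_0:
  assumes "b > 0"
  shows "(flat a b \<longlongrightarrow> 0) (at 0)"
proof -
  \<comment> \<open>On (0,1) this choice gives s^a <= s^(-n), and x = 1/s turns the claim into the
    decay of x^n / exp (b x) at infinity.\<close>
  obtain n :: nat where n: "real n > - a" using reals_Archimedean2 by blast
  have "((\<lambda>s. flat a b s) \<longlongrightarrow> 0) (at_right 0)"
  proof (rule Lim_null_comparison)
    have "((\<lambda>x. x ^ n / exp (b * x)) \<longlongrightarrow> 0) at_top"
    proof -
      have "((\<lambda>x. (1 / b ^ n) * ((b * x) ^ n / exp (b * x))) \<longlongrightarrow> (1 / b ^ n) * 0) at_top"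
        by (intro tendsto_mult tendsto_const filterlim_compose[OF tendsto_power_div_exp_0])
          (use assms in \<open>auto intro: filterlim_tendsto_pos_mult_at_top filterlim_ident\<close>)
      then show ?thesis using assms by (simp add: power_mult_distrib)
    qed
    from filterlim_compose[OF this filterlim_inverse_at_top_right]
    show "((\<lambda>s. inverse s ^ n / exp (b * inverse s)) \<longlongrightarrow> 0) (at_right 0)" .
    show "\<forall>\<^sub>F s in at_right 0. norm (flat a b s) \<le> inverse s ^ n / exp (b * inverse s)"
      unfolding eventually_at_right_field
    proof (intro exI[of _ 1] conjI allI impI)
      fix s :: real assume s: "0 < s" "s < 1"
      have "s powr a \<le> s powr (- real n)" using s n by (intro powr_mono') auto
      also have "\<dots> = inverse s ^ n" using s by (simp add: powr_minus powr_realpow power_inverse)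
      finally show "norm (flat a b s) \<le> inverse s ^ n / exp (b * inverse s)"
        using s by (simp add: flat_def exp_minus divide_inverse mult_right_mono)
    qed simp
  qed
  moreover have "((\<lambda>s. flat a b s) \<longlongrightarrow> 0) (at_left 0)"
    by (rule tendsto_eventually) (auto simp: flat_def eventually_at_left_field intro: exI[of _ "-1"])
  ultimately show ?thesis by (simp add: filterlim_split_at)
qed

text \<open>At s = 0 the difference quotient of \<open>flat a b\<close> is
  \<open>flat (a - 1) b\<close>, which tends to 0; elsewhere this is the product rule or the
  derivative of 0.\<close>

lemma DERIV_flat:
  assumes "b > 0"
  shows "(flat a b has_real_derivative a * flat (a - 1) b s + b * flat (a - 2) b s) (at s)"
proof -
  consider "s > 0" | "s < 0" | "s = 0" by linarith
  then show ?thesis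
  proof cases
    case 1
    have "((\<lambda>s. s powr a * exp (- b / s)) has_real_derivative
        a * s powr (a - 1) * exp (- b / s) + exp (- b / s) * (b / (s * s)) * s powr a) (at s)"
      using 1 by (auto intro!: derivative_eq_intros simp: has_real_derivative_powr)
    moreover have "a * s powr (a - 1) * exp (- b / s) + exp (- b / s) * (b / (s * s)) * s powr a
        = a * flat (a - 1) b s + b * flat (a - 2) b s"
      using 1 by (simp add: flat_def powr_diff power2_eq_square mult.assoc mult.left_commute mult.commute)
    ultimately have "((\<lambda>s. s powr a * exp (- b / s)) has_real_derivative
        a * flat (a - 1) b s + b * flat (a - 2) b s) (at s)" by simp
    then show ?thesis
      by (rule has_field_derivative_transform_within_open[where S = "{0<..}"]) (use 1 in \<open>auto simp: flat_def\<close>)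
  next
    case 2
    have "((\<lambda>s. 0) has_real_derivative a * flat (a - 1) b s + b * flat (a - 2) b s) (at s)"
      using 2 by (simp add: flat_def)
    then show ?thesis
      by (rule has_field_derivative_transform_within_open[where S = "{..<0}"]) (use 2 in \<open>auto simp: flat_def\<close>)
  next
    case 3
    have "((\<lambda>t. flat a b t / t) \<longlongrightarrow> 0) (at 0)"
    proof (rule Lim_transform_eventually[OF flat_tendsto_0[OF assms, of "a - 1"]])
      show "\<forall>\<^sub>F t in at 0. flat (a - 1) b t = flat a b t / t"
        by (auto simp: flat_def powr_diff)
    qed
    then show ?thesis using 3 by (simp add: DERIV_def flat_def)
  qed
qed

text \<open>Closed under directional derivatives, hence consisting of functions smooth in the iterated sense.\<close>
inductive smooth_alg :: "('a::real_normed_vector \<Rightarrow> real) \<Rightarrow> bool" where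
  const: "smooth_alg (\<lambda>_. c)"
| linear: "bounded_linear f \<Longrightarrow> smooth_alg f"
| add: "smooth_alg f \<Longrightarrow> smooth_alg g \<Longrightarrow> smooth_alg (\<lambda>x. f x + g x)"
| mult: "smooth_alg f \<Longrightarrow> smooth_alg g \<Longrightarrow> smooth_alg (\<lambda>x. f x * g x)"
| flat: "smooth_alg f \<Longrightarrow> b > 0 \<Longrightarrow> smooth_alg (\<lambda>x. flat a b (f x))"
| powr: "smooth_alg f \<Longrightarrow> (\<And>x. f x > 0) \<Longrightarrow> smooth_alg (\<lambda>x. f x powr a)"

text \<open>Every rule of differentiation stays inside the algebra. Differentiability and closure
  share one induction because the rules for sums, products and compositions require differentiable
  ingredients.\<close>

lemma smooth_alg_deriv:
  fixes f :: "'a::real_normed_vector \<Rightarrow> real"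
  assumes "smooth_alg f"
  shows "(\<forall>z. f differentiable (at z)) \<and> (\<forall>v. smooth_alg (dirderiv v f))"
  using assms
proof induction
  case (const c)
  have *: "((\<lambda>_. c) has_derivative (\<lambda>_. 0)) (at z)" for z :: 'a by simp
  then have "dirderiv v (\<lambda>_. c) = (\<lambda>_. 0)" for v :: 'a by (intro ext dirderiv_eq)
  then show ?case using * by (auto simp: differentiable_def intro: smooth_alg.const)
next
  case (linear f)
  have *: "(f has_derivative f) (at z)" for z using bounded_linear_imp_has_derivative[OF linear] .
  then have "dirderiv v f = (\<lambda>_. f v)" for v by (intro ext dirderiv_eq) 
  then show ?case using * by (auto simp: differentiable_def intro: smooth_alg.const)
next
  case (add f g)
  have *: "((\<lambda>x. f x + g x) has_derivative (\<lambda>v. dirderiv v f z + dirderiv v g z)) (at z)" for z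
    using add by (intro has_derivative_add has_derivative_dirderiv) auto
  then have "dirderiv v (\<lambda>x. f x + g x) = (\<lambda>z. dirderiv v f z + dirderiv v g z)" for v
    by (intro ext dirderiv_eq)
  then show ?case using * add by (auto simp: differentiable_def intro: smooth_alg.add)
next
  case (mult f g)
  have *: "((\<lambda>x. f x * g x) has_derivative (\<lambda>v. f z * dirderiv v g z + dirderiv v f z * g z)) (at z)" for z
    using mult by (intro has_derivative_mult has_derivative_dirderiv) auto
  then have "dirderiv v (\<lambda>x. f x * g x) = (\<lambda>z. f z * dirderiv v g z + dirderiv v f z * g z)" for v
    by (intro ext dirderiv_eq)
  then show ?case using * mult by (auto simp: differentiable_def intro!: smooth_alg.add smooth_alg.mult)
next
  case (flat f b a)
  have *: "((\<lambda>x. flat a b (f x)) has_derivative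
      (\<lambda>v. dirderiv v f z * (a * flat (a - 1) b (f z) + b * flat (a - 2) b (f z)))) (at z)" for z
    using flat by (intro DERIV_compose_FDERIV[OF DERIV_flat] has_derivative_dirderiv) auto
  then have "dirderiv v (\<lambda>x. flat a b (f x)) =
      (\<lambda>z. dirderiv v f z * (a * flat (a - 1) b (f z) + b * flat (a - 2) b (f z)))" for v
    by (intro ext dirderiv_eq)
  then show ?case using * flat
    by (auto simp: differentiable_def intro!: smooth_alg.add smooth_alg.mult smooth_alg.const smooth_alg.flat)
next
  case (powr f a)
  have *: "((\<lambda>x. f x powr a) has_derivative (\<lambda>v. dirderiv v f z * (a * f z powr (a - 1)))) (at z)" for z
    using powr by (intro DERIV_compose_FDERIV[OF has_real_derivative_powr] has_derivative_dirderiv) auto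
  then have "dirderiv v (\<lambda>x. f x powr a) = (\<lambda>z. dirderiv v f z * (a * f z powr (a - 1)))" for v
    by (intro ext dirderiv_eq)
  then show ?case using * powr
    by (auto simp: differentiable_def intro!: smooth_alg.mult smooth_alg.const smooth_alg.powr)
qed

lemma smooth_alg_imp_smooth:
  assumes "smooth_alg f"
  shows "smooth f"
proof -
  have "smooth_alg (iter_dirderiv vs f)" for vs
    by (induction vs) (use assms smooth_alg_deriv in auto)
  then show ?thesis using smooth_alg_deriv unfolding smooth_def by blast
qed

lemma smooth_alg_dirderiv: "smooth_alg f \<Longrightarrow> smooth_alg (dirderiv v f)"
  using smooth_alg_deriv by blast

lemma smooth_alg_diff:
  assumes "smooth_alg f" "smooth_alg g"
  shows "smooth_alg (\<lambda>x. f x - g x)"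
  using smooth_alg.add[OF assms(1) smooth_alg.mult[OF smooth_alg.const[of "-1"] assms(2)]] by simp

lemma smooth_alg_sum:
  assumes "finite I" "\<And>i. i \<in> I \<Longrightarrow> smooth_alg (f i)"
  shows "smooth_alg (\<lambda>x. \<Sum>i\<in>I. f i x)"
  using assms by (induction I rule: finite_induct) (auto intro: smooth_alg.const smooth_alg.add)

lemma smooth_alg_compose:
  fixes g :: "real \<Rightarrow> real"
  assumes "smooth_alg g" "smooth_alg f"
  shows "smooth_alg (\<lambda>x. g (f x))"
  using assms(1)
proof induction
  case (linear g)
  have "g (f x) = g 1 * f x" for x
    using linear_scale[OF bounded_linear.linear[OF linear], of "f x" 1] by simp
  then show ?case using assms(2) by (simp add: smooth_alg.mult smooth_alg.const)
qed (auto intro: smooth_alg.intros)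

lemma smooth_alg_real_deriv:
  fixes f :: "real \<Rightarrow> real"
  assumes "smooth_alg f"
  shows "(f has_real_derivative dirderiv 1 f x) (at x)"
  using has_real_derivative_line_dirderiv[OF smooth_differentiable[OF smooth_alg_imp_smooth[OF assms]], of x 1]
  by (simp add: DERIV_shift[of _ _ 0 x, simplified] add.commute)

lemma smooth_alg_continuous_on: "smooth_alg f \<Longrightarrow> continuous_on S f"
  by (intro smooth_continuous_on smooth_alg_imp_smooth)

lemma smooth_alg_ident: "smooth_alg (\<lambda>x::real. x)"
  by (rule smooth_alg.linear) (rule bounded_linear_ident)

text \<open>The usual smooth transition e(t) / (e(t) + e(1 - t)), with e(t) = exp (- 1/t) for t > 0
  and 0 otherwise. Division is written as \<open>powr (- 1)\<close>, which the algebra admits for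
  positive bases.\<close>

definition ustep :: "real \<Rightarrow> real" where
  "ustep t = flat 0 1 t * (flat 0 1 t + flat 0 1 (1 - t)) powr (- 1)"

lemma ustep_denominator_pos: "flat 0 1 t + flat 0 1 (1 - t) > 0"
  by (cases "t > 0") (auto simp: flat_def add_pos_nonneg)

lemma smooth_alg_ustep: "smooth_alg ustep"
  unfolding ustep_def
  by (intro smooth_alg.mult smooth_alg.powr smooth_alg.add smooth_alg.flat smooth_alg_diff
      smooth_alg.const smooth_alg_ident ustep_denominator_pos) auto

lemma ustep_le_0: "t \<le> 0 \<Longrightarrow> ustep t = 0"
  by (simp add: ustep_def flat_def)

lemma ustep_ge_1: "t \<ge> 1 \<Longrightarrow> ustep t = 1"
  by (simp add: ustep_def flat_def powr_minus)

lemma ustep_bounds: "0 \<le> ustep t" "ustep t \<le> 1"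
proof -
  have "ustep t = flat 0 1 t / (flat 0 1 t + flat 0 1 (1 - t))"
    using ustep_denominator_pos[of t] by (simp add: ustep_def powr_minus divide_inverse)
  then show "0 \<le> ustep t" "ustep t \<le> 1"
    using flat_nonneg ustep_denominator_pos[of t] by (auto simp: divide_le_eq)
qed

section \<open>Radial profiles\<close>

lemma smooth_alg_deriv_eqI:
  fixes f :: "real \<Rightarrow> real"
  assumes "smooth_alg f" "(g has_real_derivative D) (at x)" "open S" "x \<in> S" "\<And>y. y \<in> S \<Longrightarrow> f y = g y"
  shows "dirderiv 1 f x = D"
proof -
  have "(f has_real_derivative D) (at x)"
    by (rule has_field_derivative_transform_within_open[OF assms(2-4)]) (simp add: assms(5))
  then show ?thesis using smooth_alg_real_deriv[OF assms(1)] DERIV_unique by blast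
qed

text \<open>The power h^(-\<sigma>) switched on between h = 1/2 and h = 3/4. With c the step, the
  base 1 + (h - 1) c stays positive for every real h, so the power remains in the smooth
  algebra.\<close>

definition profile_inner :: "real \<Rightarrow> real \<Rightarrow> real" where
  "profile_inner \<sigma> h = (1 + (h - 1) * ustep (4 * h - 2)) powr (- \<sigma>) * ustep (4 * h - 2)"

definition profile_outer :: "real \<Rightarrow> real" where
  "profile_outer s = ustep (2 - s)"

text \<open>For \<sigma> = A / (2(1+\<gamma>)) the power h^(-\<sigma>) is the virtual extremal
  \<rho>^(-A). If H > 0, the profile agrees with it for 3/4 <= h <= H and vanishes for h <= 1/2 and
  for h >= 2 H.\<close>

definition profile :: "real \<Rightarrow> real \<Rightarrow> real \<Rightarrow> real" where
  "profile \<sigma> H h = profile_inner \<sigma> h * profile_outer (h / H)"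

lemma smooth_alg_profile_inner: "smooth_alg (profile_inner \<sigma>)"
proof -
  have a: "smooth_alg (\<lambda>h. ustep (4 * h - 2))"
    by (intro smooth_alg_compose[OF smooth_alg_ustep] smooth_alg_diff smooth_alg.mult smooth_alg.const smooth_alg_ident)
  have "1 + (h - 1) * ustep (4 * h - 2) > 0" for h
  proof (cases "h \<le> 1 / 2")
    case True
    then show ?thesis by (simp add: ustep_le_0)
  next
    case False
    define c where "c = ustep (4 * h - 2)"
    have c: "0 \<le> c" "c \<le> 1" using ustep_bounds by (auto simp: c_def)
    \<comment> \<open>A convex combination of 1 and h, where h > 1/2.\<close>
    have "1 + (h - 1) * c = (1 - c) + h * c" by algebra
    moreover have "(1 - c) + h * c > 0"
    proof (cases "c = 0")
      case False
      then have "h * c > 0" using c \<open>\<not> h \<le> 1 / 2\<close> by simp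
      then show ?thesis using c by linarith
    qed simp
    ultimately show ?thesis by (simp add: c_def)
  qed
  then show ?thesis
    unfolding profile_inner_def
    by (intro smooth_alg.mult smooth_alg.powr smooth_alg.add smooth_alg_diff smooth_alg.const smooth_alg_ident a)
qed

lemma smooth_alg_profile_outer: "smooth_alg profile_outer"
  unfolding profile_outer_def
  by (intro smooth_alg_compose[OF smooth_alg_ustep] smooth_alg_diff smooth_alg.const smooth_alg_ident)

lemma smooth_alg_profile: "smooth_alg (profile \<sigma> H)"
proof -
  have "smooth_alg (\<lambda>h. h / H)"
    using smooth_alg.mult[OF smooth_alg_ident smooth_alg.const[of "1 / H"]] by simp
  then show ?thesis
    unfolding profile_def
    by (intro smooth_alg.mult smooth_alg_compose[OF smooth_alg_profile_outer])
      (use smooth_alg_profile_inner in auto)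
qed

lemma profile_inner_le: "h \<le> 1/2 \<Longrightarrow> profile_inner \<sigma> h = 0"
  by (simp add: profile_inner_def ustep_le_0)

lemma profile_inner_ge: "h \<ge> 3/4 \<Longrightarrow> profile_inner \<sigma> h = h powr (- \<sigma>)"
  by (simp add: profile_inner_def ustep_ge_1)

lemma profile_outer_le: "s \<le> 1 \<Longrightarrow> profile_outer s = 1"
  by (simp add: profile_outer_def ustep_ge_1)

lemma profile_outer_ge: "s \<ge> 2 \<Longrightarrow> profile_outer s = 0"
  by (simp add: profile_outer_def ustep_le_0)

section \<open>Derivatives of the profile\<close>

abbreviation (input) "D1 f \<equiv> dirderiv (1::real) f"
abbreviation (input) "D2 f \<equiv> dirderiv (1::real) (dirderiv 1 f)"

lemma derivs_zero_on_open:
  fixes f :: "real \<Rightarrow> real"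
  assumes "smooth_alg f" "open S" "\<And>y. y \<in> S \<Longrightarrow> f y = c" "x \<in> S"
  shows "D1 f x = 0" "D2 f x = 0"
proof -
  have *: "D1 f y = 0" if "y \<in> S" for y
    by (rule smooth_alg_deriv_eqI[OF assms(1) DERIV_const assms(2) that assms(3)])
  show "D1 f x = 0" by (rule *[OF assms(4)])
  show "D2 f x = 0"
    by (rule smooth_alg_deriv_eqI[OF smooth_alg_dirderiv[OF assms(1)] DERIV_const assms(2,4) *])
qed

text \<open>The factors x^(\<sigma>+1) and x^(\<sigma>+2) make the derivatives of x^(-\<sigma>)
  constant. This scale-invariant form is the one in which the profile is controlled uniformly in
  H.\<close>

lemma derivs_powr_on_open:
  assumes "smooth_alg f" "open S" "S \<subseteq> {0<..}" "\<And>y. y \<in> S \<Longrightarrow> f y = y powr (- \<sigma>)" "x \<in> S"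
  shows "x powr (\<sigma> + 1) * D1 f x = - \<sigma>" "x powr (\<sigma> + 2) * D2 f x = \<sigma> * (\<sigma> + 1)"
proof -
  have *: "D1 f y = - \<sigma> * y powr (- \<sigma> - 1)" if "y \<in> S" for y
    by (rule smooth_alg_deriv_eqI[OF assms(1) has_real_derivative_powr assms(2) that assms(4)])
      (use that assms(3) in auto)
  have x: "x > 0" using assms(3,5) by auto
  have "x powr (\<sigma> + 1) * D1 f x = - \<sigma> * (x powr (\<sigma> + 1) * x powr (- \<sigma> - 1))"
    unfolding *[OF assms(5)] by simp
  then show "x powr (\<sigma> + 1) * D1 f x = - \<sigma>"
    using x by (simp flip: powr_add)
  have "((\<lambda>y. - \<sigma> * y powr (- \<sigma> - 1)) has_real_derivative - \<sigma> * ((- \<sigma> - 1) * x powr (- \<sigma> - 1 - 1))) (at x)"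
    by (intro DERIV_cmult has_real_derivative_powr x)
  then have "D2 f x = - \<sigma> * ((- \<sigma> - 1) * x powr (- \<sigma> - 1 - 1))"
    by (rule smooth_alg_deriv_eqI[OF smooth_alg_dirderiv[OF assms(1)] _ assms(2,5) *])
  then have "x powr (\<sigma> + 2) * D2 f x = \<sigma> * (\<sigma> + 1) * (x powr (\<sigma> + 2) * x powr (- \<sigma> - 1 - 1))"
    by (simp add: algebra_simps)
  then show "x powr (\<sigma> + 2) * D2 f x = \<sigma> * (\<sigma> + 1)"
    using x by (simp flip: powr_add)
qed

lemma profile_derivs_zero:
  assumes "H > 0" "x < 1/2 \<or> x > 2 * H"
  shows "profile \<sigma> H x = 0" "D1 (profile \<sigma> H) x = 0" "D2 (profile \<sigma> H) x = 0"
proof -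
  let ?S = "{..<1/2} \<union> {2 * H<..}"
  have S: "open ?S" "x \<in> ?S" using assms by auto
  have z: "profile \<sigma> H y = 0" if "y \<in> ?S" for y
    using that assms(1) by (auto simp: profile_def profile_inner_le profile_outer_ge field_simps)
  show "profile \<sigma> H x = 0" "D1 (profile \<sigma> H) x = 0" "D2 (profile \<sigma> H) x = 0"
    using z[OF S(2)] derivs_zero_on_open[OF smooth_alg_profile S(1) z S(2)] by auto
qed

lemma profile_plateau:
  assumes "1 \<le> x" "x < H"
  shows "x powr (\<sigma> + 1) * D1 (profile \<sigma> H) x = - \<sigma>"
    "x powr (\<sigma> + 2) * D2 (profile \<sigma> H) x = \<sigma> * (\<sigma> + 1)"
  by (rule derivs_powr_on_open[OF smooth_alg_profile, of "{3/4<..<H}"];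
      use assms in \<open>auto simp: profile_def profile_inner_ge profile_outer_le\<close>)+

lemma bounded_on_Icc:
  fixes f :: "real \<Rightarrow> real"
  assumes "continuous_on {a..b} f" "\<And>x. 0 < x \<Longrightarrow> x < a \<or> x > b \<Longrightarrow> \<bar>f x\<bar> \<le> c"
  shows "\<exists>C. \<forall>x>0. \<bar>f x\<bar> \<le> C"
proof -
  have "bounded (f ` {a..b})" using assms(1) by (intro compact_imp_bounded compact_continuous_image) auto
  then obtain C where C: "\<forall>x\<in>{a..b}. \<bar>f x\<bar> \<le> C" by (auto simp: bounded_iff)
  have "\<bar>f x\<bar> \<le> max C c" if "x > 0" for x
  proof (cases "x \<in> {a..b}")
    case True
    then show ?thesis using C by (simp add: le_max_iff_disj)
  next
    case False
    then have "\<bar>f x\<bar> \<le> c" using assms(2)[OF that] by auto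
    then show ?thesis by simp
  qed
  then show ?thesis by blast
qed

text \<open>The bound is uniform in H because the outer cutoff depends only on s = x/H: each
  derivative of it produces 1/H = s/x. The weighted derivatives thus become sums of products of a
  bounded function of x and a bounded function of s.\<close>

lemma profile_bound:
  "\<exists>C. \<forall>H\<ge>1. \<forall>x>0. \<bar>x powr (\<sigma> + 1) * D1 (profile \<sigma> H) x\<bar> \<le> C \<and> \<bar>x powr (\<sigma> + 2) * D2 (profile \<sigma> H) x\<bar> \<le> C"
proof -
  note si = smooth_alg_profile_inner[of \<sigma>] and so = smooth_alg_profile_outer
  note ci = smooth_alg_continuous_on[OF si] smooth_alg_continuous_on[OF smooth_alg_dirderiv[OF si]]
    smooth_alg_continuous_on[OF smooth_alg_dirderiv[OF smooth_alg_dirderiv[OF si]]]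
  note co = smooth_alg_continuous_on[OF so] smooth_alg_continuous_on[OF smooth_alg_dirderiv[OF so]]
    smooth_alg_continuous_on[OF smooth_alg_dirderiv[OF smooth_alg_dirderiv[OF so]]]
  let ?P = "profile_inner \<sigma>" and ?K = profile_outer
  have P0: "?P x = 0" "D1 ?P x = 0" "D2 ?P x = 0" if "x < 1/2" for x
    using that derivs_zero_on_open[OF si, of "{..<1/2}" 0 x] by (auto simp: profile_inner_le)
  have P1: "x powr (\<sigma> + 1) * D1 ?P x = - \<sigma>" "x powr (\<sigma> + 2) * D2 ?P x = \<sigma> * (\<sigma> + 1)" if "x > 1" for x
    by (rule derivs_powr_on_open[OF si, of "{1<..}"]; use that in \<open>auto simp: profile_inner_ge\<close>)+
  have K0: "?K x = 1" "D1 ?K x = 0" "D2 ?K x = 0" if "x < 1" for x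
    using that derivs_zero_on_open[OF so, of "{..<1}" 1 x] by (auto simp: profile_outer_le)
  have K1: "?K x = 0" "D1 ?K x = 0" "D2 ?K x = 0" if "x > 2" for x
    using that derivs_zero_on_open[OF so, of "{2<..}" 0 x] by (auto simp: profile_outer_ge)
  \<comment> \<open>This function and the five below are continuous on the compact interval of
    transition and explicit outside it.\<close>
  obtain a0 where a0: "\<And>x. x > 0 \<Longrightarrow> \<bar>x powr \<sigma> * ?P x\<bar> \<le> a0"
    using bounded_on_Icc[of "1/2" 1 "\<lambda>x. x powr \<sigma> * ?P x" 1]
    by (force intro!: continuous_intros ci simp: P0 profile_inner_ge powr_minus)
  obtain a1 where a1: "\<And>x. x > 0 \<Longrightarrow> \<bar>x powr (\<sigma> + 1) * D1 ?P x\<bar> \<le> a1"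
    using bounded_on_Icc[of "1/2" 1 "\<lambda>x. x powr (\<sigma> + 1) * D1 ?P x" "\<bar>\<sigma>\<bar>"]
    by (force intro!: continuous_intros ci simp: P0 P1)
  obtain a2 where a2: "\<And>x. x > 0 \<Longrightarrow> \<bar>x powr (\<sigma> + 2) * D2 ?P x\<bar> \<le> a2"
    using bounded_on_Icc[of "1/2" 1 "\<lambda>x. x powr (\<sigma> + 2) * D2 ?P x" "\<bar>\<sigma> * (\<sigma> + 1)\<bar>"]
    by (force intro!: continuous_intros ci simp: P0 P1)
  obtain b0 where b0: "\<And>x. x > 0 \<Longrightarrow> \<bar>?K x\<bar> \<le> b0"
    using bounded_on_Icc[of 1 2 ?K 1] by (force intro!: co simp: K0 K1)
  obtain b1 where b1: "\<And>x. x > 0 \<Longrightarrow> \<bar>x * D1 ?K x\<bar> \<le> b1"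
    using bounded_on_Icc[of 1 2 "\<lambda>x. x * D1 ?K x" 0] by (force intro!: continuous_intros co simp: K0 K1)
  obtain b2 where b2: "\<And>x. x > 0 \<Longrightarrow> \<bar>x\<^sup>2 * D2 ?K x\<bar> \<le> b2"
    using bounded_on_Icc[of 1 2 "\<lambda>x. x\<^sup>2 * D2 ?K x" 0] by (force intro!: continuous_intros co simp: K0 K1)
  define C where "C = max (a1 * b0 + a0 * b1) (a2 * b0 + 2 * (a1 * b1) + a0 * b2)"
  have "\<bar>x powr (\<sigma> + 1) * D1 (profile \<sigma> H) x\<bar> \<le> C \<and> \<bar>x powr (\<sigma> + 2) * D2 (profile \<sigma> H) x\<bar> \<le> C"
    if H: "H \<ge> 1" and x: "x > 0" for H x
  proof -
    have dK: "((\<lambda>x. ?K (x / H)) has_real_derivative D1 ?K (x / H) / H) (at x)"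
      "((\<lambda>x. D1 ?K (x / H)) has_real_derivative D2 ?K (x / H) / H) (at x)" for x
    proof -
      have i: "((\<lambda>x. x / H) has_real_derivative 1 / H) (at x)"
        by (intro derivative_eq_intros refl) (use H in auto)
      show "((\<lambda>x. ?K (x / H)) has_real_derivative D1 ?K (x / H) / H) (at x)"
        using DERIV_chain2[OF smooth_alg_real_deriv[OF so] i] by simp
      show "((\<lambda>x. D1 ?K (x / H)) has_real_derivative D2 ?K (x / H) / H) (at x)"
        using DERIV_chain2[OF smooth_alg_real_deriv[OF smooth_alg_dirderiv[OF so]] i] by simp
    qed
    have F1: "D1 (profile \<sigma> H) x = D1 ?P x * ?K (x / H) + ?P x * (D1 ?K (x / H) / H)" for x
    proof (rule smooth_alg_deriv_eqI[OF smooth_alg_profile _ open_UNIV UNIV_I])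
      show "((\<lambda>x. ?P x * ?K (x / H)) has_real_derivative
          D1 ?P x * ?K (x / H) + ?P x * (D1 ?K (x / H) / H)) (at x)"
        by (rule DERIV_cong[OF DERIV_mult[OF smooth_alg_real_deriv[OF si] dK(1)]]) simp
    qed (simp add: profile_def)
    have F2: "D2 (profile \<sigma> H) x = D2 ?P x * ?K (x / H) + 2 * (D1 ?P x * (D1 ?K (x / H) / H))
        + ?P x * (D2 ?K (x / H) / H / H)"
    proof (rule smooth_alg_deriv_eqI[OF smooth_alg_dirderiv[OF smooth_alg_profile] _ open_UNIV UNIV_I])
      show "((\<lambda>x. D1 ?P x * ?K (x / H) + ?P x * (D1 ?K (x / H) / H)) has_real_derivative
          D2 ?P x * ?K (x / H) + 2 * (D1 ?P x * (D1 ?K (x / H) / H)) + ?P x * (D2 ?K (x / H) / H / H)) (at x)"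
        by (rule DERIV_cong[OF DERIV_add[OF DERIV_mult[OF smooth_alg_real_deriv[OF smooth_alg_dirderiv[OF si]] dK(1)]
              DERIV_mult[OF smooth_alg_real_deriv[OF si] DERIV_cdivide[OF dK(2)]]]]) simp
    qed (rule F1)
    define s where "s = x / H"
    have s: "s > 0" "D / H = s * D / x" for D using x H by (auto simp: s_def)
    have p: "x powr (\<sigma> + 1) = x powr \<sigma> * x" "x powr (\<sigma> + 2) = x powr \<sigma> * x * x"
      using x by (simp_all add: powr_add power2_eq_square)
    have e1: "x powr (\<sigma> + 1) * D1 (profile \<sigma> H) x =
        (x powr (\<sigma> + 1) * D1 ?P x) * ?K s + (x powr \<sigma> * ?P x) * (s * D1 ?K s)"
      unfolding F1 s_def[symmetric] s(2) p using x by (simp add: field_simps)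
    have e2: "x powr (\<sigma> + 2) * D2 (profile \<sigma> H) x =
        (x powr (\<sigma> + 2) * D2 ?P x) * ?K s + 2 * ((x powr (\<sigma> + 1) * D1 ?P x) * (s * D1 ?K s))
        + (x powr \<sigma> * ?P x) * (s\<^sup>2 * D2 ?K s)"
      unfolding F2 s_def[symmetric] s(2) p using x by (simp add: field_simps power2_eq_square)
    have m: "\<bar>u * v\<bar> \<le> a * b" if "\<bar>u\<bar> \<le> a" "\<bar>v\<bar> \<le> b" for u v a b :: real
      using that by (simp add: abs_mult mult_mono')
    have "\<bar>x powr (\<sigma> + 1) * D1 (profile \<sigma> H) x\<bar> \<le> a1 * b0 + a0 * b1"
      unfolding e1 using m[OF a1[OF x] b0[OF s(1)]] m[OF a0[OF x] b1[OF s(1)]] by linarith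
    moreover have "\<bar>x powr (\<sigma> + 2) * D2 (profile \<sigma> H) x\<bar> \<le> a2 * b0 + 2 * (a1 * b1) + a0 * b2"
      unfolding e2 using m[OF a2[OF x] b0[OF s(1)]] m[OF a1[OF x] b1[OF s(1)]] m[OF a0[OF x] b2[OF s(1)]] by linarith
    ultimately show ?thesis unfolding C_def le_max_iff_disj by blast
  qed
  then show ?thesis by blast
qed

section \<open>Smooth trial functions\<close>

text \<open>The first derivative of \<open>flat (1+\<gamma>) b\<close>, the regularisation of
  s^(1+\<gamma>) with s = |x|^2; \<open>flat_deriv2\<close> is the second.\<close>

definition flat_deriv1 :: "real \<Rightarrow> real \<Rightarrow> real \<Rightarrow> real" where
  "flat_deriv1 \<gamma> b s = (1+\<gamma>) * flat \<gamma> b s + b * flat (\<gamma> - 1) b s"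

definition flat_deriv2 :: "real \<Rightarrow> real \<Rightarrow> real \<Rightarrow> real" where
  "flat_deriv2 \<gamma> b s = (1+\<gamma>) * (\<gamma> * flat (\<gamma> - 1) b s + b * flat (\<gamma> - 2) b s)
     + b * ((\<gamma> - 1) * flat (\<gamma> - 2) b s + b * flat (\<gamma> - 3) b s)"

lemma DERIV_flat_deriv:
  assumes "b > 0"
  shows "(flat (1+\<gamma>) b has_real_derivative flat_deriv1 \<gamma> b s) (at s)"
    and "(flat_deriv1 \<gamma> b has_real_derivative flat_deriv2 \<gamma> b s) (at s)"
proof -
  show "(flat (1+\<gamma>) b has_real_derivative flat_deriv1 \<gamma> b s) (at s)"
    using DERIV_flat[OF assms, of "1+\<gamma>" s] by (simp add: flat_deriv1_def)
  have "((\<lambda>s. (1+\<gamma>) * flat \<gamma> b s + b * flat (\<gamma> - 1) b s) has_real_derivative flat_deriv2 \<gamma> b s) (at s)"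
    by (rule DERIV_cong[OF DERIV_add[OF DERIV_cmult[OF DERIV_flat] DERIV_cmult[OF DERIV_flat]]])
      (use assms in \<open>simp_all add: flat_deriv2_def\<close>)
  then show "(flat_deriv1 \<gamma> b has_real_derivative flat_deriv2 \<gamma> b s) (at s)"
    by (simp add: flat_deriv1_def[abs_def])
qed

text \<open>Apart from a pure power of s, the parameter b enters only through b/s, as a polynomial
  times exp (- b/s). This is why bounds independent of b exist.\<close>

lemma flat_deriv_pos_eq:
  assumes "s > 0"
  shows "flat (1+\<gamma>) b s = s powr (1+\<gamma>) * exp (- (b / s))"
    and "flat_deriv1 \<gamma> b s = s powr \<gamma> * ((1 + \<gamma> + b / s) * exp (- (b / s)))"
    and "flat_deriv2 \<gamma> b s * s = s powr \<gamma> * ((\<gamma> * (1 + \<gamma>) + 2 * \<gamma> * (b / s) + (b / s)\<^sup>2) * exp (- (b / s)))"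
proof -
  define t where "t = b / s"
  have b: "b = t * s" using assms by (simp add: t_def)
  have f: "flat a b s = s powr a * exp (- t)" for a using assms by (simp add: flat_def t_def)
  have p: "s powr (\<gamma> - 1) = s powr \<gamma> / s" "s powr (\<gamma> - 2) = s powr \<gamma> / s / s" "s powr (\<gamma> - 3) = s powr \<gamma> / s / s / s"
    using assms by (simp_all add: powr_diff power2_eq_square power3_eq_cube)
  show "flat (1+\<gamma>) b s = s powr (1+\<gamma>) * exp (- (b / s))" using assms by (simp add: flat_def)
  show "flat_deriv1 \<gamma> b s = s powr \<gamma> * ((1 + \<gamma> + b / s) * exp (- (b / s)))"
    unfolding flat_deriv1_def f p t_def[symmetric] using assms by (simp add: b field_simps)
  show "flat_deriv2 \<gamma> b s * s = s powr \<gamma> * ((\<gamma> * (1 + \<gamma>) + 2 * \<gamma> * (b / s) + (b / s)\<^sup>2) * exp (- (b / s)))"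
    unfolding flat_deriv2_def f p t_def[symmetric] using assms by (simp add: b field_simps power2_eq_square)
qed

lemma flat_deriv_bounds:
  assumes "s > 0" "b > 0" "\<gamma> > 0"
  shows "\<bar>flat_deriv1 \<gamma> b s\<bar> \<le> s powr \<gamma> * (2 + \<gamma>)"
    and "\<bar>flat_deriv2 \<gamma> b s * s\<bar> \<le> s powr \<gamma> * (\<gamma> * (1 + \<gamma>) + 2 * \<gamma> + 2)"
proof -
  define t where "t = b / s"
  have t: "t > 0" using assms by (simp add: t_def)
  \<comment> \<open>This Taylor bound yields t exp (- t) <= 1 and t^2 exp (- t) <= 2, the source of
    the constants.\<close>
  have e: "1 + t + t\<^sup>2 / 2 \<le> exp t" using exp_lower_Taylor_quadratic[of t] t by simp
  have e0: "0 < exp (- t)" "exp (- t) \<le> 1" using t by auto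
  have e1: "t * exp (- t) \<le> 1" "t\<^sup>2 * exp (- t) \<le> 2"
    using e t by (auto simp: exp_minus field_simps) (use zero_le_power2[of t] in linarith)+
  have "(1 + \<gamma> + t) * exp (- t) \<le> 2 + \<gamma>"
    using e0 e1(1) mult_left_mono[OF e0(2), of "1 + \<gamma>"] assms(3) by (simp add: algebra_simps)
  then show "\<bar>flat_deriv1 \<gamma> b s\<bar> \<le> s powr \<gamma> * (2 + \<gamma>)"
    unfolding flat_deriv_pos_eq[OF assms(1)] t_def[symmetric]
    using t assms by (auto simp: abs_mult intro!: mult_left_mono)
  have "(\<gamma> * (1 + \<gamma>) + 2 * \<gamma> * t + t\<^sup>2) * exp (- t) = \<gamma> * (1 + \<gamma>) * exp (- t) + 2 * \<gamma> * (t * exp (- t)) + t\<^sup>2 * exp (- t)"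
    by algebra
  also have "\<dots> \<le> \<gamma> * (1 + \<gamma>) * 1 + 2 * \<gamma> * 1 + 2"
    using e0 e1 assms(3) by (intro add_mono mult_left_mono) auto
  finally have *: "(\<gamma> * (1 + \<gamma>) + 2 * \<gamma> * t + t\<^sup>2) * exp (- t) \<le> \<gamma> * (1 + \<gamma>) + 2 * \<gamma> + 2" by simp
  have "0 \<le> \<gamma> * (1 + \<gamma>) + 2 * \<gamma> * t + t\<^sup>2" using t assms(3) by simp
  then have "\<bar>(\<gamma> * (1 + \<gamma>) + 2 * \<gamma> * t + t\<^sup>2) * exp (- t)\<bar> \<le> \<gamma> * (1 + \<gamma>) + 2 * \<gamma> + 2"
    using * by (simp add: abs_mult)
  then show "\<bar>flat_deriv2 \<gamma> b s * s\<bar> \<le> s powr \<gamma> * (\<gamma> * (1 + \<gamma>) + 2 * \<gamma> + 2)"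
    unfolding flat_deriv_pos_eq[OF assms(1)] t_def[symmetric] abs_mult[of "s powr \<gamma>"]
    by (intro mult_mono) auto
qed

lemma flat_deriv_limits:
  assumes "s > 0" "b \<longlonglongrightarrow> 0"
  shows "(\<lambda>n. flat (1+\<gamma>) (b n) s) \<longlonglongrightarrow> s powr (1+\<gamma>)"
    and "(\<lambda>n. flat_deriv1 \<gamma> (b n) s) \<longlonglongrightarrow> s powr \<gamma> * (1 + \<gamma>)"
    and "(\<lambda>n. flat_deriv2 \<gamma> (b n) s * s) \<longlonglongrightarrow> s powr \<gamma> * (\<gamma> * (1 + \<gamma>))"
  unfolding flat_deriv_pos_eq[OF assms(1)]
  using assms by (auto intro!: tendsto_eq_intros)

text \<open>A smooth replacement of h. Its flat part takes the polynomial |x|^2 as argument, which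
  keeps it in the smooth algebra.\<close>

definition trial_gauge :: "real \<Rightarrow> real \<Rightarrow> ('m::finite,'k::finite) pt \<Rightarrow> real" where
  "trial_gauge \<gamma> b z = flat (1+\<gamma>) b ((norm (fst z))\<^sup>2) + (1+\<gamma>)\<^sup>2 * (norm (snd z))\<^sup>2"

lemma smooth_alg_trial_gauge:
  assumes "b > 0"
  shows "smooth_alg (trial_gauge \<gamma> b :: ('m::finite,'k::finite) pt \<Rightarrow> real)"
proof -
  have x: "smooth_alg (\<lambda>z :: ('m,'k) pt. fst z $ i)" for i
    by (intro smooth_alg.linear bounded_linear_compose[OF bounded_linear_vec_nth bounded_linear_fst])
  have y: "smooth_alg (\<lambda>z :: ('m,'k) pt. snd z $ i)" for i
    by (intro smooth_alg.linear bounded_linear_compose[OF bounded_linear_vec_nth bounded_linear_snd])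
  show ?thesis
    unfolding trial_gauge_def norm_sq_vec power2_eq_square[of "_ $ _"]
    by (intro smooth_alg.add smooth_alg.mult smooth_alg.flat smooth_alg_sum smooth_alg.const x y assms) auto
qed

section \<open>Gradient and Laplacian of the trial functions\<close>

lemma norm_sq_powr: "(norm x)\<^sup>2 powr p = norm x powr (2 * p)"
  by (metis norm_ge_zero powr_powr powr_numeral)

lemma line_norm_sq:
  fixes x :: "real^'n"
  shows "((\<lambda>t. (norm (x + t *\<^sub>R axis i 1))\<^sup>2) has_real_derivative 2 * x $ i) (at 0)"
    and "((\<lambda>t. (x + t *\<^sub>R axis i 1) $ i) has_real_derivative 1) (at 0)"
proof -
  have *: "(norm (x + t *\<^sub>R axis i 1))\<^sup>2 = (norm x)\<^sup>2 + 2 * t * x $ i + t\<^sup>2" for t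
    unfolding power2_norm_eq_inner
    by (simp add: inner_simps inner_axis inner_axis' algebra_simps power2_eq_square)
  show "((\<lambda>t. (norm (x + t *\<^sub>R axis i 1))\<^sup>2) has_real_derivative 2 * x $ i) (at 0)"
    unfolding * by (auto intro!: derivative_eq_intros)
  show "((\<lambda>t. (x + t *\<^sub>R axis i 1) $ i) has_real_derivative 1) (at 0)"
    by (auto intro!: derivative_eq_intros)
qed

lemma dirderiv_eq_line:
  fixes f :: "'a::real_normed_vector \<Rightarrow> real"
  assumes "smooth_alg f" "((\<lambda>t. f (z + t *\<^sub>R v)) has_real_derivative D) (at 0)"
  shows "dirderiv v f z = D"
  using has_real_derivative_line_dirderiv[OF smooth_differentiable[OF smooth_alg_imp_smooth[OF assms(1)]]]
    assms(2) DERIV_unique by blast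

text \<open>The squared Grushin gradient of \<open>trial_gauge \<gamma> b\<close> in closed
  form.\<close>

definition trial_grad :: "real \<Rightarrow> real \<Rightarrow> ('m::finite,'k::finite) pt \<Rightarrow> real" where
  "trial_grad \<gamma> b z = 4 * (flat_deriv1 \<gamma> b ((norm (fst z))\<^sup>2))\<^sup>2 * (norm (fst z))\<^sup>2
     + norm (fst z) powr (2*\<gamma>) * (4 * (1+\<gamma>)^4 * (norm (snd z))\<^sup>2)"

text \<open>The Grushin Laplacian of \<open>trial_gauge \<gamma> b\<close>. The second derivative is
  kept together with |x|^2 because this product is O(|x|^(2\<gamma>)) uniformly in b.\<close>

definition trial_lap :: "real \<Rightarrow> real \<Rightarrow> ('m::finite,'k::finite) pt \<Rightarrow> real" where
  "trial_lap \<gamma> b z = 4 * (flat_deriv2 \<gamma> b ((norm (fst z))\<^sup>2) * (norm (fst z))\<^sup>2)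
     + 2 * real CARD('m) * flat_deriv1 \<gamma> b ((norm (fst z))\<^sup>2)
     + norm (fst z) powr (2*\<gamma>) * (2 * (1+\<gamma>)\<^sup>2 * real CARD('k))"

text \<open>The chain rule, computed along coordinate lines; membership in the smooth algebra
  identifies line derivatives with \<open>dirderiv\<close>.\<close>

lemma trial_derivs:
  fixes z :: "('m::finite,'k::finite) pt"
  assumes "b > 0" "smooth_alg F"
  shows "grushin_grad_sq \<gamma> (\<lambda>z. F (trial_gauge \<gamma> b z)) z = (D1 F (trial_gauge \<gamma> b z))\<^sup>2 * trial_grad \<gamma> b z"
    and "grushin_lap \<gamma> (\<lambda>z. F (trial_gauge \<gamma> b z)) z
      = D2 F (trial_gauge \<gamma> b z) * trial_grad \<gamma> b z + D1 F (trial_gauge \<gamma> b z) * trial_lap \<gamma> b z"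
proof -
  let ?w = "trial_gauge \<gamma> b :: ('m,'k) pt \<Rightarrow> real" and ?s = "\<lambda>z :: ('m,'k) pt. (norm (fst z))\<^sup>2"
  let ?f = "\<lambda>z. F (?w z)"
  have sf: "smooth_alg ?f" by (intro smooth_alg_compose[OF assms(2)] smooth_alg_trial_gauge assms(1))
  have F1: "(F has_real_derivative D1 F x) (at x)" and F2: "(D1 F has_real_derivative D2 F x) (at x)" for x
    by (intro smooth_alg_real_deriv smooth_alg_dirderiv assms(2))+
  have sx: "((\<lambda>t. ?s (z + t *\<^sub>R ex i)) has_real_derivative 2 * fst z $ i) (at 0)" for z :: "('m,'k) pt" and i
    using line_norm_sq(1)[of "fst z" i] by (simp add: ex_def)
  have fx: "((\<lambda>t. flat (1+\<gamma>) b (?s (z + t *\<^sub>R ex i))) has_real_derivative flat_deriv1 \<gamma> b (?s z) * (2 * fst z $ i)) (at 0)"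
    "((\<lambda>t. flat_deriv1 \<gamma> b (?s (z + t *\<^sub>R ex i))) has_real_derivative flat_deriv2 \<gamma> b (?s z) * (2 * fst z $ i)) (at 0)"
    for z :: "('m,'k) pt" and i
    using DERIV_chain2[OF _ sx[of z i]] DERIV_flat_deriv[OF assms(1), of \<gamma> "?s z"] by force+
  have wx: "((\<lambda>t. ?w (z + t *\<^sub>R ex i)) has_real_derivative flat_deriv1 \<gamma> b (?s z) * (2 * fst z $ i)) (at 0)" for z i
  proof -
    have "((\<lambda>t. flat (1+\<gamma>) b (?s (z + t *\<^sub>R ex i)) + (1+\<gamma>)\<^sup>2 * (norm (snd z))\<^sup>2) has_real_derivative
        flat_deriv1 \<gamma> b (?s z) * (2 * fst z $ i) + 0) (at 0)"
      by (intro DERIV_add fx DERIV_const)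
    then show ?thesis by (simp add: trial_gauge_def ex_def)
  qed
  have wy: "((\<lambda>t. ?w (z + t *\<^sub>R ey j)) has_real_derivative (1+\<gamma>)\<^sup>2 * (2 * snd z $ j)) (at 0)" for z j
  proof -
    have "((\<lambda>t. flat (1+\<gamma>) b (?s z) + (1+\<gamma>)\<^sup>2 * (norm (snd z + t *\<^sub>R axis j 1))\<^sup>2) has_real_derivative
        0 + (1+\<gamma>)\<^sup>2 * (2 * snd z $ j)) (at 0)"
      by (intro DERIV_add DERIV_const DERIV_cmult line_norm_sq)
    then show ?thesis by (simp add: trial_gauge_def ey_def)
  qed
  have Fx: "((\<lambda>t. F (?w (z + t *\<^sub>R ex i))) has_real_derivative D1 F (?w z) * (flat_deriv1 \<gamma> b (?s z) * (2 * fst z $ i))) (at 0)"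
    "((\<lambda>t. D1 F (?w (z + t *\<^sub>R ex i))) has_real_derivative D2 F (?w z) * (flat_deriv1 \<gamma> b (?s z) * (2 * fst z $ i))) (at 0)"
    for z i
    using DERIV_chain2[OF _ wx[of z i]] F1[of "?w z"] F2[of "?w z"] by force+
  have Fy: "((\<lambda>t. F (?w (z + t *\<^sub>R ey j))) has_real_derivative D1 F (?w z) * ((1+\<gamma>)\<^sup>2 * (2 * snd z $ j))) (at 0)"
    "((\<lambda>t. D1 F (?w (z + t *\<^sub>R ey j))) has_real_derivative D2 F (?w z) * ((1+\<gamma>)\<^sup>2 * (2 * snd z $ j))) (at 0)"
    for z j
    using DERIV_chain2[OF _ wy[of z j]] F1[of "?w z"] F2[of "?w z"] by force+
  have dx: "dirderiv (ex i) ?f = (\<lambda>z. D1 F (?w z) * (flat_deriv1 \<gamma> b (?s z) * (2 * fst z $ i)))" for i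
    by (intro ext dirderiv_eq_line[OF sf] Fx)
  have dy: "dirderiv (ey j) ?f = (\<lambda>z. D1 F (?w z) * ((1+\<gamma>)\<^sup>2 * (2 * snd z $ j)))" for j
    by (intro ext dirderiv_eq_line[OF sf] Fy)
  have ddx: "dirderiv (ex i) (dirderiv (ex i) ?f) z = D2 F (?w z) * 4 * (flat_deriv1 \<gamma> b (?s z))\<^sup>2 * (fst z $ i)\<^sup>2
      + D1 F (?w z) * 4 * flat_deriv2 \<gamma> b (?s z) * (fst z $ i)\<^sup>2 + D1 F (?w z) * 2 * flat_deriv1 \<gamma> b (?s z)" for i
  proof (rule dirderiv_eq_line[OF smooth_alg_dirderiv[OF sf]])
    have x: "((\<lambda>t. 2 * fst (z + t *\<^sub>R ex i) $ i) has_real_derivative 2 * 1) (at 0)"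
      using DERIV_cmult[OF line_norm_sq(2)[of "fst z" i], of 2] by (simp add: ex_def)
    show "((\<lambda>t. dirderiv (ex i) ?f (z + t *\<^sub>R ex i)) has_real_derivative
      D2 F (?w z) * 4 * (flat_deriv1 \<gamma> b (?s z))\<^sup>2 * (fst z $ i)\<^sup>2
      + D1 F (?w z) * 4 * flat_deriv2 \<gamma> b (?s z) * (fst z $ i)\<^sup>2 + D1 F (?w z) * 2 * flat_deriv1 \<gamma> b (?s z)) (at 0)"
      unfolding dx by (rule DERIV_cong[OF DERIV_mult[OF Fx(2) DERIV_mult[OF fx(2) x]]]) (simp, algebra)
  qed
  have ddy: "dirderiv (ey j) (dirderiv (ey j) ?f) z = D2 F (?w z) * 4 * (1+\<gamma>)^4 * (snd z $ j)\<^sup>2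
      + D1 F (?w z) * 2 * (1+\<gamma>)\<^sup>2" for j
  proof (rule dirderiv_eq_line[OF smooth_alg_dirderiv[OF sf]])
    have y: "((\<lambda>t. (1+\<gamma>)\<^sup>2 * (2 * snd (z + t *\<^sub>R ey j) $ j)) has_real_derivative (1+\<gamma>)\<^sup>2 * (2 * 1)) (at 0)"
      using DERIV_cmult[OF DERIV_cmult[OF line_norm_sq(2)[of "snd z" j], of 2], of "(1+\<gamma>)\<^sup>2"] by (simp add: ey_def)
    show "((\<lambda>t. dirderiv (ey j) ?f (z + t *\<^sub>R ey j)) has_real_derivative
      D2 F (?w z) * 4 * (1+\<gamma>)^4 * (snd z $ j)\<^sup>2 + D1 F (?w z) * 2 * (1+\<gamma>)\<^sup>2) (at 0)"
      unfolding dy by (rule DERIV_cong[OF DERIV_mult[OF Fy(2) y]]) (simp, algebra)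
  qed
  show "grushin_grad_sq \<gamma> ?f z = (D1 F (?w z))\<^sup>2 * trial_grad \<gamma> b z"
    unfolding grushin_grad_sq_def dx dy power_mult_distrib sum_distrib_left[symmetric] norm_sq_vec[symmetric]
      norm_powr_sq[of "fst z" \<gamma>] trial_grad_def by algebra
  have 1: "(\<Sum>i\<in>UNIV. dirderiv (ex i) (dirderiv (ex i) ?f) z) =
      D2 F (?w z) * 4 * (flat_deriv1 \<gamma> b (?s z))\<^sup>2 * ?s z
      + D1 F (?w z) * 4 * flat_deriv2 \<gamma> b (?s z) * ?s z + real CARD('m) * (D1 F (?w z) * 2 * flat_deriv1 \<gamma> b (?s z))"
    unfolding ddx sum.distrib sum_distrib_left[symmetric] norm_sq_vec[symmetric] by simp
  have 2: "(\<Sum>j\<in>UNIV. dirderiv (ey j) (dirderiv (ey j) ?f) z) =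
      D2 F (?w z) * 4 * (1+\<gamma>)^4 * (norm (snd z))\<^sup>2 + real CARD('k) * (D1 F (?w z) * 2 * (1+\<gamma>)\<^sup>2)"
    unfolding ddy sum.distrib sum_distrib_left[symmetric] norm_sq_vec[symmetric] by simp
  show "grushin_lap \<gamma> ?f z = D2 F (?w z) * trial_grad \<gamma> b z + D1 F (?w z) * trial_lap \<gamma> b z"
    unfolding grushin_lap_def 1 2 norm_powr_sq[of "fst z" \<gamma>] trial_grad_def trial_lap_def by algebra
qed

text \<open>The upper bounds carry the factor r = |x|^(2\<gamma>) and do not depend on b. Squares of
  Laplacians of trial functions are therefore O(r^2) on bounded sets, which absorbs the singular
  weight 1/r as b tends to 0.\<close>

lemma trial_bounds:
  fixes z :: "('m::finite,'k::finite) pt"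
  assumes "\<gamma> > 0" "b > 0" "fst z \<noteq> 0"
  shows "0 \<le> trial_grad \<gamma> b z"
    and "trial_grad \<gamma> b z \<le> norm (fst z) powr (2*\<gamma>) * (4 * (2+\<gamma>)\<^sup>2 * gauge_pow \<gamma> z)"
    and "\<bar>trial_lap \<gamma> b z\<bar> \<le> norm (fst z) powr (2*\<gamma>) *
      (4 * (\<gamma> * (1 + \<gamma>) + 2 * \<gamma> + 2) + 2 * real CARD('m) * (2+\<gamma>) + 2 * (1+\<gamma>)\<^sup>2 * real CARD('k))"
proof -
  define s r where "s = (norm (fst z))\<^sup>2" and "r = norm (fst z) powr (2*\<gamma>)"
  have s: "s > 0" "s powr \<gamma> = r" using assms(3) by (auto simp: s_def r_def norm_sq_powr)
  have r: "r > 0" using assms(3) by (simp add: r_def)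
  note b = flat_deriv_bounds[OF s(1) assms(2,1), unfolded s(2)]
  show "0 \<le> trial_grad \<gamma> b z" using assms(1) by (simp add: trial_grad_def)
  have rs: "gauge_pow \<gamma> z = r * s + (1+\<gamma>)\<^sup>2 * (norm (snd z))\<^sup>2"
    using norm_powr_mult_norm_sq[of "fst z" "2 * \<gamma>"] by (simp add: r_def s_def gauge_pow_def algebra_simps)
  have "(flat_deriv1 \<gamma> b s)\<^sup>2 \<le> (r * (2+\<gamma>))\<^sup>2"
    using b(1) power_mono[of "\<bar>flat_deriv1 \<gamma> b s\<bar>" "r * (2+\<gamma>)" 2] by simp
  then have "4 * (flat_deriv1 \<gamma> b s)\<^sup>2 * s \<le> 4 * (r * (2+\<gamma>))\<^sup>2 * s"
    using s(1) by simp
  moreover have "(1+\<gamma>)^4 \<le> (2+\<gamma>)\<^sup>2 * (1+\<gamma>)\<^sup>2"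
  proof -
    have "(1+\<gamma>)^4 = (1+\<gamma>)\<^sup>2 * (1+\<gamma>)\<^sup>2" by algebra
    also have "\<dots> \<le> (2+\<gamma>)\<^sup>2 * (1+\<gamma>)\<^sup>2" using assms(1) by (intro mult_right_mono power_mono) auto
    finally show ?thesis .
  qed
  then have "r * (4 * (1+\<gamma>)^4 * (norm (snd z))\<^sup>2) \<le> r * (4 * ((2+\<gamma>)\<^sup>2 * (1+\<gamma>)\<^sup>2) * (norm (snd z))\<^sup>2)"
    using r by (intro mult_left_mono mult_right_mono) auto
  ultimately have "trial_grad \<gamma> b z \<le> 4 * (r * (2+\<gamma>))\<^sup>2 * s + r * (4 * ((2+\<gamma>)\<^sup>2 * (1+\<gamma>)\<^sup>2) * (norm (snd z))\<^sup>2)"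
    unfolding trial_grad_def s_def[symmetric] r_def[symmetric] by linarith
  also have "\<dots> = r * (4 * (2+\<gamma>)\<^sup>2 * gauge_pow \<gamma> z)" unfolding rs by algebra
  finally show "trial_grad \<gamma> b z \<le> norm (fst z) powr (2*\<gamma>) * (4 * (2+\<gamma>)\<^sup>2 * gauge_pow \<gamma> z)"
    by (simp only: r_def)
  have "\<bar>trial_lap \<gamma> b z\<bar> \<le> 4 * \<bar>flat_deriv2 \<gamma> b s * s\<bar> + 2 * real CARD('m) * \<bar>flat_deriv1 \<gamma> b s\<bar> + r * (2 * (1+\<gamma>)\<^sup>2 * real CARD('k))"
    unfolding trial_lap_def s_def[symmetric] r_def[symmetric]
    by (rule order_trans[OF abs_triangle_ineq] add_mono)+ (use r in \<open>auto simp: abs_mult\<close>)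
  also have "\<dots> \<le> 4 * (r * (\<gamma> * (1 + \<gamma>) + 2 * \<gamma> + 2)) + 2 * real CARD('m) * (r * (2+\<gamma>)) + r * (2 * (1+\<gamma>)\<^sup>2 * real CARD('k))"
    using b r by (intro add_mono mult_left_mono) auto
  finally show "\<bar>trial_lap \<gamma> b z\<bar> \<le> norm (fst z) powr (2*\<gamma>) *
      (4 * (\<gamma> * (1 + \<gamma>) + 2 * \<gamma> + 2) + 2 * real CARD('m) * (2+\<gamma>) + 2 * (1+\<gamma>)\<^sup>2 * real CARD('k))"
    unfolding r_def[symmetric] by (simp only: distrib_left mult_ac)
qed

text \<open>The limits are the values for h itself: |\<nabla>h|^2 = (2(1+\<gamma>))^2 r h and
  \<Delta>h = 2(1+\<gamma>)(Q + 2\<gamma>) r.\<close>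

lemma trial_limits:
  fixes z :: "('m::finite,'k::finite) pt"
  assumes "fst z \<noteq> 0" "b \<longlonglongrightarrow> 0"
  shows "(\<lambda>n. trial_gauge \<gamma> (b n) z) \<longlonglongrightarrow> gauge_pow \<gamma> z"
    and "(\<lambda>n. trial_grad \<gamma> (b n) z) \<longlonglongrightarrow> (2 * (1+\<gamma>))\<^sup>2 * norm (fst z) powr (2*\<gamma>) * gauge_pow \<gamma> z"
    and "(\<lambda>n. trial_lap \<gamma> (b n) z) \<longlonglongrightarrow>
      2 * (1+\<gamma>) * (hom_dim \<gamma> TYPE(('m,'k) pt) + 2 * \<gamma>) * norm (fst z) powr (2*\<gamma>)"
proof -
  define s r where "s = (norm (fst z))\<^sup>2" and "r = norm (fst z) powr (2*\<gamma>)"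
  have s: "s > 0" "s powr \<gamma> = r" using assms(1) by (auto simp: s_def r_def norm_sq_powr)
  have s1: "s powr (1+\<gamma>) = r * s" using s by (simp add: powr_add)
  have rs: "gauge_pow \<gamma> z = r * s + (1+\<gamma>)\<^sup>2 * (norm (snd z))\<^sup>2"
    using norm_powr_mult_norm_sq[of "fst z" "2 * \<gamma>"] by (simp add: r_def s_def gauge_pow_def algebra_simps)
  note l = flat_deriv_limits[OF s(1) assms(2), of \<gamma>, unfolded s1 s(2)]
  show "(\<lambda>n. trial_gauge \<gamma> (b n) z) \<longlonglongrightarrow> gauge_pow \<gamma> z"
    unfolding trial_gauge_def s_def[symmetric] rs by (intro tendsto_intros l)
  have "(\<lambda>n. trial_grad \<gamma> (b n) z) \<longlonglongrightarrow> 4 * (r * (1+\<gamma>))\<^sup>2 * s + r * (4 * (1+\<gamma>)^4 * (norm (snd z))\<^sup>2)"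
    unfolding trial_grad_def s_def[symmetric] r_def[symmetric] by (intro tendsto_intros l)
  also have "4 * (r * (1+\<gamma>))\<^sup>2 * s + r * (4 * (1+\<gamma>)^4 * (norm (snd z))\<^sup>2) = (2 * (1+\<gamma>))\<^sup>2 * r * gauge_pow \<gamma> z"
    unfolding rs by algebra
  finally show "(\<lambda>n. trial_grad \<gamma> (b n) z) \<longlonglongrightarrow> (2 * (1+\<gamma>))\<^sup>2 * norm (fst z) powr (2*\<gamma>) * gauge_pow \<gamma> z"
    unfolding r_def .
  have "(\<lambda>n. trial_lap \<gamma> (b n) z) \<longlonglongrightarrow> 4 * (r * (\<gamma> * (1+\<gamma>))) + 2 * real CARD('m) * (r * (1+\<gamma>)) + r * (2 * (1+\<gamma>)\<^sup>2 * real CARD('k))"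
    unfolding trial_lap_def s_def[symmetric] r_def[symmetric] by (intro tendsto_intros l)
  also have "4 * (r * (\<gamma> * (1+\<gamma>))) + 2 * real CARD('m) * (r * (1+\<gamma>)) + r * (2 * (1+\<gamma>)\<^sup>2 * real CARD('k)) =
      2 * (1+\<gamma>) * (hom_dim \<gamma> TYPE(('m,'k) pt) + 2 * \<gamma>) * r"
    unfolding hom_dim_def by algebra
  finally show "(\<lambda>n. trial_lap \<gamma> (b n) z) \<longlonglongrightarrow>
      2 * (1+\<gamma>) * (hom_dim \<gamma> TYPE(('m,'k) pt) + 2 * \<gamma>) * norm (fst z) powr (2*\<gamma>)"
    unfolding r_def .
qed

text \<open>One ball serves all b in (0,1]. The hypothesis gives |y|^2 <= 2 H, and |x|^2 <= 2 e H <=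
  6 H when |x| > 1, because then exp (- b/|x|^2) >= 1/e.\<close>

lemma trial_gauge_le_imp_bounded:
  fixes z :: "('m::finite,'k::finite) pt"
  assumes "\<gamma> > 0" "0 < b" "b \<le> 1" "H \<ge> 1" "trial_gauge \<gamma> b z \<le> 2 * H"
  shows "z \<in> cball 0 (sqrt (8 * H))"
proof -
  define s y where "s = (norm (fst z))\<^sup>2" and "y = (norm (snd z))\<^sup>2"
  have f: "flat (1+\<gamma>) b s + (1+\<gamma>)\<^sup>2 * y \<le> 2 * H" using assms(5) by (simp add: trial_gauge_def s_def y_def)
  have y0: "y \<ge> 0" by (simp add: y_def)
  have "1 \<le> (1+\<gamma>)\<^sup>2" using assms(1) by (simp add: one_le_power)
  then have "y \<le> (1+\<gamma>)\<^sup>2 * y" using y0 mult_right_mono[of 1 "(1+\<gamma>)\<^sup>2" y] by simp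
  then have y: "y \<le> 2 * H" using f flat_nonneg[of "1+\<gamma>" b s] by linarith
  have "s \<le> 6 * H"
  proof (cases "s \<le> 1")
    case False
    have "s powr 1 \<le> s powr (1+\<gamma>)" using False assms(1) by (intro powr_mono) auto
    moreover have "exp (- 1) \<le> exp (- b / s)"
      using False assms by (simp add: field_simps)
    ultimately have "s * exp (- 1) \<le> s powr (1+\<gamma>) * exp (- b / s)"
      using False by (intro mult_mono) auto
    also have "\<dots> = flat (1+\<gamma>) b s" using False by (simp add: flat_def)
    also have "\<dots> \<le> 2 * H" using f mult_nonneg_nonneg[OF zero_le_power2 y0, of "1+\<gamma>"] by linarith
    finally have "s \<le> 2 * H * exp 1" by (simp add: exp_minus field_simps)
    also have "\<dots> \<le> 2 * H * 3" using exp_le assms(4) by (intro mult_left_mono) auto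
    finally show ?thesis by simp
  qed (use assms in simp)
  then have "(norm z)\<^sup>2 \<le> 8 * H"
    using y by (simp add: norm_prod_def s_def y_def)
  then show ?thesis by (simp add: real_le_rsqrt)
qed

section \<open>Dilation-invariant mass of shells\<close>

lemma prod_Basis_prod:
  "(\<Prod>j\<in>(Basis :: ('a::euclidean_space \<times> 'b::euclidean_space) set). f j) = (\<Prod>i\<in>Basis. f (i, 0)) * (\<Prod>i\<in>Basis. f (0, i))"
proof -
  have "(\<lambda>i::'a. (i, 0::'b)) ` Basis \<inter> (\<lambda>i::'b. (0::'a, i)) ` Basis = {}" by (auto simp: nonzero_Basis)
  then show ?thesis
    unfolding Basis_prod_def
    by (subst prod.union_disjoint) (auto simp: prod.reindex inj_on_def)
qed

text \<open>A linear change of variables whose Jacobian is l^m l^((1+\<gamma>) k) = l^Q.\<close>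

lemma nn_integral_anisotropic_scaling:
  fixes f :: "('m::finite,'k::finite) pt \<Rightarrow> ennreal"
  assumes [measurable]: "f \<in> borel_measurable borel" and l: "l > 0"
  shows "(\<integral>\<^sup>+z. f z \<partial>lborel) =
    (\<integral>\<^sup>+z. ennreal (l powr hom_dim \<gamma> TYPE(('m,'k) pt)) * f (l *\<^sub>R fst z, (l powr (1+\<gamma>)) *\<^sub>R snd z) \<partial>lborel)"
proof -
  \<comment> \<open>A basis vector belongs to the x-factor exactly when its second component is
    0.\<close>
  define c :: "('m,'k) pt \<Rightarrow> real" where "c j = (if snd j = 0 then l else l powr (1+\<gamma>))" for j
  define T :: "('m,'k) pt \<Rightarrow> ('m,'k) pt" where "T z = 0 + (\<Sum>j\<in>Basis. (c j * (z \<bullet> j)) *\<^sub>R j)" for z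
  have T: "T z = (l *\<^sub>R fst z, (l powr (1+\<gamma>)) *\<^sub>R snd z)" for z
  proof (rule euclidean_eqI)
    fix j :: "('m,'k) pt" assume j: "j \<in> Basis"
    then have "T z \<bullet> j = c j * (z \<bullet> j)" by (simp add: T_def)
    also have "\<dots> = (l *\<^sub>R fst z, (l powr (1+\<gamma>)) *\<^sub>R snd z) \<bullet> j"
      using j by (auto simp: Basis_prod_def c_def inner_prod_def nonzero_Basis)
    finally show "T z \<bullet> j = (l *\<^sub>R fst z, (l powr (1+\<gamma>)) *\<^sub>R snd z) \<bullet> j" .
  qed
  have "(\<Prod>j\<in>Basis. \<bar>c j\<bar>) = l ^ CARD('m) * (l powr (1+\<gamma>)) ^ CARD('k)"
    using l by (simp add: prod_Basis_prod c_def nonzero_Basis)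
  also have "\<dots> = l powr hom_dim \<gamma> TYPE(('m,'k) pt)"
  proof -
    have "(l powr (1+\<gamma>)) ^ CARD('k) = l powr ((1+\<gamma>) * real CARD('k))"
      using l powr_realpow[of "l powr (1+\<gamma>)" "CARD('k)"] by (simp add: powr_powr)
    then show ?thesis using l by (simp add: hom_dim_def powr_add powr_realpow)
  qed
  finally have det: "(\<Prod>j\<in>Basis. \<bar>c j\<bar>) = l powr hom_dim \<gamma> TYPE(('m,'k) pt)" .
  have [measurable]: "T \<in> borel_measurable borel"
    unfolding T_def[abs_def] by simp
  have "lborel = density (distr lborel borel T) (\<lambda>_. ennreal (\<Prod>j\<in>Basis. \<bar>c j\<bar>))"
    using lborel_affine_euclidean[of c 0] l unfolding T_def[abs_def] by (simp add: c_def)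
  then have "(\<integral>\<^sup>+z. f z \<partial>lborel) = (\<integral>\<^sup>+z. f z \<partial>density (distr lborel borel T) (\<lambda>_. ennreal (l powr hom_dim \<gamma> TYPE(('m,'k) pt))))"
    by (simp add: det)
  also have "\<dots> = (\<integral>\<^sup>+z. ennreal (l powr hom_dim \<gamma> TYPE(('m,'k) pt)) * f (T z) \<partial>lborel)"
    by (simp add: nn_integral_density nn_integral_distr)
  finally show ?thesis unfolding T .
qed

lemma borel_gauge_pow [measurable]: "\<gamma> > 0 \<Longrightarrow> gauge_pow \<gamma> \<in> borel_measurable borel"
  by (intro borel_measurable_continuous_onI continuous_on_gauge_pow)

lemma borel_norm_fst [measurable]:
  "(\<lambda>z :: ('m::finite,'k::finite) pt. norm (fst z)) \<in> borel_measurable borel"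
  "(\<lambda>z :: ('m::finite,'k::finite) pt. norm (snd z)) \<in> borel_measurable borel"
  by (intro borel_measurable_continuous_onI continuous_intros)+

text \<open>This is \<rho>^(-Q) |\<nabla>\<rho>|^2, the density of the dilation-invariant measure of
  the introductory comment.\<close>

definition inv_density :: "real \<Rightarrow> ('m::finite,'k::finite) pt \<Rightarrow> real" where
  "inv_density \<gamma> z = gauge_pow \<gamma> z powr (- (hom_dim \<gamma> TYPE(('m,'k) pt) + 2 * \<gamma>) / (2*(1+\<gamma>))) * norm (fst z) powr (2*\<gamma>)"

text \<open>Half-open shells fit together without overlap. The \<open>itself\<close> argument fixes
  the two dimensions.\<close>

definition shell_mass :: "real \<Rightarrow> ('m::finite,'k::finite) pt itself \<Rightarrow> real \<Rightarrow> real \<Rightarrow> ennreal" where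
  "shell_mass \<gamma> _ a b = (\<integral>\<^sup>+z. ennreal (inv_density \<gamma> (z :: ('m,'k) pt)) * indicator {z. a \<le> gauge_pow \<gamma> z \<and> gauge_pow \<gamma> z < b} z \<partial>lborel)"

lemma inv_density_nonneg: "inv_density \<gamma> z \<ge> 0"
  by (simp add: inv_density_def)

lemma borel_inv_density: "\<gamma> > 0 \<Longrightarrow> inv_density \<gamma> \<in> borel_measurable borel"
  unfolding inv_density_def by measurable

lemma shell_borel:
  "\<gamma> > 0 \<Longrightarrow> {z :: ('m::finite,'k::finite) pt. a \<le> gauge_pow \<gamma> z \<and> gauge_pow \<gamma> z < b} \<in> sets borel"
  by measurable

text \<open>The dilation with l = s^(1/(2(1+\<gamma>))) multiplies h by s and the density by l^(-Q),
  which cancels the Jacobian l^Q.\<close>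

lemma shell_mass_scaling:
  assumes "\<gamma> > 0" "s > 0"
  shows "shell_mass \<gamma> TYPE(('m::finite,'k::finite) pt) (s * a) (s * b) = shell_mass \<gamma> TYPE(('m,'k) pt) a b"
proof -
  define l where "l = s powr (1 / (2*(1+\<gamma>)))"
  define Q where "Q = hom_dim \<gamma> TYPE(('m,'k) pt)"
  have l: "l > 0" using assms by (simp add: l_def)
  have ls: "l powr (2*(1+\<gamma>)) = s" using assms by (simp add: l_def powr_powr)
  define T where "T z = (l *\<^sub>R fst z, (l powr (1+\<gamma>)) *\<^sub>R snd z)" for z :: "('m,'k) pt"
  have h: "gauge_pow \<gamma> (T z) = s * gauge_pow \<gamma> z" for z
  proof -
    have "(l powr (1+\<gamma>))\<^sup>2 = s" using ls by (simp add: power2_eq_square flip: powr_add)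
    then show ?thesis using l ls
      by (simp add: gauge_pow_def T_def powr_mult power_mult_distrib algebra_simps)
  qed
  have w: "l powr Q * inv_density \<gamma> (T z) = inv_density \<gamma> z" for z
  proof -
    define e where "e = - (Q + 2 * \<gamma>) / (2*(1+\<gamma>))"
    have "s powr e = l powr (- (Q + 2 * \<gamma>))"
      by (simp add: e_def l_def powr_powr)
    then have 1: "l powr Q * s powr e * l powr (2 * \<gamma>) = 1"
      using l by (simp flip: powr_add)
    have "norm (fst (T z)) powr (2*\<gamma>) = l powr (2*\<gamma>) * norm (fst z) powr (2*\<gamma>)"
      using l by (simp add: T_def powr_mult)
    moreover have "(s * gauge_pow \<gamma> z) powr e = s powr e * gauge_pow \<gamma> z powr e"
      using assms gauge_pow_nonneg by (simp add: powr_mult)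
    ultimately have "l powr Q * inv_density \<gamma> (T z) = (l powr Q * s powr e * l powr (2 * \<gamma>)) * inv_density \<gamma> z"
      unfolding inv_density_def h Q_def[symmetric] e_def[symmetric] by algebra
    then show ?thesis unfolding 1 by simp
  qed
  have [measurable]: "inv_density \<gamma> \<in> borel_measurable (borel :: ('m,'k) pt measure)"
    by (rule borel_inv_density[OF assms(1)])
  have [measurable]: "{z :: ('m,'k) pt. s * a \<le> gauge_pow \<gamma> z \<and> gauge_pow \<gamma> z < s * b} \<in> sets borel"
    by (rule shell_borel[OF assms(1)])
  have "shell_mass \<gamma> TYPE(('m,'k) pt) (s * a) (s * b) =
    (\<integral>\<^sup>+z. ennreal (l powr Q) * (ennreal (inv_density \<gamma> (T z)) * indicator {z. s * a \<le> gauge_pow \<gamma> z \<and> gauge_pow \<gamma> z < s * b} (T z)) \<partial>lborel)"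
    unfolding shell_mass_def T_def Q_def
    by (rule nn_integral_anisotropic_scaling[OF _ l]) measurable
  also have "\<dots> = shell_mass \<gamma> TYPE(('m,'k) pt) a b"
    unfolding shell_mass_def
  proof (rule nn_integral_cong)
    fix z :: "('m,'k) pt"
    have "ennreal (l powr Q) * ennreal (inv_density \<gamma> (T z)) = ennreal (l powr Q * inv_density \<gamma> (T z))"
      by (simp add: ennreal_mult' inv_density_nonneg)
    also have "\<dots> = ennreal (inv_density \<gamma> z)" by (simp only: w)
    finally show "ennreal (l powr Q) * (ennreal (inv_density \<gamma> (T z)) * indicator {z. s * a \<le> gauge_pow \<gamma> z \<and> gauge_pow \<gamma> z < s * b} (T z))
        = ennreal (inv_density \<gamma> z) * indicator {z. a \<le> gauge_pow \<gamma> z \<and> gauge_pow \<gamma> z < b} z"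
      using assms(2) by (simp add: h indicator_def mult.assoc[symmetric])
  qed
  finally show ?thesis .
qed

lemma shell_mass_add:
  assumes "\<gamma> > 0" "a \<le> b" "b \<le> c"
  shows "shell_mass \<gamma> TYPE(('m::finite,'k::finite) pt) a c =
    shell_mass \<gamma> TYPE(('m,'k) pt) a b + shell_mass \<gamma> TYPE(('m,'k) pt) b c"
proof -
  have [measurable]: "inv_density \<gamma> \<in> borel_measurable (borel :: ('m,'k) pt measure)"
    by (rule borel_inv_density[OF assms(1)])
  note [measurable] = shell_borel[OF assms(1)]
  show ?thesis
    unfolding shell_mass_def
    by (subst nn_integral_add[symmetric]) (use assms in \<open>auto intro!: nn_integral_cong simp: indicator_def\<close>)
qed

lemma shell_mass_dyadic:
  assumes "\<gamma> > 0"
  shows "shell_mass \<gamma> TYPE(('m::finite,'k::finite) pt) 1 (2 ^ n) = of_nat n * shell_mass \<gamma> TYPE(('m,'k) pt) 1 2"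
proof (induction n)
  case 0
  have "{z :: ('m,'k) pt. 1 \<le> gauge_pow \<gamma> z \<and> gauge_pow \<gamma> z < 1} = {}" by auto
  then show ?case unfolding shell_mass_def by simp
next
  case (Suc n)
  have "shell_mass \<gamma> TYPE(('m,'k) pt) 1 (2 ^ Suc n) =
      shell_mass \<gamma> TYPE(('m,'k) pt) 1 (2 ^ n) + shell_mass \<gamma> TYPE(('m,'k) pt) (2 ^ n * 1) (2 ^ n * 2)"
    using shell_mass_add[OF assms, of 1 "2 ^ n" "2 ^ Suc n"] by (simp add: mult.commute)
  also have "\<dots> = of_nat (Suc n) * shell_mass \<gamma> TYPE(('m,'k) pt) 1 2"
    unfolding Suc shell_mass_scaling[OF assms zero_less_power[OF zero_less_numeral]] by (simp add: algebra_simps)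
  finally show ?case .
qed

section \<open>Finiteness and positivity of the shell mass\<close>

lemma gauge_pow_le_imp_bounded:
  assumes "\<gamma> > 0" "M \<ge> 1" "gauge_pow \<gamma> z \<le> M"
  shows "norm (fst z) \<le> M" "(norm (snd z))\<^sup>2 \<le> M"
proof -
  have m: "norm (fst z) powr (2*(1+\<gamma>)) \<le> M" "(1+\<gamma>)\<^sup>2 * (norm (snd z))\<^sup>2 \<le> M"
    using assms(3) powr_ge_zero[of "norm (fst z)" "2*(1+\<gamma>)"] mult_nonneg_nonneg[OF zero_le_power2 zero_le_power2, of "1+\<gamma>" "norm (snd z)"]
    unfolding gauge_pow_def by linarith+
  show "norm (fst z) \<le> M"
  proof (cases "norm (fst z) \<le> 1")
    case False
    then have "norm (fst z) powr 1 \<le> norm (fst z) powr (2*(1+\<gamma>))"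
      using assms(1) by (intro powr_mono) auto
    then show ?thesis using m(1) False by simp
  qed (use assms in simp)
  have "1 \<le> (1+\<gamma>)\<^sup>2" using assms(1) by (simp add: one_le_power)
  then have "1 * (norm (snd z))\<^sup>2 \<le> (1+\<gamma>)\<^sup>2 * (norm (snd z))\<^sup>2" by (intro mult_right_mono) auto
  then show "(norm (snd z))\<^sup>2 \<le> M" using m(2) by simp
qed

lemma nn_integral_indicator_compact_finite:
  fixes g :: "'a::euclidean_space \<Rightarrow> real"
  assumes "compact K" "continuous_on UNIV g"
  shows "(\<integral>\<^sup>+z. ennreal (indicator K z * g z) \<partial>lborel) < \<infinity>"
proof -
  have "integrable lborel (\<lambda>x. indicator K x *\<^sub>R g x)"
    by (rule borel_integrable_compact) (use assms in \<open>auto intro: continuous_on_subset\<close>)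
  then have "(\<integral>\<^sup>+z. ennreal (norm (indicator K z *\<^sub>R g z)) \<partial>lborel) < \<infinity>"
    by (simp add: integrable_iff_bounded)
  moreover have "(\<integral>\<^sup>+z. ennreal (indicator K z * g z) \<partial>lborel) \<le> (\<integral>\<^sup>+z. ennreal (norm (indicator K z *\<^sub>R g z)) \<partial>lborel)"
    by (intro nn_integral_mono ennreal_leI) simp
  ultimately show ?thesis by (rule le_less_trans[rotated])
qed

lemma shell_mass_finite:
  assumes "\<gamma> > 0"
  shows "shell_mass \<gamma> TYPE(('m::finite,'k::finite) pt) 1 2 < \<infinity>"
proof -
  let ?r = "\<lambda>z :: ('m,'k) pt. norm (fst z) powr (2*\<gamma>)"
  \<comment> \<open>On the shell |x| <= 2 and |y|^2 <= 2, so |z|^2 <= 6. As h >= 1 has a nonpositive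
    exponent, the density is at most r.\<close>
  have "shell_mass \<gamma> TYPE(('m,'k) pt) 1 2 \<le> (\<integral>\<^sup>+z. ennreal (indicator (cball 0 (sqrt 6)) z * ?r z) \<partial>lborel)"
    unfolding shell_mass_def
  proof (rule nn_integral_mono)
    fix z :: "('m,'k) pt"
    show "ennreal (inv_density \<gamma> z) * indicator {z. 1 \<le> gauge_pow \<gamma> z \<and> gauge_pow \<gamma> z < 2} z
        \<le> ennreal (indicator (cball 0 (sqrt 6)) z * ?r z)"
    proof (cases "1 \<le> gauge_pow \<gamma> z \<and> gauge_pow \<gamma> z < 2")
      case True
      then have *: "norm (fst z) \<le> 2" "(norm (snd z))\<^sup>2 \<le> 2"
        using gauge_pow_le_imp_bounded[OF assms, of 2 z] by auto
      then have "(norm (fst z))\<^sup>2 \<le> 2\<^sup>2" by (intro power_mono) auto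
      then have "(norm z)\<^sup>2 \<le> 6" using * by (simp add: norm_prod_def)
      then have "z \<in> cball 0 (sqrt 6)" by (simp add: real_le_rsqrt)
      moreover have "gauge_pow \<gamma> z powr (- (hom_dim \<gamma> TYPE(('m,'k) pt) + 2 * \<gamma>) / (2*(1+\<gamma>))) \<le> gauge_pow \<gamma> z powr 0"
      proof (rule powr_mono)
        have "0 \<le> hom_dim \<gamma> TYPE(('m,'k) pt) + 2 * \<gamma>" using assms by (simp add: hom_dim_def)
        then show "- (hom_dim \<gamma> TYPE(('m,'k) pt) + 2 * \<gamma>) / (2*(1+\<gamma>)) \<le> 0"
          using assms by (intro divide_nonpos_pos) auto
      qed (use True in simp)
      then have "inv_density \<gamma> z \<le> 1 * ?r z"
        using True unfolding inv_density_def by (intro mult_right_mono) auto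
      ultimately show ?thesis using True by (simp add: ennreal_leI)
    qed simp
  qed
  also have "\<dots> < \<infinity>"
    by (rule nn_integral_indicator_compact_finite[OF compact_cball continuous_on_norm_powr]) (use assms in simp)
  finally show ?thesis .
qed

lemma shell_mass_pos:
  assumes "\<gamma> > 0"
  shows "shell_mass \<gamma> TYPE(('m::finite,'k::finite) pt) 1 2 > 0"
proof (rule ccontr)
  assume "\<not> ?thesis"
  then have 0: "shell_mass \<gamma> TYPE(('m,'k) pt) 1 2 = 0" by simp
  have [measurable]: "inv_density \<gamma> \<in> borel_measurable (borel :: ('m,'k) pt measure)"
    by (rule borel_inv_density[OF assms(1)])
  note [measurable] = shell_borel[OF assms(1)]
  have "AE z in lborel. ennreal (inv_density \<gamma> (z :: ('m,'k) pt)) * indicator {z. 1 \<le> gauge_pow \<gamma> z \<and> gauge_pow \<gamma> z < 2} z = 0"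
    using 0 unfolding shell_mass_def by (subst (asm) nn_integral_0_iff_AE) measurable
  then have "AE z :: ('m,'k) pt in lborel. z \<notin> {z. 1 < gauge_pow \<gamma> z} \<inter> {z. gauge_pow \<gamma> z < 2}"
    using AE_fst_nonzero
  proof eventually_elim
    case (elim z)
    then have "gauge_pow \<gamma> z > 0" using gauge_pow_pos[OF assms, of z] by fastforce
    then have "inv_density \<gamma> z > 0" using elim(2) by (simp add: inv_density_def)
    then show ?case using elim(1) by (auto simp: indicator_def split: if_splits)
  qed
  moreover have "open ({z :: ('m,'k) pt. 1 < gauge_pow \<gamma> z} \<inter> {z. gauge_pow \<gamma> z < 2})"
    by (intro open_Int open_Collect_less continuous_on_gauge_pow assms continuous_on_const)
  ultimately have e: "{z :: ('m,'k) pt. 1 < gauge_pow \<gamma> z} \<inter> {z. gauge_pow \<gamma> z < 2} = {}"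
    by (intro open_AE_empty)
  obtain j :: 'k where True by simp
  \<comment> \<open>A point with x = 0 and (1+\<gamma>)^2 |y|^2 = 3/2, showing that the open shell
    is nonempty.\<close>
  define z :: "('m,'k) pt" where "z = (0, (sqrt (3/2) / (1+\<gamma>)) *\<^sub>R axis j 1)"
  have "gauge_pow \<gamma> z = 3/2"
    using assms by (simp add: gauge_pow_def z_def power_mult_distrib power_divide)
  then have "1 < gauge_pow \<gamma> z" "gauge_pow \<gamma> z < 2" by simp_all
  then show False using e by blast
qed

section \<open>Passage to the non-smooth limit\<close>

text \<open>The support lies where the regularised gauge is between 1/2 and 2 H. That set is bounded
  and misses the origin, where the regularised gauge is 0.\<close>

lemma profile_test_fun:
  fixes \<gamma> \<sigma> b H :: real
  defines "f \<equiv> \<lambda>z :: ('m::finite,'k::finite) pt. profile \<sigma> H (trial_gauge \<gamma> b z)"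
  assumes "\<gamma> > 0" "0 < b" "b \<le> 1" "H \<ge> 1"
  shows "test_fun f" "f \<noteq> (\<lambda>z. 0)"
proof -
  have s: "smooth f"
    unfolding f_def
    by (rule smooth_alg_imp_smooth[OF smooth_alg_compose[OF smooth_alg_profile smooth_alg_trial_gauge[OF assms(3)]]])
  let ?K = "{z :: ('m,'k) pt. 1/2 \<le> trial_gauge \<gamma> b z} \<inter> {z. trial_gauge \<gamma> b z \<le> 2 * H}"
  have cont: "continuous_on UNIV (trial_gauge \<gamma> b :: ('m,'k) pt \<Rightarrow> real)"
    by (intro smooth_alg_continuous_on smooth_alg_trial_gauge assms)
  have cl: "closed ?K"
    by (intro closed_Int closed_Collect_le cont continuous_on_const)
  have "{z. f z \<noteq> 0} \<subseteq> ?K"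
    using profile_derivs_zero(1)[of H _ \<sigma>] assms(5) by (force simp: f_def not_less[symmetric])
  then have sub: "tsupport f \<subseteq> ?K"
    unfolding tsupport_def by (rule closure_minimal[OF _ cl])
  have "?K \<subseteq> cball 0 (sqrt (8 * H))"
    using trial_gauge_le_imp_bounded[OF assms(2-5)] by blast
  then have "compact ?K"
    using cl by (meson bounded_cball bounded_subset compact_eq_bounded_closed)
  then have "compact (tsupport f)"
    using sub by (metis closed_closure closed_Int_compact inf.absorb_iff1 tsupport_def)
  moreover have "trial_gauge \<gamma> b (0 :: ('m,'k) pt) = 0"
    by (simp add: trial_gauge_def flat_def)
  then have "0 \<notin> tsupport f" using sub by force
  ultimately show "test_fun f" using s by (simp add: test_fun_def)
  obtain j :: 'k where True by simp
  \<comment> \<open>Here the regularised gauge equals 1, so the profile takes the value 1 whatever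
    \<sigma> is.\<close>
  define z :: "('m,'k) pt" where "z = (0, (1 / (1+\<gamma>)) *\<^sub>R axis j 1)"
  have "trial_gauge \<gamma> b z = 1"
    using assms by (simp add: trial_gauge_def z_def power_divide flat_def)
  then have "f z = 1"
    using assms by (simp add: f_def profile_def profile_inner_ge profile_outer_le)
  then show "f \<noteq> (\<lambda>z. 0)" by (metis zero_neq_one)
qed

section \<open>Measurability and bounds for dominated convergence\<close>

lemma borel_flat:
  assumes "b > 0"
  shows "flat a b \<in> borel_measurable borel"
  by (intro borel_measurable_continuous_onI continuous_at_imp_continuous_on ballI DERIV_isCont[OF DERIV_flat] assms)

lemma borel_trial:
  assumes "b > 0"
  shows "trial_grad \<gamma> b \<in> borel_measurable (borel :: ('m::finite,'k::finite) pt measure)"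
    and "trial_lap \<gamma> b \<in> borel_measurable (borel :: ('m,'k) pt measure)"
proof -
  note [measurable] = borel_flat[OF assms]
  show "trial_grad \<gamma> b \<in> borel_measurable (borel :: ('m::finite,'k::finite) pt measure)"
    unfolding trial_grad_def flat_deriv1_def by measurable
  show "trial_lap \<gamma> b \<in> borel_measurable (borel :: ('m,'k) pt measure)"
    unfolding trial_lap_def flat_deriv1_def flat_deriv2_def by measurable
qed

lemma continuous_on_gauge_pow_pos_powr:
  assumes "\<gamma> > 0" "c > 0"
  shows "continuous_on S (\<lambda>z. gauge_pow \<gamma> z powr c)"
  by (rule continuous_on_powr'[OF continuous_on_gauge_pow continuous_on_const])
    (use assms gauge_pow_nonneg in auto)

text \<open>An unweighted bound for one fixed H, used to dominate as b tends to 0; uniformity in H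
  is the business of \<open>profile_bound\<close>.\<close>

lemma profile_derivs_global_bound:
  assumes "H \<ge> 1"
  shows "\<exists>C\<ge>0. \<forall>x. \<bar>D1 (profile \<sigma> H) x\<bar> \<le> C \<and> \<bar>D2 (profile \<sigma> H) x\<bar> \<le> C"
proof -
  note d = smooth_alg_dirderiv[OF smooth_alg_profile]
  have z: "D1 (profile \<sigma> H) x = 0" "D2 (profile \<sigma> H) x = 0" if "x < 1/2 \<or> x > 2 * H" for x
    using profile_derivs_zero[of H x \<sigma>] that assms by auto
  obtain C1 where C1: "\<And>x. x > 0 \<Longrightarrow> \<bar>D1 (profile \<sigma> H) x\<bar> \<le> C1"
    using bounded_on_Icc[of "1/2" "2 * H" "D1 (profile \<sigma> H)" 0] smooth_alg_continuous_on[OF d] z by force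
  obtain C2 where C2: "\<And>x. x > 0 \<Longrightarrow> \<bar>D2 (profile \<sigma> H) x\<bar> \<le> C2"
    using bounded_on_Icc[of "1/2" "2 * H" "D2 (profile \<sigma> H)" 0] smooth_alg_continuous_on[OF smooth_alg_dirderiv[OF d]] z by force
  have "\<bar>D1 (profile \<sigma> H) x\<bar> \<le> \<bar>C1\<bar> + \<bar>C2\<bar> \<and> \<bar>D2 (profile \<sigma> H) x\<bar> \<le> \<bar>C1\<bar> + \<bar>C2\<bar>" for x
  proof (cases "x > 0")
    case True
    then show ?thesis using C1[of x] C2[of x] by linarith
  next
    case False
    then show ?thesis using z[of x] by simp
  qed
  then show ?thesis by (intro exI[of _ "\<bar>C1\<bar> + \<bar>C2\<bar>"]) auto
qed

text \<open>Dominated convergence along b = 1/(n+1) with the cutoff H fixed. The limits are the two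
  integrals of the profile composed with h itself, evaluated by the formal chain rule off x =
  0.\<close>

lemma trial_integral_limits:
  fixes \<gamma> \<alpha> \<sigma> H :: real
  defines "\<beta> \<equiv> (\<alpha> - 2) / (2*(1+\<gamma>))" and "\<tau> \<equiv> 2 * (1+\<gamma>)"
    and "F \<equiv> profile \<sigma> H" and "Q \<equiv> hom_dim \<gamma> TYPE(('m::finite,'k::finite) pt)"
    and "f \<equiv> \<lambda>n (z :: ('m,'k) pt). profile \<sigma> H (trial_gauge \<gamma> (inverse (real (Suc n))) z)"
  assumes \<gamma>: "\<gamma> > 0" and \<alpha>: "\<alpha> > 2" and H: "H \<ge> 1"
  shows "(\<lambda>n. lhs_int \<gamma> \<alpha> (f n)) \<longlonglongrightarrow>
      (\<integral>\<^sup>+z. ennreal (gauge_pow \<gamma> (z :: ('m,'k) pt) powr (\<beta> + 1) / norm (fst z) powr (2*\<gamma>) *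
        (D2 F (gauge_pow \<gamma> z) * (\<tau>\<^sup>2 * norm (fst z) powr (2*\<gamma>) * gauge_pow \<gamma> z)
         + D1 F (gauge_pow \<gamma> z) * (\<tau> * (Q + 2 * \<gamma>) * norm (fst z) powr (2*\<gamma>)))\<^sup>2) \<partial>lborel)" (is ?th1)
    and "(\<lambda>n. rhs_int \<gamma> \<alpha> (f n)) \<longlonglongrightarrow>
      (\<integral>\<^sup>+z. ennreal (gauge_pow \<gamma> (z :: ('m,'k) pt) powr \<beta> *
        ((D1 F (gauge_pow \<gamma> z))\<^sup>2 * (\<tau>\<^sup>2 * norm (fst z) powr (2*\<gamma>) * gauge_pow \<gamma> z))) \<partial>lborel)" (is ?th2)
proof -
  define b where "b n = inverse (real (Suc n))" for n
  have b: "b n > 0" "b n \<le> 1" for n by (auto simp: b_def inverse_le_1_iff)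
  have b0: "b \<longlonglongrightarrow> 0" unfolding b_def by (rule LIMSEQ_inverse_real_of_nat)
  \<comment> \<open>Positivity of \<beta> keeps the dominating powers of h continuous at the
    origin.\<close>
  have \<beta>: "\<beta> > 0" using \<gamma> \<alpha> by (simp add: \<beta>_def)
  have sF: "smooth_alg F" "smooth_alg (D1 F)" "smooth_alg (D2 F)"
    unfolding F_def by (intro smooth_alg_profile smooth_alg_dirderiv)+
  have F_cont: "isCont (D1 F) x" "isCont (D2 F) x" for x
    by (intro DERIV_isCont[OF smooth_alg_real_deriv] sF)+
  have [measurable]: "D1 F \<in> borel_measurable borel" "D2 F \<in> borel_measurable borel"
    using sF by (auto intro: borel_measurable_continuous_onI smooth_alg_continuous_on)
  have [measurable]: "gauge_pow \<gamma> \<in> borel_measurable (borel :: ('m,'k) pt measure)"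
    by (rule borel_gauge_pow[OF \<gamma>])
  have [measurable]: "trial_gauge \<gamma> (b n) \<in> borel_measurable (borel :: ('m,'k) pt measure)" for n
    using b by (auto intro: borel_measurable_continuous_onI smooth_alg_continuous_on smooth_alg_trial_gauge)
  have [measurable]: "trial_grad \<gamma> (b n) \<in> borel_measurable (borel :: ('m,'k) pt measure)"
    "trial_lap \<gamma> (b n) \<in> borel_measurable (borel :: ('m,'k) pt measure)" for n
    using borel_trial[OF b(1)[of n]] by blast+
  obtain C where C: "C \<ge> 0" "\<And>x. \<bar>D1 F x\<bar> \<le> C" "\<And>x. \<bar>D2 F x\<bar> \<le> C"
    using profile_derivs_global_bound[OF H, of \<sigma>] unfolding F_def by blast
  define C1 where "C1 = 4 * (2+\<gamma>)\<^sup>2"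
  define C2 where "C2 = 4 * (\<gamma> * (1 + \<gamma>) + 2 * \<gamma> + 2) + 2 * real CARD('m) * (2+\<gamma>) + 2 * (1+\<gamma>)\<^sup>2 * real CARD('k)"
  let ?r = "\<lambda>z :: ('m,'k) pt. norm (fst z) powr (2*\<gamma>)" and ?h = "gauge_pow \<gamma> :: ('m,'k) pt \<Rightarrow> real"
  \<comment> \<open>Outside this ball the derivatives of the profile vanish at the regularised gauge
    for every n.\<close>
  let ?B = "cball (0 :: ('m,'k) pt) (sqrt (8 * H))"
  have [measurable]: "?B \<in> sets borel" by simp
  have F0: "D1 F (trial_gauge \<gamma> (b n) z) = 0 \<and> D2 F (trial_gauge \<gamma> (b n) z) = 0" if "z \<notin> ?B" for n z
  proof -
    have "trial_gauge \<gamma> (b n) z > 2 * H"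
      using trial_gauge_le_imp_bounded[OF \<gamma> b H, of n z] that by force
    then show ?thesis using profile_derivs_zero[of H "trial_gauge \<gamma> (b n) z" \<sigma>] H by (simp add: F_def)
  qed
  have f: "f n = (\<lambda>z. F (trial_gauge \<gamma> (b n) z))" for n by (simp add: f_def F_def b_def)
  show ?th1
  proof -
    define u where "u n z = ?h z powr (\<beta> + 1) / ?r z *
      (D2 F (trial_gauge \<gamma> (b n) z) * trial_grad \<gamma> (b n) z + D1 F (trial_gauge \<gamma> (b n) z) * trial_lap \<gamma> (b n) z)\<^sup>2" for n z
    have eq: "lhs_int \<gamma> \<alpha> (f n) = (\<integral>\<^sup>+z. ennreal (u n z) \<partial>lborel)" for n
      unfolding lhs_int_def
    proof (rule nn_integral_cong_AE, use AE_fst_nonzero in eventually_elim)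
      fix z :: "('m,'k) pt" assume z: "fst z \<noteq> 0"
      show "ennreal (gauge \<gamma> z powr \<alpha> * (grushin_lap \<gamma> (f n) z)\<^sup>2 / grushin_grad_sq \<gamma> (gauge \<gamma>) z) = ennreal (u n z)"
        unfolding lhs_integrand[OF \<gamma> z] u_def f trial_derivs[OF b(1) sF(1)] \<beta>_def ..
    qed
    \<comment> \<open>The Laplacian is at most r C (C1 h + C2) in absolute value; squaring and
      dividing by r leaves one factor r.\<close>
    let ?g = "\<lambda>z. ?h z powr (\<beta> + 1) * ?r z * (C * (C1 * ?h z + C2))\<^sup>2"
    show ?thesis
      unfolding eq
    proof (rule nn_integral_dominated_convergence[where w = "\<lambda>z. ennreal (indicator ?B z * ?g z)"])
      show "(\<lambda>z. ennreal (u n z)) \<in> borel_measurable lborel" for n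
        unfolding u_def by measurable
      show "(\<integral>\<^sup>+z. ennreal (indicator ?B z * ?g z) \<partial>lborel) < \<infinity>"
        by (rule nn_integral_indicator_compact_finite[OF compact_cball])
          (intro continuous_on_norm_powr continuous_on_gauge_pow_pos_powr continuous_on_gauge_pow \<gamma> continuous_intros;
            use \<gamma> \<beta> in simp)
      show "AE z in lborel. ennreal (u n z) \<le> ennreal (indicator ?B z * ?g z)" for n
        using AE_fst_nonzero
      proof eventually_elim
        fix z :: "('m,'k) pt" assume z: "fst z \<noteq> 0"
        then have r: "?r z > 0" by simp
        note tb = trial_bounds[OF \<gamma> b(1) z, of n, folded C1_def C2_def]
        show "ennreal (u n z) \<le> ennreal (indicator ?B z * ?g z)"
        proof (cases "z \<in> ?B")
          case True
          have "\<bar>D2 F (trial_gauge \<gamma> (b n) z) * trial_grad \<gamma> (b n) z + D1 F (trial_gauge \<gamma> (b n) z) * trial_lap \<gamma> (b n) z\<bar>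
              \<le> C * (?r z * (C1 * ?h z)) + C * (?r z * C2)"
            using tb C by (intro order_trans[OF abs_triangle_ineq] add_mono) (auto simp: abs_mult intro!: mult_mono)
          also have "\<dots> = ?r z * (C * (C1 * ?h z + C2))" by algebra
          finally have "(D2 F (trial_gauge \<gamma> (b n) z) * trial_grad \<gamma> (b n) z + D1 F (trial_gauge \<gamma> (b n) z) * trial_lap \<gamma> (b n) z)\<^sup>2
              \<le> (?r z * (C * (C1 * ?h z + C2)))\<^sup>2"
            by (metis abs_ge_zero power2_abs power_mono)
          then have "u n z \<le> ?h z powr (\<beta> + 1) / ?r z * (?r z * (C * (C1 * ?h z + C2)))\<^sup>2"
            unfolding u_def by (intro mult_left_mono) auto
          also have "\<dots> = ?g z" using r by (simp add: power2_eq_square)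
          finally show ?thesis using True by (simp add: ennreal_leI)
        qed (simp add: u_def F0)
      qed
      show "AE z in lborel. (\<lambda>n. ennreal (u n z)) \<longlonglongrightarrow> ennreal (?h z powr (\<beta> + 1) / ?r z *
        (D2 F (?h z) * (\<tau>\<^sup>2 * ?r z * ?h z) + D1 F (?h z) * (\<tau> * (Q + 2 * \<gamma>) * ?r z))\<^sup>2)"
        using AE_fst_nonzero
      proof eventually_elim
        fix z :: "('m,'k) pt" assume z: "fst z \<noteq> 0"
        note l = trial_limits[OF z b0, of \<gamma>, folded Q_def \<tau>_def]
        show "(\<lambda>n. ennreal (u n z)) \<longlonglongrightarrow> ennreal (?h z powr (\<beta> + 1) / ?r z *
          (D2 F (?h z) * (\<tau>\<^sup>2 * ?r z * ?h z) + D1 F (?h z) * (\<tau> * (Q + 2 * \<gamma>) * ?r z))\<^sup>2)"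
          unfolding u_def
          by (intro tendsto_ennrealI tendsto_mult tendsto_power tendsto_add tendsto_const l
              isCont_tendsto_compose[OF F_cont(1)] isCont_tendsto_compose[OF F_cont(2)])
      qed
      show "(\<lambda>z. ennreal (indicator ?B z * ?g z)) \<in> borel_measurable lborel" by measurable
      show "(\<lambda>z. ennreal (?h z powr (\<beta> + 1) / ?r z *
        (D2 F (?h z) * (\<tau>\<^sup>2 * ?r z * ?h z) + D1 F (?h z) * (\<tau> * (Q + 2 * \<gamma>) * ?r z))\<^sup>2)) \<in> borel_measurable lborel"
        by measurable
    qed
  qed
  show ?th2
  proof -
    define u where "u n z = ?h z powr \<beta> * ((D1 F (trial_gauge \<gamma> (b n) z))\<^sup>2 * trial_grad \<gamma> (b n) z)" for n z
    have eq: "rhs_int \<gamma> \<alpha> (f n) = (\<integral>\<^sup>+z. ennreal (u n z) \<partial>lborel)" for n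
      unfolding rhs_int_def rhs_integrand[OF \<gamma>] u_def f trial_derivs[OF b(1) sF(1)] \<beta>_def ..
    let ?g = "\<lambda>z. ?h z powr \<beta> * (C\<^sup>2 * (?r z * (C1 * ?h z)))"
    show ?thesis
      unfolding eq
    proof (rule nn_integral_dominated_convergence[where w = "\<lambda>z. ennreal (indicator ?B z * ?g z)"])
      show "(\<lambda>z. ennreal (u n z)) \<in> borel_measurable lborel" for n
        unfolding u_def by measurable
      show "(\<integral>\<^sup>+z. ennreal (indicator ?B z * ?g z) \<partial>lborel) < \<infinity>"
        by (rule nn_integral_indicator_compact_finite[OF compact_cball])
          (intro continuous_on_norm_powr continuous_on_gauge_pow_pos_powr continuous_on_gauge_pow \<gamma> continuous_intros;
            use \<gamma> \<beta> in simp)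
      show "AE z in lborel. ennreal (u n z) \<le> ennreal (indicator ?B z * ?g z)" for n
        using AE_fst_nonzero
      proof eventually_elim
        fix z :: "('m,'k) pt" assume z: "fst z \<noteq> 0"
        note tb = trial_bounds[OF \<gamma> b(1) z, of n, folded C1_def C2_def]
        show "ennreal (u n z) \<le> ennreal (indicator ?B z * ?g z)"
        proof (cases "z \<in> ?B")
          case True
          have "(D1 F (trial_gauge \<gamma> (b n) z))\<^sup>2 \<le> C\<^sup>2"
            using C(2) by (metis abs_ge_zero power2_abs power_mono)
          then have "u n z \<le> ?g z"
            unfolding u_def using tb by (intro mult_left_mono mult_mono) auto
          then show ?thesis using True by (simp add: ennreal_leI)
        qed (simp add: u_def F0)
      qed
      show "AE z in lborel. (\<lambda>n. ennreal (u n z)) \<longlonglongrightarrow> ennreal (?h z powr \<beta> * ((D1 F (?h z))\<^sup>2 * (\<tau>\<^sup>2 * ?r z * ?h z)))"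
        using AE_fst_nonzero
      proof eventually_elim
        fix z :: "('m,'k) pt" assume z: "fst z \<noteq> 0"
        note l = trial_limits[OF z b0, of \<gamma>, folded Q_def \<tau>_def]
        show "(\<lambda>n. ennreal (u n z)) \<longlonglongrightarrow> ennreal (?h z powr \<beta> * ((D1 F (?h z))\<^sup>2 * (\<tau>\<^sup>2 * ?r z * ?h z)))"
          unfolding u_def
          by (intro tendsto_ennrealI tendsto_mult tendsto_power tendsto_const l
              isCont_tendsto_compose[OF F_cont(1)])
      qed
      show "(\<lambda>z. ennreal (indicator ?B z * ?g z)) \<in> borel_measurable lborel" by measurable
      show "(\<lambda>z. ennreal (?h z powr \<beta> * ((D1 F (?h z))\<^sup>2 * (\<tau>\<^sup>2 * ?r z * ?h z)))) \<in> borel_measurable lborel"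
        by measurable
    qed
  qed
qed

section \<open>Sharpness\<close>

text \<open>Each integrand splits into \<open>inv_density\<close> and a quadratic expression in the
  scale-invariant derivatives of the profile, so that bounds on the latter turn into multiples of
  shell masses.\<close>

lemma limit_integrands:
  fixes \<gamma> \<alpha> Q h r d1 d2 :: real
  assumes "\<gamma> > 0" "h > 0" "r > 0"
  defines "\<beta> \<equiv> (\<alpha> - 2) / (2*(1+\<gamma>))" and "\<tau> \<equiv> 2 * (1+\<gamma>)"
    and "\<sigma> \<equiv> (Q + \<alpha> - 4) / 2 / (2*(1+\<gamma>))" and "e \<equiv> - (Q + 2 * \<gamma>) / (2*(1+\<gamma>))"
  shows "h powr (\<beta> + 1) / r * (d2 * (\<tau>\<^sup>2 * r * h) + d1 * (\<tau> * (Q + 2 * \<gamma>) * r))\<^sup>2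
      = h powr e * r * (\<tau>\<^sup>2 * ((Q + 2 * \<gamma>) * (h powr (\<sigma> + 1) * d1) + \<tau> * (h powr (\<sigma> + 2) * d2))\<^sup>2)"
    and "h powr \<beta> * (d1\<^sup>2 * (\<tau>\<^sup>2 * r * h)) = h powr e * r * (\<tau>\<^sup>2 * (h powr (\<sigma> + 1) * d1)\<^sup>2)"
proof -
  have t: "\<tau> > 0" using assms(1) by (simp add: \<tau>_def)
  \<comment> \<open>After multiplication by \<tau> both sides equal \<alpha> + 2 \<gamma>.\<close>
  have "\<beta> + 1 = e + ((\<sigma> + 1) + (\<sigma> + 1))"
  proof -
    have l: "\<tau> * \<beta> = \<alpha> - 2" "\<tau> * \<sigma> = (Q + \<alpha> - 4) / 2" "\<tau> * e = - (Q + 2 * \<gamma>)"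
      using t unfolding \<beta>_def \<sigma>_def e_def \<tau>_def[symmetric] by simp_all
    have "\<tau> * (\<beta> + 1) = \<tau> * \<beta> + \<tau>" by algebra
    also have "\<dots> = \<tau> * e + 2 * (\<tau> * \<sigma>) + 2 * \<tau>" unfolding l by (simp add: \<tau>_def field_simps)
    also have "\<dots> = \<tau> * (e + ((\<sigma> + 1) + (\<sigma> + 1)))" by algebra
    finally have "\<tau> * (\<beta> + 1) = \<tau> * (e + ((\<sigma> + 1) + (\<sigma> + 1)))" .
    then show ?thesis using t by simp
  qed
  then have p: "h powr (\<beta> + 1) = h powr e * (h powr (\<sigma> + 1))\<^sup>2"
    by (simp only: powr_add power2_eq_square mult.assoc)
  have p1: "h powr (\<beta> + 1) = h powr \<beta> * h" "h powr (\<sigma> + 2) = h powr (\<sigma> + 1) * h"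
    using assms(2) powr_add[of h "\<sigma> + 1" 1] by (simp_all add: powr_add add.assoc)
  show "h powr (\<beta> + 1) / r * (d2 * (\<tau>\<^sup>2 * r * h) + d1 * (\<tau> * (Q + 2 * \<gamma>) * r))\<^sup>2
      = h powr e * r * (\<tau>\<^sup>2 * ((Q + 2 * \<gamma>) * (h powr (\<sigma> + 1) * d1) + \<tau> * (h powr (\<sigma> + 2) * d2))\<^sup>2)"
  proof -
    have "h powr (\<beta> + 1) / r * (d2 * (\<tau>\<^sup>2 * r * h) + d1 * (\<tau> * (Q + 2 * \<gamma>) * r))\<^sup>2
      = h powr (\<beta> + 1) / r * (r * (\<tau> * ((Q + 2 * \<gamma>) * d1 + \<tau> * (h * d2))))\<^sup>2"
      by (intro arg_cong[where f = "\<lambda>x. _ * x\<^sup>2"]) algebra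
    also have "\<dots> = h powr (\<beta> + 1) * r * (\<tau> * ((Q + 2 * \<gamma>) * d1 + \<tau> * (h * d2)))\<^sup>2"
      using assms(3) by (simp add: power2_eq_square)
    also have "\<dots> = h powr e * r * (\<tau>\<^sup>2 * ((Q + 2 * \<gamma>) * (h powr (\<sigma> + 1) * d1) + \<tau> * (h powr (\<sigma> + 2) * d2))\<^sup>2)"
      unfolding p p1(2) by algebra
    finally show ?thesis .
  qed
  show "h powr \<beta> * (d1\<^sup>2 * (\<tau>\<^sup>2 * r * h)) = h powr e * r * (\<tau>\<^sup>2 * (h powr (\<sigma> + 1) * d1)\<^sup>2)"
  proof -
    have "h powr \<beta> * (d1\<^sup>2 * (\<tau>\<^sup>2 * r * h)) = h powr (\<beta> + 1) * (d1\<^sup>2 * (\<tau>\<^sup>2 * r))"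
      unfolding p1 by algebra
    then show ?thesis unfolding p by algebra
  qed
qed

text \<open>For 1 <= h < 2^n the profile is h^(-\<sigma>) and both integrands are constant multiples
  of the density, whose mass there is n M. The cutoff regions cost at most D times their mass 3 M in
  the upper estimate and are dropped in the lower one.\<close>

lemma limit_integral_estimates:
  fixes \<gamma> \<alpha> :: real
  defines "\<beta> \<equiv> (\<alpha> - 2) / (2*(1+\<gamma>))" and "\<tau> \<equiv> 2 * (1+\<gamma>)"
    and "Q \<equiv> hom_dim \<gamma> TYPE(('m::finite,'k::finite) pt)"
    and "M \<equiv> shell_mass \<gamma> TYPE(('m,'k) pt) 1 2"
  defines "\<sigma> \<equiv> (Q + \<alpha> - 4) / 2 / (2*(1+\<gamma>))"
  assumes \<gamma>: "\<gamma> > 0"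
  obtains D where "D \<ge> 0"
    "\<And>n. (\<integral>\<^sup>+z. ennreal (gauge_pow \<gamma> (z :: ('m,'k) pt) powr (\<beta> + 1) / norm (fst z) powr (2*\<gamma>) *
        (D2 (profile \<sigma> (2 ^ n)) (gauge_pow \<gamma> z) * (\<tau>\<^sup>2 * norm (fst z) powr (2*\<gamma>) * gauge_pow \<gamma> z)
         + D1 (profile \<sigma> (2 ^ n)) (gauge_pow \<gamma> z) * (\<tau> * (Q + 2 * \<gamma>) * norm (fst z) powr (2*\<gamma>)))\<^sup>2) \<partial>lborel)
      \<le> ennreal (((Q + \<alpha> - 4) / 2)\<^sup>2 * ((Q - \<alpha>) / 2)\<^sup>2) * (of_nat n * M) + ennreal D * (3 * M)"
    "\<And>n. ennreal (((Q + \<alpha> - 4) / 2)\<^sup>2) * (of_nat n * M) \<le>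
      (\<integral>\<^sup>+z. ennreal (gauge_pow \<gamma> (z :: ('m,'k) pt) powr \<beta> *
        ((D1 (profile \<sigma> (2 ^ n)) (gauge_pow \<gamma> z))\<^sup>2 * (\<tau>\<^sup>2 * norm (fst z) powr (2*\<gamma>) * gauge_pow \<gamma> z))) \<partial>lborel)"
proof -
  define A B where "A = (Q + \<alpha> - 4) / 2" and "B = (Q - \<alpha>) / 2"
  obtain C where C: "\<And>H x. H \<ge> 1 \<Longrightarrow> x > 0 \<Longrightarrow>
      \<bar>x powr (\<sigma> + 1) * D1 (profile \<sigma> H) x\<bar> \<le> C \<and> \<bar>x powr (\<sigma> + 2) * D2 (profile \<sigma> H) x\<bar> \<le> C"
    using profile_bound[of \<sigma>] by blast
  \<comment> \<open>Independent of n, since C bounds the weighted derivatives of the profile for all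
    cutoffs at once.\<close>
  define D where "D = \<tau>\<^sup>2 * ((\<bar>Q + 2 * \<gamma>\<bar> + \<bar>\<tau>\<bar>) * C)\<^sup>2"
  have \<tau>: "\<tau> > 0" using \<gamma> by (simp add: \<tau>_def)
  have \<sigma>: "\<tau> * \<sigma> = A" using \<tau> unfolding \<sigma>_def A_def \<tau>_def[symmetric] by simp
  let ?h = "gauge_pow \<gamma> :: ('m,'k) pt \<Rightarrow> real" and ?r = "\<lambda>z :: ('m,'k) pt. norm (fst z) powr (2*\<gamma>)"
    and ?w = "inv_density \<gamma> :: ('m,'k) pt \<Rightarrow> real"
  define S where "S a b = {z :: ('m,'k) pt. a \<le> ?h z \<and> ?h z < b}" for a b
  have [measurable]: "?w \<in> borel_measurable borel" by (rule borel_inv_density[OF \<gamma>])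
  have [measurable]: "S a b \<in> sets borel" for a b unfolding S_def by (rule shell_borel[OF \<gamma>])
  have S: "(\<integral>\<^sup>+z. ennreal (?w z) * indicator (S a b) z \<partial>lborel) = shell_mass \<gamma> TYPE(('m,'k) pt) a b" for a b
    by (simp add: shell_mass_def S_def)
  \<comment> \<open>The inner cutoff occupies one dyadic shell. The outer one reaches h = 2 * 2^n;
    extending it to 4 * 2^n gives two whole half-open shells that also contain this
    endpoint.\<close>
  have shells: "shell_mass \<gamma> TYPE(('m,'k) pt) (1/2) 1 = M" "shell_mass \<gamma> TYPE(('m,'k) pt) (2 ^ n) (2 ^ n * 4) = 2 * M" for n
  proof -
    show "shell_mass \<gamma> TYPE(('m,'k) pt) (1/2) 1 = M"
      using shell_mass_scaling[OF \<gamma>, of "1/2" 1 2, where 'm = 'm and 'k = 'k] by (simp add: M_def)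
    show "shell_mass \<gamma> TYPE(('m,'k) pt) (2 ^ n) (2 ^ n * 4) = 2 * M"
      using shell_mass_scaling[OF \<gamma>, of "2 ^ n" 1 4, where 'm = 'm and 'k = 'k]
        shell_mass_dyadic[OF \<gamma>, of 2, where 'm = 'm and 'k = 'k] by (simp add: M_def)
  qed
  define E1 E2 where "E1 n x = x powr (\<sigma> + 1) * D1 (profile \<sigma> (2 ^ n)) x"
    and "E2 n x = x powr (\<sigma> + 2) * D2 (profile \<sigma> (2 ^ n)) x" for n :: nat and x
  define G where "G n x = \<tau>\<^sup>2 * ((Q + 2 * \<gamma>) * E1 n x + \<tau> * E2 n x)\<^sup>2" for n x
  have G_le: "G n x \<le> D" if "x > 0" for n x
  proof -
    have c: "\<bar>E1 n x\<bar> \<le> C" "\<bar>E2 n x\<bar> \<le> C" using C[of "2 ^ n" x] that by (auto simp: E1_def E2_def)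
    have "\<bar>(Q + 2 * \<gamma>) * E1 n x + \<tau> * E2 n x\<bar> \<le> \<bar>Q + 2 * \<gamma>\<bar> * C + \<bar>\<tau>\<bar> * C"
      using c by (intro order_trans[OF abs_triangle_ineq] add_mono) (auto simp: abs_mult intro!: mult_left_mono)
    then have "((Q + 2 * \<gamma>) * E1 n x + \<tau> * E2 n x)\<^sup>2 \<le> ((\<bar>Q + 2 * \<gamma>\<bar> + \<bar>\<tau>\<bar>) * C)\<^sup>2"
      by (metis abs_ge_zero power2_abs power_mono distrib_right)
    then show ?thesis unfolding G_def D_def by (intro mult_left_mono) auto
  qed
  have plateau: "E1 n x = - \<sigma>" "G n x = A\<^sup>2 * B\<^sup>2" if "1 \<le> x" "x < 2 ^ n" for n x
  proof -
    show e: "E1 n x = - \<sigma>" unfolding E1_def by (rule profile_plateau[OF that])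
    have "E2 n x = \<sigma> * (\<sigma> + 1)" unfolding E2_def by (rule profile_plateau[OF that])
    \<comment> \<open>This encodes \<Delta> \<rho>^(-A) = - A B \<rho>^(-A-2) |\<nabla>\<rho>|^2:
      the first factor is A and the second is - B.\<close>
    then have "G n x = (\<tau> * \<sigma> * (\<tau> * \<sigma> + \<tau> - Q - 2 * \<gamma>))\<^sup>2"
      unfolding G_def e by algebra
    also have "\<tau> * \<sigma> + \<tau> - Q - 2 * \<gamma> = - B"
      unfolding \<sigma> by (simp add: A_def B_def \<tau>_def field_simps)
    finally show "G n x = A\<^sup>2 * B\<^sup>2" unfolding \<sigma> by (simp add: power_mult_distrib)
  qed
  have zero: "G n x = 0" if "x < 1/2 \<or> x \<ge> 2 ^ n * 4" for n x
  proof -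
    have "(2::real) ^ n > 0" by simp
    then have "x < 1/2 \<or> x > 2 * 2 ^ n" using that by linarith
    then show ?thesis using profile_derivs_zero[of "2 ^ n" x \<sigma>] by (simp add: G_def E1_def E2_def)
  qed
  have eqs: "?h z powr (\<beta> + 1) / ?r z *
        (D2 (profile \<sigma> (2 ^ n)) (?h z) * (\<tau>\<^sup>2 * ?r z * ?h z) + D1 (profile \<sigma> (2 ^ n)) (?h z) * (\<tau> * (Q + 2 * \<gamma>) * ?r z))\<^sup>2
      = ?w z * G n (?h z)"
    "?h z powr \<beta> * ((D1 (profile \<sigma> (2 ^ n)) (?h z))\<^sup>2 * (\<tau>\<^sup>2 * ?r z * ?h z)) = ?w z * (\<tau>\<^sup>2 * (E1 n (?h z))\<^sup>2)"
    if "fst z \<noteq> 0" for n z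
  proof -
    have "z \<noteq> 0" using that by auto
    then have p: "?h z > 0" "?r z > 0" using gauge_pow_pos[OF \<gamma> \<open>z \<noteq> 0\<close>] that by simp_all
    show "?h z powr (\<beta> + 1) / ?r z *
        (D2 (profile \<sigma> (2 ^ n)) (?h z) * (\<tau>\<^sup>2 * ?r z * ?h z) + D1 (profile \<sigma> (2 ^ n)) (?h z) * (\<tau> * (Q + 2 * \<gamma>) * ?r z))\<^sup>2
      = ?w z * G n (?h z)"
      unfolding G_def E1_def E2_def inv_density_def \<beta>_def \<tau>_def \<sigma>_def Q_def[symmetric]
      by (rule limit_integrands(1)[OF \<gamma> p])
    show "?h z powr \<beta> * ((D1 (profile \<sigma> (2 ^ n)) (?h z))\<^sup>2 * (\<tau>\<^sup>2 * ?r z * ?h z)) = ?w z * (\<tau>\<^sup>2 * (E1 n (?h z))\<^sup>2)"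
      unfolding E1_def inv_density_def \<beta>_def \<tau>_def \<sigma>_def Q_def[symmetric]
      by (rule limit_integrands(2)[OF \<gamma> p])
  qed
  show ?thesis
  proof (rule that)
    show "D \<ge> 0" by (simp add: D_def)
    show "(\<integral>\<^sup>+z. ennreal (?h z powr (\<beta> + 1) / ?r z *
        (D2 (profile \<sigma> (2 ^ n)) (?h z) * (\<tau>\<^sup>2 * ?r z * ?h z) + D1 (profile \<sigma> (2 ^ n)) (?h z) * (\<tau> * (Q + 2 * \<gamma>) * ?r z))\<^sup>2) \<partial>lborel)
      \<le> ennreal (((Q + \<alpha> - 4) / 2)\<^sup>2 * ((Q - \<alpha>) / 2)\<^sup>2) * (of_nat n * M) + ennreal D * (3 * M)" (is "?L \<le> _") for n
    proof -
      have "?L \<le> (\<integral>\<^sup>+z. ennreal (A\<^sup>2 * B\<^sup>2) * (ennreal (?w z) * indicator (S 1 (2 ^ n)) z) +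
          ennreal D * (ennreal (?w z) * indicator (S (1/2) 1) z + ennreal (?w z) * indicator (S (2 ^ n) (2 ^ n * 4)) z) \<partial>lborel)"
      proof (rule nn_integral_mono_AE, use AE_fst_nonzero in eventually_elim)
        fix z :: "('m,'k) pt" assume z: "fst z \<noteq> 0"
        then have "z \<noteq> 0" by auto
        then have h: "?h z > 0" by (rule gauge_pow_pos[OF \<gamma>])
        have le: "ennreal (?w z * G n (?h z)) \<le> ennreal D * ennreal (?w z)"
        proof -
          have "?w z * G n (?h z) \<le> ?w z * D"
            by (intro mult_left_mono G_le h inv_density_nonneg)
          then have "ennreal (?w z * G n (?h z)) \<le> ennreal (?w z * D)" by (rule ennreal_leI)
          also have "\<dots> = ennreal D * ennreal (?w z)"
            by (simp add: ennreal_mult'' inv_density_nonneg mult.commute[of _ D])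
          finally show ?thesis .
        qed
        have n1: "(1::real) \<le> 2 ^ n" by simp
        consider "?h z < 1/2 \<or> ?h z \<ge> 2 ^ n * 4" | "1/2 \<le> ?h z" "?h z < 1" | "1 \<le> ?h z" "?h z < 2 ^ n"
          | "2 ^ n \<le> ?h z" "?h z < 2 ^ n * 4" by linarith
        then have "ennreal (?w z * G n (?h z)) \<le> ennreal (A\<^sup>2 * B\<^sup>2) * (ennreal (?w z) * indicator (S 1 (2 ^ n)) z) +
          ennreal D * (ennreal (?w z) * indicator (S (1/2) 1) z + ennreal (?w z) * indicator (S (2 ^ n) (2 ^ n * 4)) z)"
        proof cases
          case 1
          then show ?thesis by (simp add: zero)
        next
          case 2
          then have "\<not> 2 ^ n \<le> ?h z" using n1 by linarith
          with 2 have "indicator (S (1/2) 1) z = (1 :: ennreal)" "indicator (S 1 (2 ^ n)) z = (0 :: ennreal)"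
            "indicator (S (2 ^ n) (2 ^ n * 4)) z = (0 :: ennreal)"
            by (simp_all add: S_def)
          then show ?thesis using le by simp
        next
          case 3
          then have "indicator (S (1/2) 1) z = (0 :: ennreal)" "indicator (S 1 (2 ^ n)) z = (1 :: ennreal)"
            "indicator (S (2 ^ n) (2 ^ n * 4)) z = (0 :: ennreal)"
            by (auto simp: S_def)
          moreover have "ennreal (?w z * G n (?h z)) = ennreal (A\<^sup>2 * B\<^sup>2) * ennreal (?w z)"
            unfolding plateau(2)[OF 3] by (subst ennreal_mult''[symmetric]) (auto simp: inv_density_nonneg mult.commute)
          ultimately show ?thesis by simp
        next
          case 4
          then have "1 \<le> ?h z" using n1 by linarith
          with 4 have "indicator (S (1/2) 1) z = (0 :: ennreal)" "indicator (S 1 (2 ^ n)) z = (0 :: ennreal)"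
            "indicator (S (2 ^ n) (2 ^ n * 4)) z = (1 :: ennreal)"
            by (simp_all add: S_def)
          then show ?thesis using le by simp
        qed
        then show "ennreal (?h z powr (\<beta> + 1) / ?r z *
            (D2 (profile \<sigma> (2 ^ n)) (?h z) * (\<tau>\<^sup>2 * ?r z * ?h z) + D1 (profile \<sigma> (2 ^ n)) (?h z) * (\<tau> * (Q + 2 * \<gamma>) * ?r z))\<^sup>2)
          \<le> ennreal (A\<^sup>2 * B\<^sup>2) * (ennreal (?w z) * indicator (S 1 (2 ^ n)) z) +
          ennreal D * (ennreal (?w z) * indicator (S (1/2) 1) z + ennreal (?w z) * indicator (S (2 ^ n) (2 ^ n * 4)) z)"
          unfolding eqs[OF z] .
      qed
      also have "\<dots> = ennreal (A\<^sup>2 * B\<^sup>2) * (of_nat n * M) + ennreal D * (M + 2 * M)"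
        by (simp add: nn_integral_add nn_integral_cmult S shells shell_mass_dyadic[OF \<gamma>] M_def[symmetric])
      also have "M + 2 * M = 3 * M" by (simp add: distrib_right[of 1 2 M, simplified, symmetric])
      finally show ?thesis unfolding A_def B_def .
    qed
    show "ennreal (((Q + \<alpha> - 4) / 2)\<^sup>2) * (of_nat n * M) \<le>
      (\<integral>\<^sup>+z. ennreal (?h z powr \<beta> * ((D1 (profile \<sigma> (2 ^ n)) (?h z))\<^sup>2 * (\<tau>\<^sup>2 * ?r z * ?h z))) \<partial>lborel)" (is "_ \<le> ?R") for n
    proof -
      have "ennreal (A\<^sup>2) * (of_nat n * M) = (\<integral>\<^sup>+z. ennreal (A\<^sup>2) * (ennreal (?w z) * indicator (S 1 (2 ^ n)) z) \<partial>lborel)"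
        by (simp add: nn_integral_cmult S shell_mass_dyadic[OF \<gamma>] M_def[symmetric])
      also have "\<dots> \<le> ?R"
      proof (rule nn_integral_mono_AE, use AE_fst_nonzero in eventually_elim)
        fix z :: "('m,'k) pt" assume z: "fst z \<noteq> 0"
        show "ennreal (A\<^sup>2) * (ennreal (?w z) * indicator (S 1 (2 ^ n)) z)
          \<le> ennreal (?h z powr \<beta> * ((D1 (profile \<sigma> (2 ^ n)) (?h z))\<^sup>2 * (\<tau>\<^sup>2 * ?r z * ?h z)))"
        proof (cases "z \<in> S 1 (2 ^ n)")
          case True
          then have "E1 n (?h z) = - \<sigma>" by (intro plateau) (auto simp: S_def)
          then have "\<tau>\<^sup>2 * (E1 n (?h z))\<^sup>2 = A\<^sup>2" unfolding \<sigma>[symmetric] by (simp add: power_mult_distrib)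
          then have "ennreal (A\<^sup>2) * ennreal (?w z) = ennreal (?w z * (\<tau>\<^sup>2 * (E1 n (?h z))\<^sup>2))"
            by (subst ennreal_mult''[symmetric]) (auto simp: inv_density_nonneg mult.commute)
          then show ?thesis using True unfolding eqs[OF z] by simp
        qed simp
      qed
      finally show ?thesis unfolding A_def .
    qed
  qed
qed

theorem theorem4p5:
  fixes \<gamma> \<alpha> :: real
  assumes "\<gamma> > 0"
    and "2 < \<alpha>" and "\<alpha> < hom_dim \<gamma> TYPE(('m::finite,'k::finite) pt)"
  shows "(\<forall>\<phi> :: ('m,'k) pt \<Rightarrow> real. test_fun \<phi> \<longrightarrow>
            lhs_int \<gamma> \<alpha> \<phi> \<ge> ennreal ((hom_dim \<gamma> TYPE(('m,'k) pt) - \<alpha>)\<^sup>2 / 4) * rhs_int \<gamma> \<alpha> \<phi>)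
       \<and> (INF \<phi> \<in> {\<phi> :: ('m,'k) pt \<Rightarrow> real. test_fun \<phi> \<and> \<phi> \<noteq> (\<lambda>z. 0)}.
            lhs_int \<gamma> \<alpha> \<phi> / rhs_int \<gamma> \<alpha> \<phi>)
         = ennreal ((hom_dim \<gamma> TYPE(('m,'k) pt) - \<alpha>)\<^sup>2 / 4)"
proof -
  define Q where "Q = hom_dim \<gamma> TYPE(('m,'k) pt)"
  define A K where "A = (Q + \<alpha> - 4) / 2" and "K = (Q - \<alpha>)\<^sup>2 / 4"
  let ?I = "INF \<phi> \<in> {\<phi> :: ('m,'k) pt \<Rightarrow> real. test_fun \<phi> \<and> \<phi> \<noteq> (\<lambda>z. 0)}. lhs_int \<gamma> \<alpha> \<phi> / rhs_int \<gamma> \<alpha> \<phi>"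
  have A: "A > 0" using assms by (simp add: A_def Q_def)
  have ineq: "ennreal K * rhs_int \<gamma> \<alpha> \<phi> \<le> lhs_int \<gamma> \<alpha> \<phi>" if "test_fun \<phi>" for \<phi> :: "('m,'k) pt \<Rightarrow> real"
    unfolding K_def Q_def by (rule grushin_rellich(1)[OF assms that])
  \<comment> \<open>Division in \<open>ennreal\<close> can be undone only because the denominator is
    neither 0 nor infinite.\<close>
  have rhs: "rhs_int \<gamma> \<alpha> \<phi> \<noteq> 0" "rhs_int \<gamma> \<alpha> \<phi> \<noteq> top"
    if "test_fun \<phi>" "\<phi> \<noteq> (\<lambda>z. 0)" for \<phi> :: "('m,'k) pt \<Rightarrow> real"
    using grushin_rellich(2)[OF assms that] rhs_int_eq[OF assms(1) that(1), of \<alpha>] by auto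
  have cancel: "c * rhs_int \<gamma> \<alpha> \<phi> \<le> lhs_int \<gamma> \<alpha> \<phi> \<longleftrightarrow> c \<le> lhs_int \<gamma> \<alpha> \<phi> / rhs_int \<gamma> \<alpha> \<phi>"
    if "test_fun \<phi>" "\<phi> \<noteq> (\<lambda>z. 0)" for \<phi> :: "('m,'k) pt \<Rightarrow> real" and c
  proof
    assume "c * rhs_int \<gamma> \<alpha> \<phi> \<le> lhs_int \<gamma> \<alpha> \<phi>"
    then have "c * rhs_int \<gamma> \<alpha> \<phi> / rhs_int \<gamma> \<alpha> \<phi> \<le> lhs_int \<gamma> \<alpha> \<phi> / rhs_int \<gamma> \<alpha> \<phi>"
      by (rule divide_right_mono_ennreal)
    then show "c \<le> lhs_int \<gamma> \<alpha> \<phi> / rhs_int \<gamma> \<alpha> \<phi>"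
      using rhs[OF that] by (simp add: ennreal_mult_divide_eq)
  next
    assume "c \<le> lhs_int \<gamma> \<alpha> \<phi> / rhs_int \<gamma> \<alpha> \<phi>"
    then have "c * rhs_int \<gamma> \<alpha> \<phi> \<le> lhs_int \<gamma> \<alpha> \<phi> / rhs_int \<gamma> \<alpha> \<phi> * rhs_int \<gamma> \<alpha> \<phi>"
      by (rule mult_right_mono) simp
    then show "c * rhs_int \<gamma> \<alpha> \<phi> \<le> lhs_int \<gamma> \<alpha> \<phi>"
      using rhs[OF that] by (simp add: ennreal_divide_times ennreal_divide_self less_top)
  qed
  have "ennreal K \<le> ?I"
    using ineq cancel by (intro INF_greatest) auto
  moreover have "?I \<le> ennreal K"
  proof (rule ccontr)
    assume "\<not> ?I \<le> ennreal K"
    then have "ennreal K < ?I" by simp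
    \<comment> \<open>An infimum above K would make the inequality hold for all nonzero test
      functions with some larger constant c. Being below the infimum, y is finite, so c can be taken
      real.\<close>
    then obtain y where y: "ennreal K < y" "y < ?I" using dense by blast
    define c where "c = enn2real y"
    have c: "ennreal c = y" using order.strict_trans2[OF y(2) top_greatest] by (simp add: c_def)
    have cK: "c > K"
    proof (rule ccontr)
      assume "\<not> c > K"
      then have "ennreal c \<le> ennreal K" by (intro ennreal_leI) simp
      then show False using y(1) c by simp
    qed
    define \<sigma> where "\<sigma> = A / (2*(1+\<gamma>))"
    obtain D where D: "D \<ge> 0"
      "\<And>n. (\<integral>\<^sup>+z. ennreal (gauge_pow \<gamma> (z :: ('m,'k) pt) powr ((\<alpha> - 2) / (2*(1+\<gamma>)) + 1) / norm (fst z) powr (2*\<gamma>) *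
        (D2 (profile \<sigma> (2 ^ n)) (gauge_pow \<gamma> z) * ((2*(1+\<gamma>))\<^sup>2 * norm (fst z) powr (2*\<gamma>) * gauge_pow \<gamma> z)
         + D1 (profile \<sigma> (2 ^ n)) (gauge_pow \<gamma> z) * (2*(1+\<gamma>) * (Q + 2 * \<gamma>) * norm (fst z) powr (2*\<gamma>)))\<^sup>2) \<partial>lborel)
      \<le> ennreal (A\<^sup>2 * ((Q - \<alpha>) / 2)\<^sup>2) * (of_nat n * shell_mass \<gamma> TYPE(('m,'k) pt) 1 2) + ennreal D * (3 * shell_mass \<gamma> TYPE(('m,'k) pt) 1 2)"
      "\<And>n. ennreal (A\<^sup>2) * (of_nat n * shell_mass \<gamma> TYPE(('m,'k) pt) 1 2) \<le>
      (\<integral>\<^sup>+z. ennreal (gauge_pow \<gamma> (z :: ('m,'k) pt) powr ((\<alpha> - 2) / (2*(1+\<gamma>))) *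
        ((D1 (profile \<sigma> (2 ^ n)) (gauge_pow \<gamma> z))\<^sup>2 * ((2*(1+\<gamma>))\<^sup>2 * norm (fst z) powr (2*\<gamma>) * gauge_pow \<gamma> z))) \<partial>lborel)"
    proof (rule limit_integral_estimates[OF assms(1), where \<alpha> = \<alpha> and 'm = 'm and 'k = 'k, folded Q_def, folded A_def, folded \<sigma>_def], goal_cases)
      case (1 D)
      show ?case by (rule 1(1)[OF 1(2-4)])
    qed
    obtain m where m: "shell_mass \<gamma> TYPE(('m,'k) pt) 1 2 = ennreal m" "m > 0"
    proof
      show "shell_mass \<gamma> TYPE(('m,'k) pt) 1 2 = ennreal (enn2real (shell_mass \<gamma> TYPE(('m,'k) pt) 1 2))"
        using shell_mass_finite[OF assms(1), where 'm = 'm and 'k = 'k] by (simp add: less_top)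
      show "enn2real (shell_mass \<gamma> TYPE(('m,'k) pt) 1 2) > 0"
        using shell_mass_finite[OF assms(1), where 'm = 'm and 'k = 'k] shell_mass_pos[OF assms(1), where 'm = 'm and 'k = 'k]
        by (simp add: enn2real_positive_iff)
    qed
    \<comment> \<open>For fixed n, letting b tend to 0 carries the inequality with constant c over
      to the limit integrals. Their estimates give c A^2 n m <= K A^2 n m + 3 D m, and m > 0
      cancels.\<close>
    have "(c - K) * A\<^sup>2 * real n \<le> 3 * D" for n
    proof -
      let ?f = "\<lambda>i (z :: ('m,'k) pt). profile \<sigma> (2 ^ n) (trial_gauge \<gamma> (inverse (real (Suc i))) z)"
      have tf: "test_fun (?f i)" "?f i \<noteq> (\<lambda>z. 0)" for i
        using profile_test_fun[OF assms(1), of "inverse (real (Suc i))" "2 ^ n" \<sigma>] by (auto simp: inverse_le_1_iff)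
      have "ennreal c * rhs_int \<gamma> \<alpha> (?f i) \<le> lhs_int \<gamma> \<alpha> (?f i)" for i
      proof -
        have "?I \<le> lhs_int \<gamma> \<alpha> (?f i) / rhs_int \<gamma> \<alpha> (?f i)"
          by (rule INF_lower) (use tf in blast)
        then show ?thesis unfolding cancel[OF tf] c using y(2) by order
      qed
      note lim = trial_integral_limits[OF assms(1,2), of "2 ^ n" \<sigma>, where 'm = 'm and 'k = 'k, folded Q_def]
      have "ennreal (A\<^sup>2) * (of_nat n * ennreal m) * ennreal c
          \<le> ennreal (A\<^sup>2 * ((Q - \<alpha>) / 2)\<^sup>2) * (of_nat n * ennreal m) + ennreal D * (3 * ennreal m)"
      proof -
        have "ennreal c * (\<integral>\<^sup>+z. ennreal (gauge_pow \<gamma> (z :: ('m,'k) pt) powr ((\<alpha> - 2) / (2*(1+\<gamma>))) *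
          ((D1 (profile \<sigma> (2 ^ n)) (gauge_pow \<gamma> z))\<^sup>2 * ((2*(1+\<gamma>))\<^sup>2 * norm (fst z) powr (2*\<gamma>) * gauge_pow \<gamma> z))) \<partial>lborel)
          \<le> (\<integral>\<^sup>+z. ennreal (gauge_pow \<gamma> (z :: ('m,'k) pt) powr ((\<alpha> - 2) / (2*(1+\<gamma>)) + 1) / norm (fst z) powr (2*\<gamma>) *
        (D2 (profile \<sigma> (2 ^ n)) (gauge_pow \<gamma> z) * ((2*(1+\<gamma>))\<^sup>2 * norm (fst z) powr (2*\<gamma>) * gauge_pow \<gamma> z)
         + D1 (profile \<sigma> (2 ^ n)) (gauge_pow \<gamma> z) * (2*(1+\<gamma>) * (Q + 2 * \<gamma>) * norm (fst z) powr (2*\<gamma>)))\<^sup>2) \<partial>lborel)"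
          by (rule LIMSEQ_le[OF ennreal_tendsto_cmult[OF _ lim(2)] lim(1)]) (use \<open>\<And>i. ennreal c * rhs_int \<gamma> \<alpha> (?f i) \<le> lhs_int \<gamma> \<alpha> (?f i)\<close> in auto)
        from order_trans[OF mult_left_mono[OF D(3)[of n], of "ennreal c"] order_trans[OF this D(2)[of n]]]
        show ?thesis by (simp add: m(1) ac_simps)
      qed
      also have "ennreal (A\<^sup>2) * (of_nat n * ennreal m) * ennreal c = ennreal (A\<^sup>2 * (real n * m) * c)"
        using m(2) by (simp add: ennreal_mult'' ennreal_mult' ennreal_of_nat_eq_real_of_nat)
      also have "ennreal (A\<^sup>2 * ((Q - \<alpha>) / 2)\<^sup>2) * (of_nat n * ennreal m) + ennreal D * (3 * ennreal m)
          = ennreal (A\<^sup>2 * K * (real n * m) + D * (3 * m))"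
      proof -
        have "((Q - \<alpha>) / 2)\<^sup>2 = K" by (simp add: K_def power_divide)
        moreover have "of_nat n * ennreal m = ennreal (real n * m)"
          by (simp add: ennreal_mult' ennreal_of_nat_eq_real_of_nat)
        moreover have "3 * ennreal m = ennreal (3 * m)" by (simp add: ennreal_mult')
        moreover have "K \<ge> 0" by (simp add: K_def)
        ultimately show ?thesis using m(2) D(1)
          by (simp add: ennreal_mult'[symmetric] ennreal_plus[symmetric] del: ennreal_plus)
      qed
      finally have "A\<^sup>2 * (real n * m) * c \<le> A\<^sup>2 * K * (real n * m) + D * (3 * m)"
        using m(2) D(1) by (subst (asm) ennreal_le_iff) (auto simp: K_def)
      then have "((c - K) * A\<^sup>2 * real n) * m \<le> (3 * D) * m" by (simp add: algebra_simps)
      then show ?thesis using m(2) by simp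
    qed
    \<comment> \<open>As c > K and A > 0, the left-hand side grows linearly in n, whereas D does not
      depend on n.\<close>
    moreover obtain n :: nat where "real n > 3 * D / ((c - K) * A\<^sup>2)" using reals_Archimedean2 by blast
    then have "(c - K) * A\<^sup>2 * real n > 3 * D"
      using cK A by (simp add: pos_divide_less_eq mult.commute)
    ultimately show False using not_less by blast
  qed
  ultimately have "?I = ennreal K" by (rule antisym[rotated])
  then show ?thesis using ineq unfolding K_def Q_def by blast
qed

end
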